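(* Let $d\ge1$, $p>d+1$, $L>0$, and let $$J_c=\int_{\mathbb R^d}|\zeta_1|\,K(\zeta)\,d\zeta,\qquad \zeta_1=\langle\zeta,e_1\rangle .$$ For every $J\ge J_c$ one has $\tilde{\mathcal F}_{J,p,d}(E,[0,L)^d)\ge0$ for every $[0,L)^d$-periodic set $E\subset\mathbb R^d$ of locally finite perimeter, and $\tilde{\mathcal F}_{J,p,d}(E,[0,L)^d)=0$ if and only if $E=\emptyset$ or $E=\mathbb R^d$.
   Context: Sets are identified when they differ by a Lebesgue null set. The functional is $$\tilde{\mathcal F}_{J,p,d}(E,\Omega)=\frac1{|\Omega|}\Bigl[J\,\mathrm{Per}(E;\Omega)-\int_\Omega\int_{\mathbb R^d}|\chi_E(x+\zeta)-\chi_E(x)|K(\zeta)\,d\zeta\,dx\Bigr],\qquad \Omega=[0,L)^d,$$ with $\mathrm{Per}(\cdot,\Omega)$ the classical isotropic perimeter relative to $\Omega$. The kernel $K$ is rotation invariant, integrable, with $p$-power law decay: $\frac1{C(\|\zeta\|+1)^p}\le K(\zeta)\le\frac{C}{(\|\zeta\|+1)^p}$ for some constant $C$; the model is $K(\zeta)=1/\max(1,\|\zeta\|^p)$. *)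

theory Defs
  imports "HOL-Analysis.Analysis"
begin

definition ae_eq_set :: "(real ^ 'n) set \<Rightarrow> (real ^ 'n) set \<Rightarrow> bool" where
  "ae_eq_set A B \<longleftrightarrow> (A - B) \<union> (B - A) \<in> null_sets lebesgue"

definition cube :: "real \<Rightarrow> (real ^ 'n) set" where
  "cube L = {x. \<forall>i. 0 \<le> x $ i \<and> x $ i < L}"

text \<open>Since sets are identified modulo null sets, periodicity is only required modulo null sets.\<close>

definition periodic_set :: "real \<Rightarrow> (real ^ 'n) set \<Rightarrow> bool" where
  "periodic_set L E \<longleftrightarrow>
     (\<forall>z :: real ^ 'n. (\<forall>i. z $ i \<in> \<int>) \<longrightarrow> ae_eq_set ((\<lambda>x. x + L *\<^sub>R z) ` E) E)"

definition divergence :: "(real ^ 'n \<Rightarrow> real ^ 'n) \<Rightarrow> real ^ 'n \<Rightarrow> real" where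
  "divergence \<phi> x = trace (jacobian \<phi> (at x))"

definition test_fields :: "(real ^ 'n) set \<Rightarrow> (real ^ 'n \<Rightarrow> real ^ 'n) set" where
  "test_fields A = {\<phi>. (\<forall>x. \<phi> differentiable (at x)) \<and>
     continuous_on UNIV (\<lambda>x. jacobian \<phi> (at x)) \<and>
     compact (closure {x. \<phi> x \<noteq> 0}) \<and> closure {x. \<phi> x \<noteq> 0} \<subseteq> A \<and>
     (\<forall>x. norm (\<phi> x) \<le> 1)}"

text \<open>De Giorgi's variation of the indicator function of \<open>E\<close> in an open set \<open>A\<close>.\<close>

definition variation :: "(real ^ 'n) set \<Rightarrow> (real ^ 'n) set \<Rightarrow> ereal" where
  "variation E A = (SUP \<phi>\<in>test_fields A. ereal (LINT x:E|lebesgue. divergence \<phi> x))"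

text \<open>
  The relative perimeter in an arbitrary (Borel) set is the total variation measure of the
  distributional gradient of the indicator function, obtained from the open sets by outer
  regularity. The extension beyond open sets matters here: the half-open cube \<open>cube L\<close> is not
  open, and the part of the reduced boundary of \<open>E\<close> on those faces which belong to \<open>cube L\<close>
  has to be counted.
\<close>

definition perimeter :: "(real ^ 'n) set \<Rightarrow> (real ^ 'n) set \<Rightarrow> ereal" where
  "perimeter E B = (INF A\<in>{A. open A \<and> B \<subseteq> A}. variation E A)"

definition locally_finite_perimeter :: "(real ^ 'n) set \<Rightarrow> bool" where
  "locally_finite_perimeter E \<longleftrightarrow>
     E \<in> sets lebesgue \<and> (\<forall>C. compact C \<longrightarrow> perimeter E C < \<infinity>)"

text \<open>
  Rotation invariance refers to orthogonal matrices of determinant \<open>1\<close>; in dimension one this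
  condition is void, so that no symmetry of the kernel is assumed there.
\<close>

definition admissible_kernel :: "real \<Rightarrow> (real ^ 'n \<Rightarrow> real) \<Rightarrow> bool" where
  "admissible_kernel p K \<longleftrightarrow>
     integrable lebesgue K \<and>
     (\<forall>Q z. rotation_matrix Q \<longrightarrow> K (Q *v z) = K z) \<and>
     (\<exists>C>0. \<forall>z. 1 / (C * (norm z + 1) powr p) \<le> K z \<and> K z \<le> C / (norm z + 1) powr p)"

text \<open>
  The dimension is \<open>CARD('n)\<close>. A finite index type has no distinguished first element, so the
  coordinate direction singled out in the critical constant is a parameter.
\<close>

definition J_crit :: "(real ^ 'n \<Rightarrow> real) \<Rightarrow> 'n \<Rightarrow> real" where
  "J_crit K i = (\<integral>z. \<bar>z $ i\<bar> * K z \<partial>lebesgue)"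

definition nonlocal_term :: "(real ^ 'n \<Rightarrow> real) \<Rightarrow> (real ^ 'n) set \<Rightarrow> (real ^ 'n) set \<Rightarrow> real" where
  "nonlocal_term K E \<Omega> = (LINT x:\<Omega>|lebesgue.
     (\<integral>z. \<bar>indicat_real E (x + z) - indicat_real E x\<bar> * K z \<partial>lebesgue))"

definition functional :: "real \<Rightarrow> (real ^ 'n \<Rightarrow> real) \<Rightarrow> (real ^ 'n) set \<Rightarrow> (real ^ 'n) set \<Rightarrow> ereal" where
  "functional J K E \<Omega> =
     ereal (1 / measure lebesgue \<Omega>) * (ereal J * perimeter E \<Omega> - ereal (nonlocal_term K E \<Omega>))"

end

theory Submission
  imports Defs
begin

text \<open>
  Let \<open>e\<close> be the indicator function of \<open>E\<close> and let the translation defect \<open>N(\<zeta>)\<close> be the integral of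
  \<open>\<bar>e(x + \<zeta>) - e(x)\<bar>\<close> over one period cell, so that the nonlocal term is \<open>\<integral> N(\<zeta>) K(\<zeta>) d\<zeta>\<close>.
  For a set with a measure theoretic normal \<open>\<nu>\<close>, the defect \<open>N(\<zeta>)\<close> is at most the integral of
  \<open>\<bar>\<nu> \<bullet> \<zeta>\<bar>\<close> over the boundary, and integration against \<open>K\<close> turns \<open>\<bar>\<nu> \<bullet> \<zeta>\<bar>\<close> into the critical
  constant \<open>J\<^sub>c\<close>, whatever \<open>\<nu>\<close> is, by rotation invariance. As the perimeter is defined by duality, this inequality is proved
  without normals, by a calibration: the periodic field

  \<open>\<psi>(y) = \<integral> K(\<zeta>) \<zeta> \<integral>\<^sub>0\<^sup>1 (e(y - t\<zeta>) - e(y - t\<zeta> + \<zeta>)) dt d\<zeta>\<close>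

  has length at most \<open>J\<^sub>c\<close>, because the inner integral lies between \<open>-1\<close> and \<open>1\<close>; and by the
  fundamental theorem of calculus along the segments in direction \<open>\<zeta>\<close> the integral of its formal
  divergence over the part of \<open>E\<close> in a cell is \<open>\<integral> N(\<zeta>) K(\<zeta>) d\<zeta>\<close>, since
  \<open>(e(x + \<zeta>) - e(x))\<^sup>2 = \<bar>e(x + \<zeta>) - e(x)\<bar>\<close>. To obtain an admissible test field, \<open>\<psi>\<close> is cut off to a
  fundamental domain of the lattice and mollified (\<open>pairing_le_variation\<close>); the error of the
  mollification is controlled by the defects of small translations (\<open>pairing_lower_bound\<close>). The
  result is \<open>integral_translation_defect_le_variation\<close>, for an arbitrary finite measure with
  finite first moment in place of \<open>K(\<zeta>) d\<zeta>\<close>.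

  This freedom yields the strict inequality. The defect \<open>N\<close> is periodic, so a little mass of \<open>K\<close>
  around each lattice vector \<open>L e\<^sub>j\<close> can be moved to a ball around the origin without changing
  \<open>\<integral> N(\<zeta>) K(\<zeta>) d\<zeta>\<close>, while \<open>\<integral> \<bar>\<zeta> \<bullet> v\<bar> K(\<zeta>) d\<zeta>\<close> drops by a definite amount for all unit vectors
  \<open>v\<close> (\<open>kernel_mass_transfer\<close>). Hence the nonlocal term is at most \<open>c\<close> times the perimeter for some
  \<open>c < J\<^sub>c\<close>. If the functional vanishes for some \<open>J \<ge> J\<^sub>c\<close>, then the perimeter and the nonlocal term
  vanish, so \<open>N = 0\<close> almost everywhere, and averaging \<open>N\<close> over a cell shows that \<open>E\<close> or its
  complement is a null set (\<open>integral_translation_defect_zero\<close>). Conversely both terms vanish for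
  these two sets; for the whole space this is the divergence theorem for compactly supported fields.
\<close>

section \<open>Integration of periodic functions over a cell\<close>

definition lattice :: "(real ^ 'n) set" where
  "lattice = {z. \<forall>i. z $ i \<in> \<int>}"

text \<open>
  The Lebesgue measure on one period is taken as a measure on the whole space, so that products with
  other measures and translated integrands stay on the same measurable space.
\<close>

definition cell :: "real \<Rightarrow> (real ^ 'n) measure" where
  "cell L = density lborel (indicator (cube L))"

definition periodic :: "real \<Rightarrow> (real ^ 'n \<Rightarrow> 'b) \<Rightarrow> bool" where
  "periodic L f \<longleftrightarrow> (\<forall>z\<in>lattice. \<forall>x. f (x + L *\<^sub>R z) = f x)"

lemma periodicD: "periodic L f \<Longrightarrow> z \<in> lattice \<Longrightarrow> f (x + L *\<^sub>R z) = f x"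
  by (simp add: periodic_def)

lemma countable_lattice: "countable (lattice :: (real ^ 'n) set)"
  unfolding lattice_def by (rule countable_vector) (auto simp: Ints_def)

lemma zero_in_lattice [simp]: "0 \<in> lattice"
  by (simp add: lattice_def)

lemma minus_in_lattice_iff [simp]: "- z \<in> lattice \<longleftrightarrow> z \<in> lattice"
  by (simp add: lattice_def)

lemma lattice_add: "y \<in> lattice \<Longrightarrow> z \<in> lattice \<Longrightarrow> y + z \<in> lattice"
  and lattice_diff: "y \<in> lattice \<Longrightarrow> z \<in> lattice \<Longrightarrow> y - z \<in> lattice"
  by (simp_all add: lattice_def)

lemma axis_in_lattice [simp]: "axis j 1 \<in> lattice"
  by (auto simp: lattice_def axis_def)

lemma cube_translate_ex1:
  fixes x :: "real ^ 'n"
  assumes "L > 0"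
  shows "\<exists>!z. z \<in> lattice \<and> x + L *\<^sub>R z \<in> cube L"
proof -
  have *: "0 \<le> a + L * of_int k \<and> a + L * of_int k < L \<longleftrightarrow> k = - \<lfloor>a / L\<rfloor>" for a and k :: int
  proof -
    have "0 \<le> a + L * of_int k \<and> a + L * of_int k < L \<longleftrightarrow>
        of_int (- k) \<le> a / L \<and> a / L < of_int (- k) + 1"
      using assms by (auto simp: field_simps)
    also have "\<dots> \<longleftrightarrow> \<lfloor>a / L\<rfloor> = - k"
      by (simp add: floor_eq_iff)
    finally show ?thesis by auto
  qed
  have "z \<in> lattice \<and> x + L *\<^sub>R z \<in> cube L \<longleftrightarrow> z = (\<chi> i. of_int (- \<lfloor>x $ i / L\<rfloor>))" for z
  proof
    assume z: "z \<in> lattice \<and> x + L *\<^sub>R z \<in> cube L"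
    have "z $ i = of_int (- \<lfloor>x $ i / L\<rfloor>)" for i
    proof -
      from z obtain k where k: "z $ i = of_int k" by (auto simp: lattice_def Ints_def)
      moreover from z have "0 \<le> x $ i + L * z $ i \<and> x $ i + L * z $ i < L"
        by (simp add: cube_def)
      ultimately show ?thesis using *[of "x $ i" k] by simp
    qed
    then show "z = (\<chi> i. of_int (- \<lfloor>x $ i / L\<rfloor>))" by (simp add: vec_eq_iff)
  next
    assume z: "z = (\<chi> i. of_int (- \<lfloor>x $ i / L\<rfloor>))"
    have "0 \<le> x $ i + L * z $ i \<and> x $ i + L * z $ i < L" for i
      using *[of "x $ i" "- \<lfloor>x $ i / L\<rfloor>"] z by simp
    moreover have "z $ i \<in> \<int>" for i
      using z by simp
    ultimately show "z \<in> lattice \<and> x + L *\<^sub>R z \<in> cube L"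
      by (simp add: cube_def lattice_def)
  qed
  then show ?thesis by simp
qed

lemma nn_integral_lattice_indicator:
  fixes x :: "real ^ 'n"
  assumes "\<exists>!z. z \<in> lattice \<and> x + L *\<^sub>R z \<in> D"
  shows "(\<integral>\<^sup>+z. indicator D (x + L *\<^sub>R z) \<partial>count_space lattice) = 1"
proof -
  obtain z0 where z0: "z0 \<in> lattice" "x + L *\<^sub>R z0 \<in> D"
    and uniq: "\<And>z. z \<in> lattice \<Longrightarrow> x + L *\<^sub>R z \<in> D \<Longrightarrow> z = z0"
    using assms by metis
  have "(\<integral>\<^sup>+z. indicator D (x + L *\<^sub>R z) \<partial>count_space lattice)
      = (\<integral>\<^sup>+z. indicator {z0} z \<partial>count_space lattice)"
  proof (rule nn_integral_cong)
    fix z :: "real ^ 'n" assume "z \<in> space (count_space lattice)"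
    then have "z \<in> lattice" by simp
    then have "x + L *\<^sub>R z \<in> D \<longleftrightarrow> z = z0"
      using z0 uniq by metis
    then show "(indicator D (x + L *\<^sub>R z) :: ennreal) = indicator {z0} z"
      by (simp add: indicator_def)
  qed
  also have "\<dots> = 1" using z0 by simp
  finally show ?thesis .
qed

lemmas nn_integral_lattice_indicator_cube = nn_integral_lattice_indicator[OF cube_translate_ex1]

lemma cube_measurable [measurable]: "cube L \<in> sets borel"
proof -
  have "cube L = (\<Inter>i. {x. 0 \<le> x $ i} \<inter> {x. x $ i < L})"
    by (auto simp: cube_def)
  also have "\<dots> \<in> sets borel"
    by (intro sets.countable_INT'' sets.Int borel_closed borel_open closed_Collect_le
        open_Collect_less continuous_intros) auto
  finally show ?thesis .
qed

lemma sets_cell [simp, measurable_cong]: "sets (cell L) = sets borel"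
  by (simp add: cell_def)

lemma space_cell [simp]: "space (cell L) = UNIV"
  by (simp add: cell_def)

lemma emeasure_lborel_cube:
  assumes "L > 0"
  shows "emeasure lborel (cube L :: (real ^ 'n) set) = ennreal (L ^ CARD('n))"
proof -
  have box: "x \<in> box 0 (\<chi> i. L) \<longleftrightarrow> (\<forall>i. 0 < x $ i \<and> x $ i < L)" for x :: "real ^ 'n"
    by (auto simp: mem_box_cart)
  have cbox: "x \<in> cbox 0 (\<chi> i. L) \<longleftrightarrow> (\<forall>i. 0 \<le> x $ i \<and> x $ i \<le> L)" for x :: "real ^ 'n"
    by (auto simp: mem_box_cart)
  have inner: "(\<chi> i. L) \<bullet> b = L" if "b \<in> Basis" for b :: "real ^ 'n"
    using that by (auto simp: Basis_vec_def inner_axis)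
  have "emeasure lborel (box 0 (\<chi> i. L) :: (real ^ 'n) set) = ennreal (L ^ CARD('n))"
    using assms by (subst emeasure_lborel_box) (auto simp: inner)
  moreover have "emeasure lborel (cbox 0 (\<chi> i. L) :: (real ^ 'n) set) = ennreal (L ^ CARD('n))"
    using assms by (subst emeasure_lborel_cbox) (auto simp: inner)
  moreover have "box 0 (\<chi> i. L) \<subseteq> (cube L :: (real ^ 'n) set)"
    by (auto simp: box cube_def less_imp_le)
  moreover have "(cube L :: (real ^ 'n) set) \<subseteq> cbox 0 (\<chi> i. L)"
    by (auto simp: cbox cube_def less_imp_le)
  ultimately show ?thesis
    using emeasure_mono[of "box 0 (\<chi> i. L)" "cube L :: (real ^ 'n) set" lborel]
      emeasure_mono[of "cube L" "cbox 0 (\<chi> i. L) :: (real ^ 'n) set" lborel]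
    by (intro antisym) simp_all
qed

lemma emeasure_cell_space:
  assumes "L > 0"
  shows "emeasure (cell L :: (real ^ 'n) measure) UNIV = ennreal (L ^ CARD('n))"
  unfolding cell_def using emeasure_lborel_cube[OF assms, where 'n = 'n]
  by (simp add: emeasure_density)

lemma finite_measure_cell: "L > 0 \<Longrightarrow> finite_measure (cell L)"
  by (rule finite_measureI) (simp add: emeasure_cell_space)

lemma nn_integral_cell:
  assumes [measurable]: "f \<in> borel_measurable borel"
  shows "(\<integral>\<^sup>+x. f x \<partial>cell L) = (\<integral>\<^sup>+x. f x * indicator (cube L) x \<partial>lborel)"
  unfolding cell_def by (subst nn_integral_density) (simp_all add: mult.commute)

lemma nn_integral_lborel_translate:
  assumes [measurable]: "f \<in> borel_measurable borel"
  shows "(\<integral>\<^sup>+x. f (x + a) \<partial>lborel) = (\<integral>\<^sup>+x. f x \<partial>(lborel :: (real ^ 'n) measure))"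
proof -
  have "(\<integral>\<^sup>+x. f x \<partial>lborel) = (\<integral>\<^sup>+x. f x \<partial>distr lborel borel ((+) a))"
    by (subst lborel_distr_plus) simp
  also have "\<dots> = (\<integral>\<^sup>+x. f (x + a) \<partial>lborel)"
    by (subst nn_integral_distr) (simp_all add: add.commute)
  finally show ?thesis by simp
qed

lemma integral_lborel_translate:
  fixes f :: "real ^ 'n \<Rightarrow> 'b :: {banach, second_countable_topology}"
  assumes [measurable]: "f \<in> borel_measurable borel"
  shows "(\<integral>x. f (x + a) \<partial>lborel) = (\<integral>x. f x \<partial>lborel)"
proof -
  have "(\<integral>x. f x \<partial>lborel) = (\<integral>x. f x \<partial>distr lborel borel ((+) a))"
    by (subst lborel_distr_plus) simp
  also have "\<dots> = (\<integral>x. f (x + a) \<partial>lborel)"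
    by (subst integral_distr) (simp_all add: add.commute)
  finally show ?thesis by simp
qed

lemma integrable_lborel_translate:
  fixes f :: "real ^ 'n \<Rightarrow> 'b :: {banach, second_countable_topology}"
  assumes "integrable lborel f"
  shows "integrable lborel (\<lambda>x. f (x + a))"
proof -
  have "integrable (distr lborel borel ((+) a)) f"
    using assms by (subst lborel_distr_plus)
  then have "integrable lborel (\<lambda>x. f (a + x))"
    by (subst (asm) integrable_distr_eq) (use assms in auto)
  then show ?thesis by (simp add: add.commute)
qed

text \<open>
  If the lattice translates of a weight \<open>w\<close> add up to one, then so do those of the indicator
  function of the cube; inserting either sum and moving all pieces by lattice vectors shows that
  both weights integrate a periodic function to the same value. Indicator functions of translated
  cubes and of other fundamental domains are the weights of interest.
\<close>

lemma nn_integral_cell_eq_weight: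
  fixes f w :: "real ^ 'n \<Rightarrow> ennreal"
  assumes L: "L > 0" and [measurable]: "f \<in> borel_measurable borel" "w \<in> borel_measurable borel"
    and f: "periodic L f" and w: "\<And>x. (\<integral>\<^sup>+z. w (x + L *\<^sub>R z) \<partial>count_space lattice) = 1"
  shows "(\<integral>\<^sup>+x. f x * w x \<partial>lborel) = (\<integral>\<^sup>+x. f x \<partial>cell L)"
proof -
  let ?Q = "indicator (cube L) :: real ^ 'n \<Rightarrow> ennreal"
  have "(\<integral>\<^sup>+x. f x * w x \<partial>lborel)
      = (\<integral>\<^sup>+x. f x * w x * (\<integral>\<^sup>+z. ?Q (x + L *\<^sub>R z) \<partial>count_space lattice) \<partial>lborel)"
    by (simp add: nn_integral_lattice_indicator_cube[OF L])
  also have "\<dots> = (\<integral>\<^sup>+x. \<integral>\<^sup>+z. f x * w x * ?Q (x + L *\<^sub>R z) \<partial>count_space lattice \<partial>lborel)"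
    by (simp add: nn_integral_cmult)
  also have "\<dots> = (\<integral>\<^sup>+z. \<integral>\<^sup>+x. f x * w x * ?Q (x + L *\<^sub>R z) \<partial>lborel \<partial>count_space lattice)"
    by (rule nn_integral_count_space_nn_integral) (simp_all add: countable_lattice)
  also have "\<dots> = (\<integral>\<^sup>+z. \<integral>\<^sup>+x. f x * w (x - L *\<^sub>R z) * ?Q x \<partial>lborel \<partial>count_space lattice)"
  proof (rule nn_integral_cong)
    fix z :: "real ^ 'n" assume "z \<in> space (count_space lattice)"
    then have z: "z \<in> lattice" by simp
    have "(\<integral>\<^sup>+x. f x * w x * ?Q (x + L *\<^sub>R z) \<partial>lborel)
        = (\<integral>\<^sup>+x. f (x + L *\<^sub>R z) * w (x + L *\<^sub>R z - L *\<^sub>R z) * ?Q (x + L *\<^sub>R z) \<partial>lborel)"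
      by (simp add: periodicD[OF f z])
    also have "\<dots> = (\<integral>\<^sup>+x. f x * w (x - L *\<^sub>R z) * ?Q x \<partial>lborel)"
      by (rule nn_integral_lborel_translate[where f = "\<lambda>x. f x * w (x - L *\<^sub>R z) * ?Q x"]) measurable
    finally show "(\<integral>\<^sup>+x. f x * w x * ?Q (x + L *\<^sub>R z) \<partial>lborel)
        = (\<integral>\<^sup>+x. f x * w (x - L *\<^sub>R z) * ?Q x \<partial>lborel)" .
  qed
  also have "\<dots> = (\<integral>\<^sup>+x. \<integral>\<^sup>+z. f x * w (x - L *\<^sub>R z) * ?Q x \<partial>count_space lattice \<partial>lborel)"
    by (rule nn_integral_count_space_nn_integral[symmetric]) (simp_all add: countable_lattice)
  also have "\<dots> = (\<integral>\<^sup>+x. f x * ?Q x * (\<integral>\<^sup>+z. w (x - L *\<^sub>R z) \<partial>count_space lattice) \<partial>lborel)"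
    by (simp add: nn_integral_cmult[symmetric] ac_simps)
  also have "\<dots> = (\<integral>\<^sup>+x. f x * ?Q x \<partial>lborel)"
  proof (rule nn_integral_cong)
    fix x :: "real ^ 'n"
    have "(\<integral>\<^sup>+z. w (x - L *\<^sub>R z) \<partial>count_space lattice)
        = (\<integral>\<^sup>+z. w (x + L *\<^sub>R (- z)) \<partial>count_space lattice)"
      by simp
    also have "\<dots> = (\<integral>\<^sup>+z. w (x + L *\<^sub>R z) \<partial>count_space lattice)"
      by (rule nn_integral_bij_count_space[where g = uminus])
         (rule bij_betw_byWitness[where f' = uminus], auto)
    finally show "f x * ?Q x * (\<integral>\<^sup>+z. w (x - L *\<^sub>R z) \<partial>count_space lattice) = f x * ?Q x"
      by (simp add: w)
  qed
  also have "\<dots> = (\<integral>\<^sup>+x. f x \<partial>cell L)"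
    by (simp add: nn_integral_cell)
  finally show ?thesis .
qed

lemma nn_integral_cell_translate:
  fixes f :: "real ^ 'n \<Rightarrow> ennreal"
  assumes L: "L > 0" and [measurable]: "f \<in> borel_measurable borel" and f: "periodic L f"
  shows "(\<integral>\<^sup>+x. f (x + a) \<partial>cell L) = (\<integral>\<^sup>+x. f x \<partial>cell L)"
proof -
  let ?w = "\<lambda>x. indicator (cube L) (x - a) :: ennreal"
  have w: "(\<integral>\<^sup>+z. ?w (x + L *\<^sub>R z) \<partial>count_space lattice) = 1" for x
  proof -
    have eq: "x + L *\<^sub>R z - a = x - a + L *\<^sub>R z" for z by simp
    show ?thesis unfolding eq by (rule nn_integral_lattice_indicator_cube[OF L])
  qed
  have "(\<integral>\<^sup>+x. f (x + a) \<partial>cell L) = (\<integral>\<^sup>+x. f (x + a) * ?w (x + a) \<partial>lborel)"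
    by (simp add: nn_integral_cell)
  also have "\<dots> = (\<integral>\<^sup>+x. f x * ?w x \<partial>lborel)"
    by (rule nn_integral_lborel_translate[where f = "\<lambda>x. f x * ?w x"]) measurable
  also have "\<dots> = (\<integral>\<^sup>+x. f x \<partial>cell L)"
    by (rule nn_integral_cell_eq_weight[OF L _ _ f w]) simp_all
  finally show ?thesis .
qed

lemma integral_cell_translate:
  fixes f :: "real ^ 'n \<Rightarrow> real"
  assumes L: "L > 0" and [measurable]: "f \<in> borel_measurable borel" and f: "periodic L f"
    and bounded: "\<And>x. \<bar>f x\<bar> \<le> B"
  shows "(\<integral>x. f (x + a) \<partial>cell L) = (\<integral>x. f x \<partial>cell L)"
proof -
  interpret finite_measure "cell L" by (rule finite_measure_cell[OF L])
  have int: "integrable (cell L) f"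
    by (rule integrable_const_bound[where B = B]) (use bounded in auto)
  have int_a: "integrable (cell L) (\<lambda>x. f (x + a))"
    by (rule integrable_const_bound[where B = B]) (use bounded in auto)
  have "(\<integral>\<^sup>+x. ennreal (f (x + a)) \<partial>cell L) = (\<integral>\<^sup>+x. ennreal (f x) \<partial>cell L)"
    by (rule nn_integral_cell_translate[OF L, where f = "\<lambda>x. ennreal (f x)"]) (use f in \<open>auto simp: periodic_def\<close>)
  moreover have "(\<integral>\<^sup>+x. ennreal (- f (x + a)) \<partial>cell L) = (\<integral>\<^sup>+x. ennreal (- f x) \<partial>cell L)"
    by (rule nn_integral_cell_translate[OF L, where f = "\<lambda>x. ennreal (- f x)"]) (use f in \<open>auto simp: periodic_def\<close>)
  ultimately show ?thesis
    by (simp add: real_lebesgue_integral_def[OF int] real_lebesgue_integral_def[OF int_a])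
qed

lemma integral_cell:
  fixes f :: "real ^ 'n \<Rightarrow> real"
  assumes [measurable]: "f \<in> borel_measurable borel"
  shows "(\<integral>x. f x \<partial>cell L) = (\<integral>x. indicator (cube L) x * f x \<partial>lborel)"
proof -
  have "cell L = density (lborel :: (real ^ 'n) measure) (\<lambda>x. ennreal (indicator (cube L) x :: real))"
    by (simp add: cell_def ennreal_indicator)
  then show ?thesis
    by (simp add: integral_density)
qed


text \<open>
  The open set \<open>A\<close> may touch the cube from outside at the faces that do not belong to it, so the
  cube itself is not separated from the complement of \<open>A\<close>. Its points near such faces are
  equivalent to points near the opposite faces, and compactness of the closed cube provides a
  fundamental domain at positive distance from the complement.
\<close>

lemma fundamental_domain_in_open:
  fixes A :: "(real ^ 'n) set"
  assumes L: "L > 0" and A: "open A" "cube L \<subseteq> A"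
  obtains r R D where "r > 0" "D \<in> sets borel" "\<And>y. y \<in> D \<Longrightarrow> ball y r \<subseteq> A"
    "\<And>y. y \<in> D \<Longrightarrow> norm y \<le> R" "\<And>y. \<exists>!z. z \<in> lattice \<and> y + L *\<^sub>R z \<in> D"
proof -
  let ?Q = "cbox 0 (\<chi> i. L) :: (real ^ 'n) set"
  obtain R0 where R0: "\<And>x. x \<in> ?Q \<Longrightarrow> norm x \<le> R0"
    using bounded_cbox[of 0 "\<chi> i. L"] by (auto simp: bounded_iff)
  have cube: "cube L \<subseteq> ?Q"
    by (auto simp: mem_box_cart cube_def less_imp_le)
  \<comment> \<open>Only translations of bounded length are admitted, which keeps the fundamental domain bounded.\<close>
  define \<Z> :: "(real ^ 'n) set" where "\<Z> = {z \<in> lattice. norm (L *\<^sub>R z) \<le> 2 * R0}"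
  define \<G> where "\<G> = (\<lambda>z. (\<lambda>x. x + L *\<^sub>R z) -` A) ` \<Z>"
  have "?Q \<subseteq> \<Union>\<G>"
  proof
    fix x assume x: "x \<in> ?Q"
    obtain z where z: "z \<in> lattice" "x + L *\<^sub>R z \<in> cube L"
      using cube_translate_ex1[OF L, of x] by blast
    have "norm (L *\<^sub>R z) \<le> norm (x + L *\<^sub>R z) + norm x"
      by (metis add_diff_cancel_left' norm_triangle_ineq4)
    also have "\<dots> \<le> 2 * R0" using R0[of "x + L *\<^sub>R z"] R0[OF x] z cube by auto
    finally show "x \<in> \<Union>\<G>" using z A by (auto simp: \<G>_def \<Z>_def)
  qed
  moreover have "open G" if "G \<in> \<G>" for G
    using that A by (auto simp: \<G>_def intro!: open_vimage continuous_intros)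
  ultimately obtain \<epsilon> where \<epsilon>: "0 < \<epsilon>" "\<And>x. x \<in> ?Q \<Longrightarrow> \<exists>G\<in>\<G>. ball x \<epsilon> \<subseteq> G"
    using Heine_Borel_lemma[OF compact_cbox] by metis
  define U where "U = {y. ball y \<epsilon> \<subseteq> A \<and> norm y \<le> 3 * R0}"
  have U_ex: "\<exists>z\<in>lattice. x + L *\<^sub>R z \<in> U" if x: "x \<in> cube L" for x
  proof -
    from x cube \<epsilon>(2)[of x] obtain z where z: "z \<in> \<Z>" "ball x \<epsilon> \<subseteq> (\<lambda>x. x + L *\<^sub>R z) -` A"
      by (auto simp: \<G>_def)
    have "ball (x + L *\<^sub>R z) \<epsilon> \<subseteq> A"
    proof
      fix y assume "y \<in> ball (x + L *\<^sub>R z) \<epsilon>"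
      then have "y - L *\<^sub>R z \<in> ball x \<epsilon>" by (simp add: dist_norm algebra_simps)
      then show "y \<in> A" using z(2) by auto
    qed
    moreover have "norm (x + L *\<^sub>R z) \<le> 3 * R0"
      using norm_triangle_ineq[of x "L *\<^sub>R z"] R0[of x] x cube z(1) by (auto simp: \<Z>_def)
    ultimately show ?thesis using z(1) by (auto simp: U_def \<Z>_def)
  qed
  have "closed {y. ball y \<epsilon> \<subseteq> A}"
  proof -
    have "{y. ball y \<epsilon> \<subseteq> A} = - (\<Union>a\<in>- A. ball a \<epsilon>)"
      by (auto simp: dist_commute)
    then show ?thesis by (metis closed_Compl open_UN open_ball)
  qed
  moreover have "closed {y::real^'n. norm y \<le> 3 * R0}"
    by (intro closed_Collect_le continuous_intros)
  ultimately have "closed U"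
    unfolding U_def by (rule closed_Collect_conj)
  then have [measurable]: "U \<in> sets borel" by (rule borel_closed)
  define e where "e = from_nat_into (lattice :: (real ^ 'n) set)"
  have e: "e n \<in> lattice" for n
    unfolding e_def by (rule from_nat_into) (use zero_in_lattice in blast)
  have e_surj: "\<exists>n. z = e n" if "z \<in> lattice" for z
    using from_nat_into_surj[OF countable_lattice that] by (auto simp: e_def)
  define V where "V n = cube L \<inter> (\<lambda>x. x + L *\<^sub>R e n) -` U" for n
  \<comment> \<open>Each point of the cube is moved by the first lattice vector in the enumeration that brings it into \<open>U\<close>.\<close>
  define D where "D = (\<Union>n. (\<lambda>y. y - L *\<^sub>R e n) -` disjointed V n)"
  have V_borel: "V n \<in> sets borel" for n
    unfolding V_def
    by (intro sets.Int cube_measurable measurable_sets_borel[OF _ \<open>U \<in> sets borel\<close>]) measurable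
  have "disjointed V n \<in> sets borel" for n
    using sets.range_disjointed_sets[of V borel] V_borel by blast
  then have "(\<lambda>y. y - L *\<^sub>R e n) -` disjointed V n \<in> sets borel" for n
    by (rule measurable_sets_borel[rotated]) measurable
  then have D: "D \<in> sets borel"
    unfolding D_def by (intro sets.countable_UN) auto
  have DU: "y \<in> U" if "y \<in> D" for y
  proof -
    from that obtain n where "y - L *\<^sub>R e n \<in> disjointed V n" by (auto simp: D_def)
    then have "y - L *\<^sub>R e n \<in> V n" using disjointed_subset[of V n] by auto
    then show ?thesis by (simp add: V_def)
  qed
  have "\<exists>!z. z \<in> lattice \<and> y + L *\<^sub>R z \<in> D" for y
  proof -
    obtain z0 where z0: "z0 \<in> lattice" "y + L *\<^sub>R z0 \<in> cube L"
      and uniq: "\<And>z. z \<in> lattice \<Longrightarrow> y + L *\<^sub>R z \<in> cube L \<Longrightarrow> z = z0"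
      using cube_translate_ex1[OF L, of y] by metis
    obtain m where "y + L *\<^sub>R z0 \<in> V m"
      using U_ex[OF z0(2)] e_surj z0(2) unfolding V_def by blast
    then have "y + L *\<^sub>R z0 \<in> (\<Union>n. disjointed V n)"
      unfolding UN_disjointed_eq by blast
    then obtain n where n: "y + L *\<^sub>R z0 \<in> disjointed V n" by blast
    show ?thesis
    proof (rule ex1I[of _ "z0 + e n"])
      have "y + L *\<^sub>R (z0 + e n) - L *\<^sub>R e n \<in> disjointed V n"
        using n by (simp add: algebra_simps)
      then show "z0 + e n \<in> lattice \<and> y + L *\<^sub>R (z0 + e n) \<in> D"
        using z0(1) e by (auto simp: D_def intro: lattice_add)
    next
      fix z assume z: "z \<in> lattice \<and> y + L *\<^sub>R z \<in> D"
      then obtain k where k: "y + L *\<^sub>R z - L *\<^sub>R e k \<in> disjointed V k" by (auto simp: D_def)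
      then have k': "y + L *\<^sub>R (z - e k) \<in> disjointed V k" by (simp add: algebra_simps)
      then have "y + L *\<^sub>R (z - e k) \<in> cube L"
        using disjointed_subset[of V k] by (auto simp: V_def)
      then have zk: "z - e k = z0" by (rule uniq[rotated]) (use z e lattice_diff in blast)
      have "k = n"
      proof (rule ccontr)
        assume "k \<noteq> n"
        then have "disjointed V k \<inter> disjointed V n = {}"
          using disjoint_family_disjointed[of V] by (auto simp: disjoint_family_on_def)
        then show False using k' n zk by auto
      qed
      then show "z = z0 + e n" using zk by (simp add: algebra_simps)
    qed
  qed
  then show ?thesis
    using that[of \<epsilon> D "3 * R0"] \<epsilon>(1) D DU by (simp add: U_def)
qed

text \<open>
  Every measurable fundamental domain gives the same integral of a periodic function. This is what
  allows the cube to be exchanged for a domain that is suitable for cutting off vector fields.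
\<close>

lemma integral_cell_eq_fundamental_domain:
  fixes f :: "real ^ 'n \<Rightarrow> real"
  assumes L: "L > 0" and [measurable]: "f \<in> borel_measurable borel" and f: "periodic L f"
    and bounded: "\<And>x. \<bar>f x\<bar> \<le> B"
    and [measurable]: "D \<in> sets borel" and D: "\<And>y. \<exists>!z. z \<in> lattice \<and> y + L *\<^sub>R z \<in> D"
  shows "(\<integral>x. indicator D x * f x \<partial>lborel) = (\<integral>x. f x \<partial>cell L)"
proof -
  interpret finite_measure "cell L" by (rule finite_measure_cell[OF L])
  have w: "(\<integral>\<^sup>+z. indicator D (x + L *\<^sub>R z) \<partial>count_space lattice) = 1" for x
    by (rule nn_integral_lattice_indicator[OF D])
  have part: "(\<integral>\<^sup>+x. ennreal (indicator D x * g x) \<partial>lborel) = (\<integral>\<^sup>+x. ennreal (g x) \<partial>cell L)"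
    if [measurable]: "g \<in> borel_measurable borel" and g: "periodic L g" for g :: "real ^ 'n \<Rightarrow> real"
  proof -
    have "(\<integral>\<^sup>+x. ennreal (indicator D x * g x) \<partial>lborel) = (\<integral>\<^sup>+x. ennreal (g x) * indicator D x \<partial>lborel)"
      by (intro nn_integral_cong) (simp add: indicator_def)
    also have "\<dots> = (\<integral>\<^sup>+x. ennreal (g x) \<partial>cell L)"
      by (rule nn_integral_cell_eq_weight[OF L _ _ _ w]) (use g in \<open>auto simp: periodic_def\<close>)
    finally show ?thesis .
  qed
  have int: "integrable (cell L) f"
    by (rule integrable_const_bound[where B = B]) (use bounded in auto)
  have intD: "integrable lborel (\<lambda>x. indicator D x * f x)"
  proof (rule integrableI_bounded)
    have "(\<integral>\<^sup>+x. ennreal (norm (indicator D x * f x)) \<partial>lborel)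
        = (\<integral>\<^sup>+x. ennreal (indicator D x * \<bar>f x\<bar>) \<partial>lborel)"
      by (simp add: abs_mult)
    also have "\<dots> = (\<integral>\<^sup>+x. ennreal \<bar>f x\<bar> \<partial>cell L)"
      by (rule part) (use f in \<open>auto simp: periodic_def\<close>)
    also have "\<dots> < \<infinity>"
      using int by (simp add: integrable_iff_bounded)
    finally show "(\<integral>\<^sup>+x. ennreal (norm (indicator D x * f x)) \<partial>lborel) < \<infinity>" .
  qed measurable
  have "(\<integral>\<^sup>+x. ennreal (indicator D x * - f x) \<partial>lborel) = (\<integral>\<^sup>+x. ennreal (- f x) \<partial>cell L)"
    by (rule part) (use f in \<open>auto simp: periodic_def\<close>)
  moreover have "(\<integral>\<^sup>+x. ennreal (indicator D x * f x) \<partial>lborel) = (\<integral>\<^sup>+x. ennreal (f x) \<partial>cell L)"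
    by (rule part) (use f in auto)
  ultimately show "(\<integral>x. indicator D x * f x \<partial>lborel) = (\<integral>x. f x \<partial>cell L)"
    by (simp add: real_lebesgue_integral_def[OF int] real_lebesgue_integral_def[OF intD])
qed

section \<open>Mollified vector fields\<close>

text \<open>
  The quadratic remainder estimate for \<open>\<rho>\<close> with gradient \<open>g\<close> makes convolutions with merely bounded
  measurable functions differentiable without any further limit argument.
\<close>

locale mollifier =
  fixes \<rho> :: "real ^ 'n \<Rightarrow> real" and g :: "real ^ 'n \<Rightarrow> real ^ 'n" and a M B :: real
  assumes radius_pos: "a > 0"
    and cont: "continuous_on UNIV \<rho>" and cont_grad: "continuous_on UNIV g"
    and nonneg: "\<rho> x \<ge> 0"
    and support: "norm x \<ge> a \<Longrightarrow> \<rho> x = 0" "norm x \<ge> a \<Longrightarrow> g x = 0"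
    and bound: "\<rho> x \<le> B" "norm (g x) \<le> B"
    and integral_one: "(\<integral>x. \<rho> x \<partial>lborel) = 1"
    and remainder: "norm v \<le> a \<Longrightarrow> \<bar>\<rho> (x + v) - \<rho> x - g x \<bullet> v\<bar> \<le> M * (norm v)\<^sup>2"

text \<open>
  The bump \<open>(max 0 (a\<^sup>2 - \<bar>x\<bar>\<^sup>2))\<^sup>2\<close> is continuously differentiable with Lipschitz gradient, since
  \<open>s \<mapsto> (max 0 s)\<^sup>2\<close> has these properties, and needs only to be normalised.
\<close>

lemma mollifier_exists:
  assumes a: "(a::real) > 0"
  shows "\<exists>(\<rho> :: real ^ 'n \<Rightarrow> real) g M B. mollifier \<rho> g a M B"
proof -
  define s where "s x = a\<^sup>2 - x \<bullet> x" for x :: "real ^ 'n"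
  define b where "b x = (max 0 (s x))\<^sup>2" for x
  define h where "h x = (- 4 * max 0 (s x)) *\<^sub>R x" for x
  have cont_b: "continuous_on UNIV b" and cont_h: "continuous_on UNIV h"
    unfolding b_def h_def s_def by (intro continuous_intros)+
  have s_neg: "s x \<le> 0" if "norm x \<ge> a" for x
    using that a power_mono[of a "norm x" 2] by (simp add: s_def power2_norm_eq_inner)
  have m_le: "max 0 (s x) \<le> a\<^sup>2" for x
    by (simp add: s_def)
  have supp_b: "b x = 0" and supp_h: "h x = 0" if "norm x \<ge> a" for x
    using s_neg[OF that] by (simp_all add: b_def h_def)
  have b_nonneg: "b x \<ge> 0" for x by (simp add: b_def)
  have b_le: "b x \<le> a ^ 4" for x
  proof -
    have "b x \<le> (a\<^sup>2)\<^sup>2" unfolding b_def by (rule power_mono[OF m_le]) simp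
    then show ?thesis by simp
  qed
  have h_le: "norm (h x) \<le> 4 * a ^ 3" for x
  proof (cases "norm x \<ge> a")
    case True then show ?thesis using a by (simp add: supp_h)
  next
    case False
    have "norm (h x) = 4 * (max 0 (s x) * norm x)" by (simp add: h_def)
    also have "\<dots> \<le> 4 * (a\<^sup>2 * a)"
      using False m_le[of x] by (intro mult_left_mono mult_mono) auto
    finally show ?thesis by (simp add: power3_eq_cube power2_eq_square)
  qed
  \<comment> \<open>Beyond \<open>2 a\<close> all three terms vanish; otherwise the increment \<open>\<tau>\<close> of \<open>s\<close> is at most \<open>5 a \<bar>v\<bar>\<close>, whence \<open>5\<^sup>2 + 2 = 27\<close>.\<close>
  have rem: "\<bar>b (x + v) - b x - h x \<bullet> v\<bar> \<le> 27 * a\<^sup>2 * (norm v)\<^sup>2" if v: "norm v \<le> a" for x v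
  proof (cases "norm x \<le> 2 * a")
    case False
    then have "norm (x + v) \<ge> a" using v norm_triangle_ineq4[of "x + v" v] by simp
    then show ?thesis using False a by (simp add: supp_b supp_h)
  next
    case True
    define \<tau> where "\<tau> = - 2 * (x \<bullet> v) - v \<bullet> v"
    define m where "m = max 0 (s x)"
    have sxv: "s (x + v) = s x + \<tau>"
      by (simp add: s_def \<tau>_def inner_add inner_commute)
    have quad: "\<bar>(max 0 (p + t))\<^sup>2 - (max 0 p)\<^sup>2 - 2 * max 0 p * t\<bar> \<le> t\<^sup>2" for p t :: real
    proof (cases "p \<ge> 0"; cases "p + t \<ge> 0")
      assume "p \<ge> 0" "\<not> p + t \<ge> 0"
      then have "p * p \<le> - t * p" "t * p \<le> 0" "-t * p \<le> - t * - t" 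
        by (intro mult_right_mono mult_left_mono mult_nonpos_nonneg; simp)+
      moreover have "0 \<le> (p + t)\<^sup>2" by simp
      ultimately show ?thesis using \<open>p \<ge> 0\<close> \<open>\<not> p + t \<ge> 0\<close>
        by (simp add: max_def power2_eq_square algebra_simps)
    next
      assume "\<not> p \<ge> 0" "p + t \<ge> 0"
      then have "(p + t)\<^sup>2 \<le> t\<^sup>2" by (intro power_mono) auto
      then show ?thesis using \<open>\<not> p \<ge> 0\<close> \<open>p + t \<ge> 0\<close> by (simp add: max_def)
    qed (auto simp: max_def power2_eq_square algebra_simps)
    have "b (x + v) - b x - h x \<bullet> v
        = ((max 0 (s x + \<tau>))\<^sup>2 - (max 0 (s x))\<^sup>2 - 2 * max 0 (s x) * \<tau>) - 2 * m * (v \<bullet> v)"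
      unfolding b_def sxv by (simp add: h_def m_def \<tau>_def algebra_simps)
    also have "\<bar>\<dots>\<bar> \<le> \<tau>\<^sup>2 + 2 * m * (v \<bullet> v)"
    proof -
      have "0 \<le> 2 * m * (v \<bullet> v)" by (simp add: m_def)
      then show ?thesis using quad[of "s x" \<tau>] by linarith
    qed
    also have "\<dots> \<le> 25 * a\<^sup>2 * (norm v)\<^sup>2 + 2 * a\<^sup>2 * (norm v)\<^sup>2"
    proof (rule add_mono)
      have "\<bar>\<tau>\<bar> \<le> 2 * \<bar>x \<bullet> v\<bar> + \<bar>v \<bullet> v\<bar>" unfolding \<tau>_def by linarith
      also have "\<dots> \<le> 2 * (norm x * norm v) + norm v * norm v"
        using Cauchy_Schwarz_ineq2[of x v] Cauchy_Schwarz_ineq2[of v v] by simp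
      also have "\<dots> \<le> 2 * (2 * a * norm v) + a * norm v"
        using True v by (intro add_mono mult_left_mono mult_right_mono) auto
      finally have "\<bar>\<tau>\<bar> \<le> 5 * a * norm v" by simp
      then have "\<bar>\<tau>\<bar>\<^sup>2 \<le> (5 * a * norm v)\<^sup>2" by (intro power_mono) auto
      then show "\<tau>\<^sup>2 \<le> 25 * a\<^sup>2 * (norm v)\<^sup>2" by (simp add: power_mult_distrib)
      show "2 * m * (v \<bullet> v) \<le> 2 * a\<^sup>2 * (norm v)\<^sup>2"
        using m_le[of x] by (simp add: m_def power2_norm_eq_inner mult_right_mono)
    qed
    finally show ?thesis by simp
  qed
  have int_b: "integrable lborel b"
  proof -
    have "integrable lborel (\<lambda>x. indicator (cball 0 a) x *\<^sub>R b x)"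
      by (intro borel_integrable_compact continuous_on_subset[OF cont_b]) auto
    also have "(\<lambda>x. indicator (cball 0 a) x *\<^sub>R b x) = b"
      using supp_b by (auto simp: indicator_def fun_eq_iff)
    finally show ?thesis .
  qed
  define c where "c = (\<integral>x. b x \<partial>lborel)"
  have "c > 0"
  proof -
    define k where "k = (a\<^sup>2 - (a/2)\<^sup>2)\<^sup>2"
    have "k > 0" using a by (simp add: k_def power2_eq_square)
    have le: "k * indicator (ball 0 (a/2)) x \<le> b x" for x
    proof (cases "x \<in> ball 0 (a/2)")
      case True
      then have "norm x \<le> a / 2" by simp
      then have "x \<bullet> x \<le> (a/2)\<^sup>2"
        by (metis norm_ge_zero power2_norm_eq_inner power_mono)
      then have "a\<^sup>2 - (a/2)\<^sup>2 \<le> max 0 (s x)" by (simp add: s_def)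
      moreover have "0 \<le> a\<^sup>2 - (a/2)\<^sup>2" by (simp add: power_divide)
      ultimately show ?thesis using True by (simp add: k_def b_def power_mono)
    qed (simp add: b_nonneg)
    have "0 < k * measure lborel (ball (0 :: real ^ 'n) (a/2))"
      using \<open>k > 0\<close> content_ball_pos[of "a/2" "0 :: real ^ 'n"] a by simp
    also have "\<dots> = (\<integral>x. k * indicator (ball (0 :: real ^ 'n) (a/2)) x \<partial>lborel)"
      by simp
    also have "\<dots> \<le> c"
      unfolding c_def
      by (intro integral_mono int_b le integrable_mult_right integrable_real_indicator
          emeasure_bounded_finite bounded_ball) simp
    finally show ?thesis .
  qed
  have "mollifier (\<lambda>x. b x / c) (\<lambda>x. h x /\<^sub>R c) a (27 * a\<^sup>2 / c) (max (a ^ 4) (4 * a ^ 3) / c)"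
  proof
    show "continuous_on UNIV (\<lambda>x. b x / c)" "continuous_on UNIV (\<lambda>x. h x /\<^sub>R c)"
      using \<open>c > 0\<close> by (auto intro!: continuous_intros cont_b cont_h)
    show "b x / c \<le> max (a ^ 4) (4 * a ^ 3) / c" for x
      using \<open>c > 0\<close> b_le[of x] by (intro divide_right_mono) auto
    show "norm (h x /\<^sub>R c) \<le> max (a ^ 4) (4 * a ^ 3) / c" for x
    proof -
      have "norm (h x /\<^sub>R c) = norm (h x) / c" using \<open>c > 0\<close> by (simp add: divide_inverse mult.commute)
      also have "\<dots> \<le> max (a ^ 4) (4 * a ^ 3) / c"
        using \<open>c > 0\<close> h_le[of x] by (intro divide_right_mono) auto
      finally show ?thesis .
    qed
    show "(\<integral>x. b x / c \<partial>lborel) = 1" using \<open>c > 0\<close> by (simp add: c_def)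
    fix x v :: "real ^ 'n" assume v: "norm v \<le> a"
    have "b (x + v) / c - b x / c - (h x /\<^sub>R c) \<bullet> v = (b (x + v) - b x - h x \<bullet> v) / c"
      by (simp add: algebra_simps divide_inverse)
    then have "\<bar>b (x + v) / c - b x / c - (h x /\<^sub>R c) \<bullet> v\<bar> = \<bar>b (x + v) - b x - h x \<bullet> v\<bar> / c"
      using \<open>c > 0\<close> by simp
    also have "\<dots> \<le> (27 * a\<^sup>2 * (norm v)\<^sup>2) / c"
      using \<open>c > 0\<close> rem[OF v] by (intro divide_right_mono) auto
    finally show "\<bar>b (x + v) / c - b x / c - (h x /\<^sub>R c) \<bullet> v\<bar> \<le> 27 * a\<^sup>2 / c * (norm v)\<^sup>2"
      by simp
  qed (use a supp_b supp_h b_nonneg \<open>c > 0\<close> in auto)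
  then show ?thesis by blast
qed

lemma lborel_eq_distr_reflect: "(lborel :: (real ^ 'n) measure) = distr lborel borel (\<lambda>y. x - y)"
proof -
  have "lborel = density (distr (lborel :: (real ^ 'n) measure) borel (\<lambda>y. x + (- 1) *\<^sub>R y)) (\<lambda>_. ennreal (\<bar>- 1\<bar> ^ DIM(real ^ 'n)))"
    by (rule lborel_affine) simp
  then show ?thesis
    by (simp add: density_1)
qed

lemma integral_lborel_reflect:
  fixes f :: "real ^ 'n \<Rightarrow> 'b :: {banach, second_countable_topology}"
  assumes [measurable]: "f \<in> borel_measurable borel"
  shows "(\<integral>y. f (x - y) \<partial>lborel) = (\<integral>y. f y \<partial>lborel)"
proof -
  have "(\<integral>y. f y \<partial>lborel) = (\<integral>y. f y \<partial>distr lborel borel (\<lambda>y. x - y))"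
    by (subst lborel_eq_distr_reflect[of x]) simp
  also have "\<dots> = (\<integral>y. f (x - y) \<partial>lborel)"
    by (rule integral_distr) measurable
  finally show ?thesis by simp
qed

lemma integrable_lborel_reflect:
  fixes f :: "real ^ 'n \<Rightarrow> 'b :: {banach, second_countable_topology}"
  assumes f: "integrable lborel f"
  shows "integrable lborel (\<lambda>y. f (x - y))"
proof -
  have "integrable (distr lborel borel (\<lambda>y. x - y)) f"
    using f by (simp flip: lborel_eq_distr_reflect)
  then show ?thesis
    using f by (subst (asm) integrable_distr_eq) auto
qed

lemma continuous_on_convolution:
  fixes h F :: "real ^ 'n \<Rightarrow> real"
  assumes F: "integrable lborel F" and h: "continuous_on UNIV h" and B: "\<And>x. \<bar>h x\<bar> \<le> B"
  shows "continuous_on UNIV (\<lambda>x. \<integral>y. h (x - y) * F y \<partial>lborel)"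
  unfolding continuous_on_sequentially
proof (intro allI ballI impI, elim conjE)
  fix X :: "nat \<Rightarrow> real ^ 'n" and x assume X: "X \<longlonglongrightarrow> x"
  have [measurable]: "h \<in> borel_measurable borel"
    using h by (rule borel_measurable_continuous_onI)
  have [measurable]: "F \<in> borel_measurable borel" using F by auto
  show "((\<lambda>x. \<integral>y. h (x - y) * F y \<partial>lborel) \<circ> X) \<longlonglongrightarrow> (\<integral>y. h (x - y) * F y \<partial>lborel)"
    unfolding o_def
  proof (rule integral_dominated_convergence[where w = "\<lambda>y. B * \<bar>F y\<bar>"])
    show "integrable lborel (\<lambda>y. B * \<bar>F y\<bar>)" using F by auto
    have "(\<lambda>n. h (X n - y) * F y) \<longlonglongrightarrow> h (x - y) * F y" for y
      using h by (intro tendsto_intros X continuous_on_tendsto_compose[OF h]) auto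
    then show "AE y in lborel. (\<lambda>n. h (X n - y) * F y) \<longlonglongrightarrow> h (x - y) * F y" by simp
    show "AE y in lborel. norm (h (X n - y) * F y) \<le> B * \<bar>F y\<bar>" for n
      using B by (auto simp: abs_mult intro!: mult_right_mono)
  qed measurable
qed

context mollifier
begin

lemma measurable_kernel [measurable]: "\<rho> \<in> borel_measurable borel" "g \<in> borel_measurable borel"
  using cont cont_grad by (auto intro: borel_measurable_continuous_onI)

lemma bound_nonneg: "B \<ge> 0"
  using bound(2)[of 0] norm_ge_zero order_trans by blast

lemma integrable_kernel: "integrable lborel \<rho>" "integrable lborel g"
proof -
  have "integrable lborel (\<lambda>x. indicator (cball 0 a) x *\<^sub>R \<rho> x)"
    by (intro borel_integrable_compact continuous_on_subset[OF cont]) auto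
  also have "(\<lambda>x. indicator (cball 0 a) x *\<^sub>R \<rho> x) = \<rho>"
    using support by (auto simp: indicator_def fun_eq_iff)
  finally show "integrable lborel \<rho>" .
  have "integrable lborel (\<lambda>x. indicator (cball 0 a) x *\<^sub>R g x)"
    by (intro borel_integrable_compact continuous_on_subset[OF cont_grad]) auto
  also have "(\<lambda>x. indicator (cball 0 a) x *\<^sub>R g x) = g"
    using support by (auto simp: indicator_def fun_eq_iff)
  finally show "integrable lborel g" .
qed

lemma integral_kernel_reflect: "(\<integral>y. \<rho> (x - y) \<partial>lborel) = 1"
  by (subst integral_lborel_reflect) (simp_all add: integral_one)

text \<open>
  Mollification enlarges the support by at most \<open>a\<close>, which leaves it inside \<open>A\<close>, and does not increase
  the length of the vectors; the derivative falls on the kernel.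
\<close>

lemma mollified_field:
  fixes F :: "real ^ 'n \<Rightarrow> real ^ 'n"
  assumes [measurable]: "F \<in> borel_measurable borel" and F_le: "\<And>y. norm (F y) \<le> 1"
    and F_supp: "\<And>y. F y \<noteq> 0 \<Longrightarrow> ball y r \<subseteq> A" "\<And>y. F y \<noteq> 0 \<Longrightarrow> norm y \<le> R" and "a < r"
  defines "\<Phi> \<equiv> \<lambda>x. \<integral>y. \<rho> (x - y) *\<^sub>R F y \<partial>lborel"
  shows "\<Phi> \<in> test_fields A"
    and "divergence \<Phi> x = (\<integral>y. g (x - y) \<bullet> F y \<partial>lborel)"
proof -
  have int_F: "integrable lborel F"
  proof (rule Bochner_Integration.integrable_bound)
    show "integrable lborel (indicat_real (cball (0 :: real ^ 'n) R))"
      by (intro integrable_real_indicator emeasure_bounded_finite bounded_cball) simp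
    show "AE y in lborel. norm (F y) \<le> norm (indicat_real (cball 0 R) y)"
      using F_le F_supp(2) by (auto simp: indicator_def)
  qed measurable
  have int_scale: "integrable lborel (\<lambda>y. h y *\<^sub>R F y)"
    if [measurable]: "h \<in> borel_measurable borel" and "\<And>y. \<bar>h y\<bar> \<le> C" for h C
  proof (rule Bochner_Integration.integrable_bound)
    show "integrable lborel (\<lambda>y. C * norm (F y))" using int_F by auto
    show "AE y in lborel. norm (h y *\<^sub>R F y) \<le> norm (C * norm (F y))"
      using that(2) by (auto simp: abs_mult intro!: mult_right_mono order_trans[OF that(2)])
  qed measurable
  have \<rho>_abs: "\<bar>\<rho> y\<bar> \<le> B" for y using nonneg[of y] bound(1)[of y] by simp
  have g_inner: "\<bar>g y \<bullet> v\<bar> \<le> B * norm v" for y v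
    using Cauchy_Schwarz_ineq2[of "g y" v] mult_right_mono[OF bound(2)[of y], of "norm v"] by simp
  define D where "D x v = (\<integral>y. (g (x - y) \<bullet> v) *\<^sub>R F y \<partial>lborel)" for x v
  have int_\<rho>: "integrable lborel (\<lambda>y. \<rho> (x - y) *\<^sub>R F y)" for x
    by (rule int_scale[where C = B]) (use \<rho>_abs in auto)
  have int_g: "integrable lborel (\<lambda>y. (g (x - y) \<bullet> v) *\<^sub>R F y)" for x v
    by (rule int_scale[where C = "B * norm v"]) (use g_inner in auto)
  have lin: "bounded_linear (D x)" for x
    unfolding linear_conv_bounded_linear[symmetric]
  proof
    show "D x (u + v) = D x u + D x v" for u v
      unfolding D_def inner_add_right scaleR_add_left
      by (rule Bochner_Integration.integral_add[OF int_g int_g])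
    show "D x (c *\<^sub>R v) = c *\<^sub>R D x v" for c v
      by (simp add: D_def flip: scaleR_scaleR)
  qed
  define C where "C = (\<integral>y. norm (F y) \<partial>lborel)"
  have deriv: "(\<Phi> has_derivative D x) (at x)" for x
  proof (rule has_derivativeI_sandwich[where e = a and H = "\<lambda>y. M * C * norm (y - x)"])
    show "0 < a" by (rule radius_pos)
    show "bounded_linear (D x)" by (rule lin)
    fix x' :: "real ^ 'n" assume "x' \<noteq> x" "dist x' x < a"
    define v where "v = x' - x"
    have v: "norm v \<le> a" "v \<noteq> 0" "x' = x + v"
      using \<open>x' \<noteq> x\<close> \<open>dist x' x < a\<close> by (auto simp: v_def dist_norm)
    have "\<Phi> x' - \<Phi> x - D x v
        = (\<integral>y. (\<rho> (x - y + v) - \<rho> (x - y) - g (x - y) \<bullet> v) *\<^sub>R F y \<partial>lborel)"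
      unfolding \<Phi>_def D_def scaleR_diff_left
      using int_\<rho>[of x] int_\<rho>[of x'] int_g[of x v]
      by (simp add: v(3) algebra_simps)
    also have "norm \<dots> \<le> (\<integral>y. M * (norm v)\<^sup>2 * norm (F y) \<partial>lborel)"
    proof (rule Bochner_Integration.integral_norm_bound_integral)
      show "integrable lborel (\<lambda>y. (\<rho> (x - y + v) - \<rho> (x - y) - g (x - y) \<bullet> v) *\<^sub>R F y)"
        using remainder[OF v(1)] by (intro int_scale[where C = "M * (norm v)\<^sup>2"]) auto
      show "integrable lborel (\<lambda>y. M * (norm v)\<^sup>2 * norm (F y))" using int_F by auto
      show "norm ((\<rho> (x - y + v) - \<rho> (x - y) - g (x - y) \<bullet> v) *\<^sub>R F y) \<le> M * (norm v)\<^sup>2 * norm (F y)" for y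
        using remainder[OF v(1), of "x - y"] by (auto intro!: mult_right_mono)
    qed
    also have "\<dots> = M * C * (norm v)\<^sup>2" by (simp add: C_def)
    finally show "norm (\<Phi> x' - \<Phi> x - D x (x' - x)) / norm (x' - x) \<le> M * C * norm (x' - x)"
      using v(2) by (simp add: v_def[symmetric] divide_le_eq power2_eq_square mult.assoc)
  next
    have "((\<lambda>y. M * C * norm (y - x)) \<longlongrightarrow> M * C * norm (x - x)) (at x)"
      by (intro tendsto_intros)
    then show "((\<lambda>y. M * C * norm (y - x)) \<longlongrightarrow> 0) (at x)" by simp
  qed
  have jac: "jacobian \<Phi> (at x) = (\<chi> i j. \<integral>y. g (x - y) $ j * F y $ i \<partial>lborel)" for x
  proof -
    have "D x (axis j 1) $ i = (\<integral>y. g (x - y) $ j * F y $ i \<partial>lborel)" for i j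
    proof -
      have "D x (axis j 1) $ i = (\<integral>y. ((g (x - y) \<bullet> axis j 1) *\<^sub>R F y) $ i \<partial>lborel)"
        unfolding D_def by (rule integral_bounded_linear[OF bounded_linear_vec_nth int_g, symmetric])
      then show ?thesis by (simp add: inner_axis)
    qed
    then show ?thesis
      using frechet_derivative_at[OF deriv[of x]]
      by (simp add: jacobian_def matrix_def)
  qed
  have int_Fi: "integrable lborel (\<lambda>y. F y $ i)" for i
    using int_F by (rule integrable_bounded_linear[OF bounded_linear_vec_nth])
  have cont_jac: "continuous_on UNIV (\<lambda>x. jacobian \<Phi> (at x))"
    unfolding jac
  proof (intro continuous_on_vec_lambda)
    fix i j
    show "continuous_on UNIV (\<lambda>x. \<integral>y. g (x - y) $ j * F y $ i \<partial>lborel)"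
      using cont_grad component_le_norm_cart[of "g _" j] bound(2) order_trans
      by (intro continuous_on_convolution[OF int_Fi, where B = B]) (auto intro!: continuous_intros, blast)
  qed
  have supp: "\<exists>y. norm (x - y) < a \<and> F y \<noteq> 0" if "\<Phi> x \<noteq> 0" for x
  proof (rule ccontr)
    assume "\<not> (\<exists>y. norm (x - y) < a \<and> F y \<noteq> 0)"
    then have "\<rho> (x - y) *\<^sub>R F y = 0" for y
      using support(1)[of "x - y"] by (cases "norm (x - y) < a") auto
    then have "(\<lambda>y. \<rho> (x - y) *\<^sub>R F y) = (\<lambda>_. 0)" by blast
    then show False using that unfolding \<Phi>_def by (metis integral_zero)
  qed
  have "norm x \<le> R + a" if x: "\<Phi> x \<noteq> 0" for x
  proof -
    obtain y where "norm (x - y) < a" "F y \<noteq> 0" using supp[OF x] by blast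
    then show ?thesis using F_supp(2)[of y] norm_triangle_sub[of x y] by simp
  qed
  then have bdd: "bounded {x. \<Phi> x \<noteq> 0}" by (auto simp: bounded_iff)
  have sub: "closure {x. \<Phi> x \<noteq> 0} \<subseteq> A"
  proof
    fix x assume "x \<in> closure {x. \<Phi> x \<noteq> 0}"
    then obtain x' where x': "\<Phi> x' \<noteq> 0" "dist x' x < r - a"
      using \<open>a < r\<close> unfolding closure_approachable
      by (metis (mono_tags, lifting) diff_gt_0_iff_gt mem_Collect_eq)
    obtain y where y: "norm (x' - y) < a" "F y \<noteq> 0" using supp[OF x'(1)] by blast
    have "dist y x \<le> dist y x' + dist x' x" by (rule dist_triangle)
    also have "\<dots> < r" using x'(2) y(1) by (simp add: dist_norm norm_minus_commute)
    finally show "x \<in> A" using F_supp(1)[OF y(2)] by auto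
  qed
  have le1: "norm (\<Phi> x) \<le> 1" for x
  proof -
    have "norm (\<Phi> x) \<le> (\<integral>y. \<rho> (x - y) \<partial>lborel)"
      unfolding \<Phi>_def
    proof (rule Bochner_Integration.integral_norm_bound_integral[OF int_\<rho>])
      show "integrable lborel (\<lambda>y. \<rho> (x - y))"
        by (rule integrable_lborel_reflect[OF integrable_kernel(1)])
      show "norm (\<rho> (x - y) *\<^sub>R F y) \<le> \<rho> (x - y)" for y
        using nonneg[of "x - y"] F_le[of y] by (simp add: mult_left_le)
    qed
    then show ?thesis by (simp add: integral_kernel_reflect)
  qed
  show "\<Phi> \<in> test_fields A"
    using deriv cont_jac bdd sub le1
    by (auto simp: test_fields_def differentiable_def compact_closure)
  have "divergence \<Phi> x = (\<Sum>i\<in>UNIV. \<integral>y. g (x - y) $ i * F y $ i \<partial>lborel)"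
    by (simp add: divergence_def jac trace_def)
  also have "\<dots> = (\<integral>y. (\<Sum>i\<in>UNIV. g (x - y) $ i * F y $ i) \<partial>lborel)"
  proof (rule Bochner_Integration.integral_sum[symmetric])
    fix i
    have "integrable lborel (\<lambda>y. ((g (x - y) \<bullet> axis i 1) *\<^sub>R F y) $ i)"
      by (rule integrable_bounded_linear[OF bounded_linear_vec_nth int_g])
    then show "integrable lborel (\<lambda>y. g (x - y) $ i * F y $ i)"
      by (simp add: inner_axis)
  qed
  also have "\<dots> = (\<integral>y. g (x - y) \<bullet> F y \<partial>lborel)"
    by (simp add: inner_vec_def)
  finally show "divergence \<Phi> x = (\<integral>y. g (x - y) \<bullet> F y \<partial>lborel)" .
qed

end

lemma integral_lebesgue_borel_set:
  fixes f :: "real ^ 'n \<Rightarrow> real"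
  assumes [measurable]: "f \<in> borel_measurable borel" "E \<in> sets borel"
  shows "(LINT x:E|lebesgue. f x) = (\<integral>x. indicat_real E x * f x \<partial>lborel)"
  unfolding set_lebesgue_integral_def
  by (subst integral_completion) simp_all

text \<open>
  The parameter measure for line integrals, as a measure on the whole real line for use in Fubini's
  theorem.
\<close>

definition unit_interval :: "real measure" where
  "unit_interval = density lborel (indicator {0..1})"

lemma sets_unit_interval [simp, measurable_cong]: "sets unit_interval = sets borel"
  by (simp add: unit_interval_def)

lemma space_unit_interval [simp]: "space unit_interval = UNIV"
  by (simp add: unit_interval_def)

lemma emeasure_unit_interval: "emeasure unit_interval UNIV = 1"
  by (simp add: unit_interval_def emeasure_density)

interpretation unit_interval: finite_measure unit_interval
  by (rule finite_measureI) (simp add: emeasure_unit_interval)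

lemma integral_unit_interval:
  fixes f :: "real \<Rightarrow> real"
  assumes [measurable]: "f \<in> borel_measurable borel"
  shows "(\<integral>t. f t \<partial>unit_interval) = (\<integral>t. f t * indicator {0..1} t \<partial>lborel)"
proof -
  have eq: "unit_interval = density lborel (\<lambda>t. ennreal (indicat_real {0..1} t))"
    by (simp add: unit_interval_def ennreal_indicator)
  have "(\<integral>t. f t \<partial>unit_interval) = (\<integral>t. indicat_real {0..1} t *\<^sub>R f t \<partial>lborel)"
    unfolding eq by (rule integral_density) auto
  then show ?thesis
    by (simp add: mult.commute)
qed

lemma integral_unit_interval_restrict:
  fixes f :: "real \<Rightarrow> real"
  assumes [measurable]: "f \<in> borel_measurable borel"
  shows "(\<integral>t. indicat_real {0..1} t * f t \<partial>unit_interval) = (\<integral>t. f t \<partial>unit_interval)"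
  by (subst (1 2) integral_unit_interval)
     (auto intro!: Bochner_Integration.integral_cong simp: indicator_def)

context mollifier
begin

lemma line_integral_gradient:
  "\<rho> (x + \<zeta>) - \<rho> x = (\<integral>t. g (x + t *\<^sub>R \<zeta>) \<bullet> \<zeta> \<partial>unit_interval)"
proof -
  have has_grad: "(\<rho> has_derivative (\<lambda>v. g y \<bullet> v)) (at y)" for y
  proof (rule has_derivativeI_sandwich[where e = a and H = "\<lambda>y'. M * norm (y' - y)"])
    show "0 < a" by (rule radius_pos)
    show "bounded_linear (\<lambda>v. g y \<bullet> v)" by (rule bounded_linear_inner_right)
    fix y' assume y': "y' \<noteq> y" "dist y' y < a"
    then have "\<bar>\<rho> (y + (y' - y)) - \<rho> y - g y \<bullet> (y' - y)\<bar> \<le> M * (norm (y' - y))\<^sup>2"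
      by (intro remainder) (simp add: dist_norm)
    then show "norm (\<rho> y' - \<rho> y - g y \<bullet> (y' - y)) / norm (y' - y) \<le> M * norm (y' - y)"
      using y'(1) by (simp add: divide_le_eq power2_eq_square mult.assoc)
  next
    have "((\<lambda>y'. M * norm (y' - y)) \<longlongrightarrow> M * norm (y - y)) (at y)"
      by (intro tendsto_intros)
    then show "((\<lambda>y'. M * norm (y' - y)) \<longlongrightarrow> 0) (at y)" by simp
  qed
  have "(\<integral>t. g (x + t *\<^sub>R \<zeta>) \<bullet> \<zeta> \<partial>unit_interval)
      = (\<integral>t. (g (x + t *\<^sub>R \<zeta>) \<bullet> \<zeta>) * indicator {0..1} t \<partial>lborel)"
    by (rule integral_unit_interval) measurable
  also have "\<dots> = \<rho> (x + 1 *\<^sub>R \<zeta>) - \<rho> (x + 0 *\<^sub>R \<zeta>)"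
  proof (rule integral_FTC_Icc_real[where F = "\<lambda>t. \<rho> (x + t *\<^sub>R \<zeta>)"])
    fix t :: real
    have "((\<lambda>t. \<rho> (x + t *\<^sub>R \<zeta>)) has_derivative (\<lambda>h. g (x + t *\<^sub>R \<zeta>) \<bullet> (0 + h *\<^sub>R \<zeta>))) (at t)"
      by (rule has_derivative_compose[OF _ has_grad]) (auto intro!: derivative_eq_intros)
    then show "DERIV (\<lambda>t. \<rho> (x + t *\<^sub>R \<zeta>)) t :> g (x + t *\<^sub>R \<zeta>) \<bullet> \<zeta>"
      by (simp add: has_field_derivative_def mult.commute[of _ "g _ \<bullet> _"])
    show "isCont (\<lambda>t. g (x + t *\<^sub>R \<zeta>) \<bullet> \<zeta>) t"
    proof -
      have g: "isCont g y" for y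
        using cont_grad by (simp add: continuous_on_eq_continuous_at)
      have "isCont (\<lambda>t. x + t *\<^sub>R \<zeta>) t" by (intro continuous_intros)
      then have "isCont (\<lambda>t. g (x + t *\<^sub>R \<zeta>)) t" by (rule isCont_o2[OF _ g])
      then show ?thesis by (intro continuous_intros)
    qed
  qed simp
  finally show ?thesis by simp
qed

end

lemma integrable_pair_bounded_support:
  fixes f :: "'a \<times> 'b \<Rightarrow> real"
  assumes "sigma_finite_measure M" "sigma_finite_measure N"
    and [measurable]: "f \<in> borel_measurable (M \<Otimes>\<^sub>M N)" "A \<in> sets M" "B \<in> sets N"
    and fin: "emeasure M A < \<infinity>" "emeasure N B < \<infinity>"
    and bound: "\<And>x y. \<bar>f (x, y)\<bar> \<le> C" and supp: "\<And>x y. x \<notin> A \<or> y \<notin> B \<Longrightarrow> f (x, y) = 0"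
  shows "integrable (M \<Otimes>\<^sub>M N) f"
proof (rule integrableI_bounded_set[where A = "A \<times> B" and B = C])
  interpret N: sigma_finite_measure N by fact
  show "emeasure (M \<Otimes>\<^sub>M N) (A \<times> B) < \<infinity>"
    using fin by (subst N.emeasure_pair_measure_Times) (auto simp: ennreal_mult_less_top)
  show "AE p in M \<Otimes>\<^sub>M N. p \<in> A \<times> B \<longrightarrow> norm (f p) \<le> C"
    using bound by (auto simp: split_beta)
  show "AE p in M \<Otimes>\<^sub>M N. p \<notin> A \<times> B \<longrightarrow> f p = 0"
  proof (rule AE_I2)
    fix p show "p \<notin> A \<times> B \<longrightarrow> f p = 0"
      using supp by (cases p) auto
  qed
qed measurable

section \<open>Translation defects\<close>

definition translation_defect :: "real \<Rightarrow> (real ^ 'n) set \<Rightarrow> real ^ 'n \<Rightarrow> real" where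
  "translation_defect L E \<zeta> = (\<integral>x. \<bar>indicat_real E (x + \<zeta>) - indicat_real E x\<bar> \<partial>cell L)"

text \<open>
  Periodicity and Borel measurability are required exactly and not only up to null sets: the indicator
  functions of \<open>x + \<zeta> \<in> E\<close> are then measurable on product spaces without completing the product measure,
  and translations act on them pointwise.
\<close>

locale periodic_borel_set =
  fixes L :: real and E :: "(real ^ 'n) set"
  assumes L_pos: "L > 0" and E_borel [measurable]: "E \<in> sets borel"
    and E_periodic: "periodic L (\<lambda>x. x \<in> E)"
begin

abbreviation e :: "real ^ 'n \<Rightarrow> real" where
  "e \<equiv> indicat_real E"

sublocale cell: finite_measure "cell L :: (real ^ 'n) measure"
  by (rule finite_measure_cell[OF L_pos])

lemma e_periodic: "z \<in> lattice \<Longrightarrow> e (x + L *\<^sub>R z + y) = e (x + y)"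
proof -
  assume "z \<in> lattice"
  then have "x + y + L *\<^sub>R z \<in> E \<longleftrightarrow> x + y \<in> E"
    using E_periodic by (simp add: periodic_def)
  then show ?thesis by (simp add: indicator_def algebra_simps)
qed

lemma e_periodic': "z \<in> lattice \<Longrightarrow> e (x + L *\<^sub>R z) = e x"
  using e_periodic[of z x 0] by simp

lemma e_range: "0 \<le> e x" "e x \<le> 1" "\<bar>e x - e y\<bar> \<le> 1" "\<bar>e x\<bar> \<le> 1"
  by (auto simp: indicator_def)

lemma integrable_cell_bounded:
  fixes f :: "real ^ 'n \<Rightarrow> real"
  assumes "f \<in> borel_measurable borel" "\<And>x. \<bar>f x\<bar> \<le> C"
  shows "integrable (cell L) f"
  using assms by (intro cell.integrable_const_bound[where B = C]) auto

lemma translation_defect_nonneg: "0 \<le> translation_defect L E \<zeta>"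
  by (simp add: translation_defect_def)

lemma translation_defect_le: "translation_defect L E \<zeta> \<le> measure (cell L :: (real ^ 'n) measure) UNIV"
proof -
  have "translation_defect L E \<zeta> \<le> (\<integral>x. 1 \<partial>(cell L :: (real ^ 'n) measure))"
    unfolding translation_defect_def
    by (intro integral_mono integrable_cell_bounded[where C = 1]) (auto simp: e_range)
  then show ?thesis by simp
qed

lemma measurable_translation_defect [measurable]:
  "translation_defect L E \<in> borel_measurable borel"
proof -
  have [measurable]: "(\<lambda>(\<zeta>, x). \<bar>e (x + \<zeta>) - e x\<bar>) \<in> borel_measurable (borel \<Otimes>\<^sub>M cell L)"
    by measurable
  show ?thesis
    unfolding translation_defect_def by measurable
qed

lemma integrable_translation_defect:
  assumes "finite_measure \<kappa>" and [measurable_cong]: "sets \<kappa> = sets borel"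
  shows "integrable \<kappa> (translation_defect L E)"
proof -
  interpret finite_measure \<kappa> by fact
  show ?thesis
    by (rule integrable_const_bound[where B = "measure (cell L :: (real ^ 'n) measure) UNIV"])
       (auto simp: translation_defect_nonneg translation_defect_le)
qed

lemma integrable_translation_defect_mult:
  assumes [measurable]: "k \<in> borel_measurable borel" and k: "\<And>z. 0 \<le> k z" "integrable lborel k"
  shows "integrable lborel (\<lambda>z. translation_defect L E z * k z)"
proof (rule Bochner_Integration.integrable_bound)
  show "integrable lborel (\<lambda>z. measure (cell L :: (real ^ 'n) measure) UNIV * k z)"
    using k(2) by simp
  show "AE z in lborel. norm (translation_defect L E z * k z)
      \<le> norm (measure (cell L :: (real ^ 'n) measure) UNIV * k z)"
    using translation_defect_le translation_defect_nonneg k(1)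
    by (auto intro!: AE_I2 mult_right_mono simp: abs_mult)
qed measurable

lemma translation_defect_lattice:
  "z \<in> lattice \<Longrightarrow> translation_defect L E (L *\<^sub>R z + \<zeta>) = translation_defect L E \<zeta>"
  using e_periodic[of z _ \<zeta>] unfolding translation_defect_def by (simp add: add.assoc[symmetric])

text \<open>
  Translations are continuous in \<open>L\<^sup>1\<close>: the set and its complement contain, near the cell, closed sets
  of almost full measure which have a positive distance, so a short translation can change membership only
  at points that start or end in the small remainder \<open>W\<close>.
\<close>

lemma translation_defect_small:
  assumes "\<delta> > 0"
  obtains a where "a > 0" "\<And>t. norm t \<le> a \<Longrightarrow> translation_defect L E t \<le> \<delta>"
proof -
  obtain R where R: "\<And>x. x \<in> cbox 0 (\<chi> i. L) \<Longrightarrow> norm (x :: real ^ 'n) \<le> R"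
    using bounded_cbox[of 0 "\<chi> i. L"] by (auto simp: bounded_iff)
  have cube: "norm x \<le> R" if "x \<in> cube L" for x :: "real ^ 'n"
    using that by (intro R) (auto simp: mem_box_cart cube_def less_imp_le)
  define K where "K = cball (0 :: real ^ 'n) (R + 1)"
  have inner: "\<exists>C. closed C \<and> C \<subseteq> S \<and> emeasure lborel (S - C) < ennreal (\<delta> / 4)"
    if "S \<in> sets borel" for S :: "(real ^ 'n) set"
  proof -
    have "S \<in> sets lebesgue" using that by simp
    then obtain C where C: "closed C" "C \<subseteq> S" "emeasure lebesgue (S - C) < ennreal (\<delta> / 4)"
      using sets_lebesgue_inner_closed[of S "\<delta> / 4"] assms by (metis zero_less_divide_iff zero_less_numeral)
    moreover have "S - C \<in> sets lborel" using that C(1) by auto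
    ultimately show ?thesis by auto
  qed
  have [measurable]: "K \<in> sets borel" by (simp add: K_def)
  obtain C1 where C1: "closed C1" "C1 \<subseteq> K \<inter> E" "emeasure lborel (K \<inter> E - C1) < ennreal (\<delta> / 4)"
    using inner[of "K \<inter> E"] by auto
  obtain C2 where C2: "closed C2" "C2 \<subseteq> K - E" "emeasure lborel (K - E - C2) < ennreal (\<delta> / 4)"
    using inner[of "K - E"] by auto
  have [measurable]: "C1 \<in> sets borel" "C2 \<in> sets borel" using C1 C2 by auto
  have "compact C1"
    using C1 bounded_subset[of "cball 0 (R + 1)" C1] by (auto simp: compact_eq_bounded_closed K_def)
  moreover have "C1 \<inter> C2 = {}" using C1 C2 by auto
  ultimately obtain d where d: "d > 0" "\<And>x y. x \<in> C1 \<Longrightarrow> y \<in> C2 \<Longrightarrow> d \<le> dist x y"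
    using separate_compact_closed[of C1 C2] C2(1) by metis
  define W where "W = K - C1 - C2"
  have [measurable]: "W \<in> sets borel" by (simp add: W_def)
  have "W = (K \<inter> E - C1) \<union> (K - E - C2)" using C1(2) C2(2) by (auto simp: W_def)
  then have "emeasure lborel W \<le> emeasure lborel (K \<inter> E - C1) + emeasure lborel (K - E - C2)"
    by (metis emeasure_subadditive sets_lborel \<open>K \<in> sets borel\<close> \<open>C1 \<in> sets borel\<close> \<open>C2 \<in> sets borel\<close> E_borel sets.Diff sets.Int)
  also have "\<dots> \<le> ennreal (\<delta> / 4) + ennreal (\<delta> / 4)"
    using C1(3) C2(3) by (intro add_mono) auto
  also have "\<dots> = ennreal (\<delta> / 2)" using assms by (simp flip: ennreal_plus)
  finally have W: "emeasure lborel W \<le> ennreal (\<delta> / 2)" .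
  then have W_fin: "emeasure lborel W < \<infinity>" using ennreal_less_top le_less_trans infinity_ennreal_def by metis
  have mW: "measure lborel W \<le> \<delta> / 2"
    unfolding measure_def using assms by (intro enn2real_leI[OF _ W]) simp
  have int_W: "integrable lborel (indicat_real W)"
    using W_fin by (intro integrable_real_indicator) auto
  have int_Wt: "integrable lborel (\<lambda>w. indicat_real W (w + t))" for t
    by (rule integrable_lborel_translate[OF int_W])
  show ?thesis
  proof (rule that[of "min 1 (d / 2)"])
    show "min 1 (d / 2) > 0" using d(1) by simp
    fix t :: "real ^ 'n" assume t: "norm t \<le> min 1 (d / 2)"
    have pointwise: "indicat_real (cube L) w * \<bar>e (w + t) - e w\<bar> \<le> indicat_real W w + indicat_real W (w + t)" for w
    proof (cases "w \<in> cube L \<and> w \<notin> W \<and> w + t \<notin> W")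
      case False
      then show ?thesis by (auto simp: indicator_def)
    next
      case True
      have "norm w \<le> R" using cube True by blast
      then have "w \<in> K" "w + t \<in> K" using norm_triangle_ineq[of w t] t by (auto simp: K_def)
      then have mem: "w \<in> C1 \<union> C2" "w + t \<in> C1 \<union> C2" using True by (auto simp: W_def)
      have "dist w (w + t) < d" "dist (w + t) w < d" using t d(1) by (auto simp: dist_norm)
      then have "w \<in> C1 \<longleftrightarrow> w + t \<in> C1"
        using mem d(2)[of w "w + t"] d(2)[of "w + t" w] by fastforce
      then have "w \<in> E \<longleftrightarrow> w + t \<in> E" using mem C1(2) C2(2) by blast
      then show ?thesis by (simp add: indicator_def)
    qed
    have "translation_defect L E t = (\<integral>w. indicat_real (cube L) w * \<bar>e (w + t) - e w\<bar> \<partial>lborel)"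
      unfolding translation_defect_def by (rule integral_cell) measurable
    also have "\<dots> \<le> (\<integral>w. indicat_real W w + indicat_real W (w + t) \<partial>lborel)"
    proof (rule integral_mono)
      show "integrable lborel (\<lambda>w. indicat_real (cube L) w * \<bar>e (w + t) - e w\<bar>)"
      proof (rule integrableI_bounded_set[where A = "cube L" and B = 1])
        show "emeasure lborel (cube L :: (real ^ 'n) set) < \<infinity>"
          using emeasure_lborel_cube[OF L_pos, where 'n = 'n] by simp
      qed (auto simp: e_range)
    qed (use int_W int_Wt pointwise in auto)
    also have "\<dots> = measure lborel W + measure lborel W"
      using int_W int_Wt[of t] integral_lborel_translate[of "indicat_real W" t] by simp
    finally show "translation_defect L E t \<le> \<delta>" using mW by simp
  qed
qed

end

section \<open>The calibrating vector field\<close>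

text \<open>
  The measure \<open>\<kappa>\<close> plays the role of \<open>K(\<zeta>) d\<zeta>\<close>, and the assumption \<open>width\<close> says that its first moment in
  direction of a unit vector is at most \<open>c\<close>.
\<close>

locale calibration = periodic_borel_set L E + mollifier \<rho> g a M B
  for L and E :: "(real ^ 'n) set" and \<rho> :: "real ^ 'n \<Rightarrow> real" and g a M B +
  fixes \<kappa> :: "(real ^ 'n) measure" and c :: real
  assumes sets_\<kappa> [simp, measurable_cong]: "sets \<kappa> = sets borel"
    and finite_\<kappa>: "finite_measure \<kappa>"
    and integrable_norm_\<kappa>: "integrable \<kappa> norm"
    and c_pos: "c > 0"
    and width: "\<And>v. (\<integral>\<zeta>. \<bar>\<zeta> \<bullet> v\<bar> \<partial>\<kappa>) \<le> c * norm v"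
begin

sublocale \<kappa>: finite_measure \<kappa> by (rule finite_\<kappa>)

lemma space_\<kappa> [simp]: "space \<kappa> = UNIV"
  using sets_eq_imp_space_eq[OF sets_\<kappa>] by simp

text \<open>
  The mollified indicator function \<open>u\<close> has gradient \<open>-G\<close>.
\<close>

definition u :: "real ^ 'n \<Rightarrow> real" where
  "u y = (\<integral>x. e (x + y) * \<rho> x \<partial>lborel)"

definition G :: "real ^ 'n \<Rightarrow> real ^ 'n" where
  "G y = (\<integral>x. e (x + y) *\<^sub>R g x \<partial>lborel)"

text \<open>
  The difference of the mean densities of \<open>E\<close> on the segments from \<open>y\<close> to \<open>y - \<zeta>\<close> and to \<open>y + \<zeta>\<close>; as
  such it lies between \<open>-1\<close> and \<open>1\<close>.
\<close>

definition h :: "real ^ 'n \<Rightarrow> real ^ 'n \<Rightarrow> real" where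
  "h y \<zeta> = (\<integral>t. e (y - t *\<^sub>R \<zeta>) - e (y - t *\<^sub>R \<zeta> + \<zeta>) \<partial>unit_interval)"

definition \<psi> :: "real ^ 'n \<Rightarrow> real ^ 'n" where
  "\<psi> y = (\<integral>\<zeta>. h y \<zeta> *\<^sub>R \<zeta> \<partial>\<kappa>)"

lemma measurable_u [measurable]: "u \<in> borel_measurable borel"
  unfolding u_def by measurable

lemma measurable_G [measurable]: "G \<in> borel_measurable borel"
  unfolding G_def by measurable

lemma measurable_h [measurable]: "(\<lambda>(y, \<zeta>). h y \<zeta>) \<in> borel_measurable (borel \<Otimes>\<^sub>M borel)"
  unfolding h_def by measurable

lemma measurable_\<psi> [measurable]: "\<psi> \<in> borel_measurable borel"
  unfolding \<psi>_def by measurable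

lemma integrable_e_mult [simp]:
  "integrable lborel (\<lambda>x. e (x + y) * \<rho> x)" "integrable lborel (\<lambda>x. e (x + y) *\<^sub>R g x)"
proof -
  show "integrable lborel (\<lambda>x. e (x + y) * \<rho> x)"
    by (rule Bochner_Integration.integrable_bound[OF integrable_kernel(1)])
       (auto simp: abs_mult indicator_def)
  show "integrable lborel (\<lambda>x. e (x + y) *\<^sub>R g x)"
    by (rule Bochner_Integration.integrable_bound[OF integrable_kernel(2)])
       (auto simp: indicator_def)
qed

lemma h_abs_le: "\<bar>h y \<zeta>\<bar> \<le> 1"
proof -
  have "norm (h y \<zeta>) \<le> (\<integral>t. norm (e (y - t *\<^sub>R \<zeta>) - e (y - t *\<^sub>R \<zeta> + \<zeta>)) \<partial>unit_interval)"
    unfolding h_def by (rule integral_norm_bound)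
  also have "\<dots> \<le> (\<integral>t. 1 \<partial>unit_interval)"
    by (intro integral_mono unit_interval.integrable_const_bound[where B = 1]) (auto simp: e_range)
  also have "\<dots> = 1" by (simp add: measure_def emeasure_unit_interval)
  finally show ?thesis by simp
qed

lemma integrable_h_scaleR: "integrable \<kappa> (\<lambda>\<zeta>. h y \<zeta> *\<^sub>R \<zeta>)"
  by (rule Bochner_Integration.integrable_bound[OF integrable_norm_\<kappa>])
     (auto intro!: mult_left_le_one_le h_abs_le)

text \<open>
  The component of \<open>\<psi>\<close> in its own direction is an average of \<open>\<zeta> \<bullet> \<psi>\<close> with weights of modulus at most
  one, so the bound on the first moments of \<open>\<kappa>\<close> applies.
\<close>

lemma norm_\<psi>_le: "norm (\<psi> y) \<le> c"
proof (cases "\<psi> y = 0")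
  case True
  then show ?thesis using c_pos by simp
next
  case False
  have "(norm (\<psi> y))\<^sup>2 = (\<integral>\<zeta>. (h y \<zeta> *\<^sub>R \<zeta>) \<bullet> \<psi> y \<partial>\<kappa>)"
    unfolding power2_norm_eq_inner
    by (subst integral_inner_left) (auto simp: integrable_h_scaleR \<psi>_def)
  also have "\<dots> \<le> (\<integral>\<zeta>. \<bar>\<zeta> \<bullet> \<psi> y\<bar> \<partial>\<kappa>)"
  proof (rule integral_mono)
    show "integrable \<kappa> (\<lambda>\<zeta>. (h y \<zeta> *\<^sub>R \<zeta>) \<bullet> \<psi> y)"
      by (rule integrable_inner_left) (rule integrable_h_scaleR)
    show "integrable \<kappa> (\<lambda>\<zeta>. \<bar>\<zeta> \<bullet> \<psi> y\<bar>)"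
      by (rule Bochner_Integration.integrable_bound[where f = "\<lambda>\<zeta>. norm (\<psi> y) * norm \<zeta>"])
         (use integrable_norm_\<kappa> Cauchy_Schwarz_ineq2 in \<open>auto simp: mult.commute\<close>)
    show "(h y \<zeta> *\<^sub>R \<zeta>) \<bullet> \<psi> y \<le> \<bar>\<zeta> \<bullet> \<psi> y\<bar>" for \<zeta>
    proof -
      have "(h y \<zeta> *\<^sub>R \<zeta>) \<bullet> \<psi> y \<le> \<bar>h y \<zeta>\<bar> * \<bar>\<zeta> \<bullet> \<psi> y\<bar>"
        by (metis abs_ge_self abs_mult inner_scaleR_left)
      also have "\<dots> \<le> 1 * \<bar>\<zeta> \<bullet> \<psi> y\<bar>" by (intro mult_right_mono h_abs_le) simp
      finally show ?thesis by simp
    qed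
  qed
  also have "\<dots> \<le> c * norm (\<psi> y)" by (rule width)
  finally show ?thesis using False by (simp add: power2_eq_square)
qed

lemma u_diff: "u (w + \<zeta>) - u w = - (\<integral>t. \<zeta> \<bullet> G (w + t *\<^sub>R \<zeta>) \<partial>unit_interval)"
proof -
  have u_eq: "u y = (\<integral>x. e x * \<rho> (x - y) \<partial>lborel)" for y
    using integral_lborel_translate[of "\<lambda>x. e x * \<rho> (x - y)" y] by (simp add: u_def)
  have int_u: "integrable lborel (\<lambda>x. e x * \<rho> (x - y))" for y
    using integrable_lborel_translate[OF integrable_e_mult(1)[of y], of "- y"] by simp
  have G_eq: "\<zeta> \<bullet> G y = (\<integral>x. e x * (g (x - y) \<bullet> \<zeta>) \<partial>lborel)" for y
  proof -
    have "\<zeta> \<bullet> G y = (\<integral>x. \<zeta> \<bullet> (e (x + y) *\<^sub>R g x) \<partial>lborel)"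
      unfolding G_def by (subst integral_inner_right) auto
    also have "\<dots> = (\<integral>x. e x * (g (x - y) \<bullet> \<zeta>) \<partial>lborel)"
      using integral_lborel_translate[of "\<lambda>x. e x * (g (x - y) \<bullet> \<zeta>)" y] by (simp add: inner_commute)
    finally show ?thesis .
  qed
  interpret P: pair_sigma_finite unit_interval "lborel :: (real ^ 'n) measure" ..
  let ?f = "\<lambda>t x. e x * (g (x - (w + t *\<^sub>R \<zeta>)) \<bullet> - \<zeta>)"
  have int: "integrable (unit_interval \<Otimes>\<^sub>M lborel) (\<lambda>(t, x). indicat_real {0..1} t * ?f t x)"
  proof (rule integrable_pair_bounded_support[where A = "{0..1}" and B = "cball w (a + norm \<zeta>)" and C = "B * norm \<zeta>"])
    show "emeasure unit_interval {0..1} < \<infinity>"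
      using unit_interval.emeasure_finite[of "{0..1}"] by (simp add: less_top[symmetric])
    show "emeasure lborel (cball w (a + norm \<zeta>)) < \<infinity>"
      by (intro emeasure_bounded_finite bounded_cball)
    fix t x
    have "\<bar>g (x - (w + t *\<^sub>R \<zeta>)) \<bullet> - \<zeta>\<bar> \<le> norm (g (x - (w + t *\<^sub>R \<zeta>))) * norm \<zeta>"
      using Cauchy_Schwarz_ineq2[of _ "- \<zeta>"] by simp
    also have "\<dots> \<le> B * norm \<zeta>"
      by (intro mult_right_mono bound) simp
    finally show "\<bar>case (t, x) of (t, x) \<Rightarrow> indicat_real {0..1} t * ?f t x\<bar> \<le> B * norm \<zeta>"
      using bound_nonneg by (auto simp: indicator_def)
    assume "t \<notin> {0..1} \<or> x \<notin> cball w (a + norm \<zeta>)"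
    then show "(case (t, x) of (t, x) \<Rightarrow> indicat_real {0..1} t * ?f t x) = 0"
    proof
      assume x: "x \<notin> cball w (a + norm \<zeta>)"
      have "norm (x - (w + t *\<^sub>R \<zeta>)) \<ge> a" if t: "t \<in> {0..1}"
      proof -
        have "norm (t *\<^sub>R \<zeta>) \<le> norm \<zeta>" using t by (simp add: mult_left_le_one_le)
        moreover have "norm (x - w) \<le> norm (x - (w + t *\<^sub>R \<zeta>)) + norm (t *\<^sub>R \<zeta>)"
          using norm_triangle_ineq[of "x - (w + t *\<^sub>R \<zeta>)" "t *\<^sub>R \<zeta>"] by (simp add: algebra_simps)
        moreover have "a + norm \<zeta> < norm (x - w)" using x by (simp add: dist_norm norm_minus_commute)
        ultimately show ?thesis by simp
      qed
      then show ?thesis by (auto simp: indicator_def support)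
    qed simp
  qed (auto intro: unit_interval.sigma_finite_measure_axioms lborel.sigma_finite_measure_axioms)
  have "u (w + \<zeta>) - u w = (\<integral>x. e x * (\<rho> (x - w + - \<zeta>) - \<rho> (x - w)) \<partial>lborel)"
    using int_u[of w] int_u[of "w + \<zeta>"] by (simp add: u_eq algebra_simps)
  also have "\<dots> = (\<integral>x. (\<integral>t. indicat_real {0..1} t * ?f t x \<partial>unit_interval) \<partial>lborel)"
  proof (rule Bochner_Integration.integral_cong[OF refl])
    fix x
    have "(\<integral>t. indicat_real {0..1} t * ?f t x \<partial>unit_interval) = (\<integral>t. ?f t x \<partial>unit_interval)"
      by (rule integral_unit_interval_restrict) measurable
    also have "\<dots> = e x * (\<integral>t. g (x - w + t *\<^sub>R (- \<zeta>)) \<bullet> - \<zeta> \<partial>unit_interval)"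
      by (subst integral_mult_right_zero[symmetric]) (simp add: algebra_simps)
    finally show "e x * (\<rho> (x - w + - \<zeta>) - \<rho> (x - w)) = (\<integral>t. indicat_real {0..1} t * ?f t x \<partial>unit_interval)"
      by (simp only: line_integral_gradient)
  qed
  also have "\<dots> = (\<integral>t. (\<integral>x. indicat_real {0..1} t * ?f t x \<partial>lborel) \<partial>unit_interval)"
    by (rule P.Fubini_integral[OF int])
  also have "\<dots> = (\<integral>t. indicat_real {0..1} t * - (\<zeta> \<bullet> G (w + t *\<^sub>R \<zeta>)) \<partial>unit_interval)"
    unfolding G_eq by simp
  also have "\<dots> = (\<integral>t. - (\<zeta> \<bullet> G (w + t *\<^sub>R \<zeta>)) \<partial>unit_interval)"
    by (rule integral_unit_interval_restrict) measurable
  finally show ?thesis by simp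
qed

lemma u_periodic: "z \<in> lattice \<Longrightarrow> u (y + L *\<^sub>R z) = u y"
  and G_periodic: "z \<in> lattice \<Longrightarrow> G (y + L *\<^sub>R z) = G y"
proof -
  assume z: "z \<in> lattice"
  have "e (x + (y + L *\<^sub>R z)) = e (x + y)" for x
    using e_periodic'[OF z, of "x + y"] by (simp add: add.assoc)
  then show "u (y + L *\<^sub>R z) = u y" "G (y + L *\<^sub>R z) = G y"
    by (simp_all add: u_def G_def)
qed

lemma h_periodic: "z \<in> lattice \<Longrightarrow> h (y + L *\<^sub>R z) \<zeta> = h y \<zeta>"
proof -
  assume z: "z \<in> lattice"
  have "e (y + L *\<^sub>R z - t *\<^sub>R \<zeta>) = e (y - t *\<^sub>R \<zeta>)"
    "e (y + L *\<^sub>R z - t *\<^sub>R \<zeta> + \<zeta>) = e (y - t *\<^sub>R \<zeta> + \<zeta>)" for t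
    using e_periodic[OF z, of y "- t *\<^sub>R \<zeta>"] e_periodic[OF z, of y "- t *\<^sub>R \<zeta> + \<zeta>"]
    by (simp_all add: algebra_simps)
  then show ?thesis by (simp add: h_def)
qed

lemma \<psi>_periodic: "z \<in> lattice \<Longrightarrow> \<psi> (y + L *\<^sub>R z) = \<psi> y"
  by (simp add: \<psi>_def h_periodic)

lemma u_range: "0 \<le> u y" "u y \<le> 1"
proof -
  show "0 \<le> u y" unfolding u_def using nonneg by (simp add: e_range)
  have "u y \<le> (\<integral>x. \<rho> x \<partial>lborel)"
    unfolding u_def using nonneg
    by (intro integral_mono integrable_kernel integrable_e_mult) (auto simp: indicator_def)
  then show "u y \<le> 1" by (simp_all add: integral_one)
qed

definition G_bound :: real where
  "G_bound = (\<integral>x. norm (g x) \<partial>lborel)"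

lemma G_bound_nonneg: "0 \<le> G_bound"
  by (simp add: G_bound_def)

lemma norm_G_le: "norm (G y) \<le> G_bound"
  unfolding G_def G_bound_def
  by (rule Bochner_Integration.integral_norm_bound_integral[OF integrable_e_mult(2)])
     (use integrable_kernel in \<open>auto simp: indicator_def\<close>)

lemma inner_G_le: "\<bar>\<zeta> \<bullet> G y\<bar> \<le> G_bound * norm \<zeta>"
  using Cauchy_Schwarz_ineq2[of \<zeta> "G y"] mult_left_mono[OF norm_G_le[of y], of "norm \<zeta>"]
  by (simp add: mult.commute)

text \<open>
  This is the double integral \<open>\<integral>\<integral> \<bar>e(w + \<zeta>) - e(w)\<bar> dw d\<kappa>(\<zeta>)\<close>, written with the square of the
  difference and with one of the two factors mollified.
\<close>

definition pairing :: real where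
  "pairing = (\<integral>\<zeta>. \<integral>w. (e (w + \<zeta>) - e w) * (u (w + \<zeta>) - u w) \<partial>cell L \<partial>\<kappa>)"

text \<open>
  Translating by \<open>t\<zeta>\<close> moves the difference of \<open>e\<close> to a fixed segment; the integral over \<open>t\<close> of the
  remaining factor is then a line integral of the gradient of \<open>u\<close>.
\<close>

lemma pairing_slice:
  "(\<integral>y. h y \<zeta> * (\<zeta> \<bullet> G y) \<partial>cell L) = (\<integral>w. (e (w + \<zeta>) - e w) * (u (w + \<zeta>) - u w) \<partial>cell L)"
proof -
  interpret P: pair_sigma_finite unit_interval "cell L :: (real ^ 'n) measure" ..
  interpret PF: finite_measure "unit_interval \<Otimes>\<^sub>M (cell L :: (real ^ 'n) measure)"
    by (intro finite_measure_pair_measure unit_interval.finite_measure_axioms cell.finite_measure_axioms)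
  have bnd: "\<bar>(e x - e x') * (\<zeta> \<bullet> G y)\<bar> \<le> G_bound * norm \<zeta>" for x x' y
    using mult_mono[OF e_range(3)[of x x'] inner_G_le[of \<zeta> y]] by (simp add: abs_mult)
  have int1: "integrable (unit_interval \<Otimes>\<^sub>M cell L)
      (\<lambda>(t, y). (e (y - t *\<^sub>R \<zeta>) - e (y - t *\<^sub>R \<zeta> + \<zeta>)) * (\<zeta> \<bullet> G y))"
    by (rule PF.integrable_const_bound[where B = "G_bound * norm \<zeta>"]) (auto simp: bnd)
  have int2: "integrable (unit_interval \<Otimes>\<^sub>M cell L)
      (\<lambda>(t, w). (e w - e (w + \<zeta>)) * (\<zeta> \<bullet> G (w + t *\<^sub>R \<zeta>)))"
    by (rule PF.integrable_const_bound[where B = "G_bound * norm \<zeta>"]) (auto simp: bnd)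
  have "(\<integral>y. h y \<zeta> * (\<zeta> \<bullet> G y) \<partial>cell L)
      = (\<integral>y. (\<integral>t. (e (y - t *\<^sub>R \<zeta>) - e (y - t *\<^sub>R \<zeta> + \<zeta>)) * (\<zeta> \<bullet> G y) \<partial>unit_interval) \<partial>cell L)"
    by (simp add: h_def)
  also have "\<dots> = (\<integral>t. (\<integral>y. (e (y - t *\<^sub>R \<zeta>) - e (y - t *\<^sub>R \<zeta> + \<zeta>)) * (\<zeta> \<bullet> G y) \<partial>cell L) \<partial>unit_interval)"
    by (rule P.Fubini_integral[OF int1])
  also have "\<dots> = (\<integral>t. (\<integral>w. (e w - e (w + \<zeta>)) * (\<zeta> \<bullet> G (w + t *\<^sub>R \<zeta>)) \<partial>cell L) \<partial>unit_interval)"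
  proof (rule Bochner_Integration.integral_cong[OF refl])
    fix t :: real
    let ?f = "\<lambda>y. (e (y - t *\<^sub>R \<zeta>) - e (y - t *\<^sub>R \<zeta> + \<zeta>)) * (\<zeta> \<bullet> G y)"
    have "periodic L ?f"
      unfolding periodic_def
    proof (intro ballI allI)
      fix z x :: "real ^ 'n" assume z: "z \<in> lattice"
      have "e (x + L *\<^sub>R z - t *\<^sub>R \<zeta>) = e (x - t *\<^sub>R \<zeta>)"
        "e (x + L *\<^sub>R z - t *\<^sub>R \<zeta> + \<zeta>) = e (x - t *\<^sub>R \<zeta> + \<zeta>)"
        using e_periodic[OF z, of x "- t *\<^sub>R \<zeta>"] e_periodic[OF z, of x "- t *\<^sub>R \<zeta> + \<zeta>"]
        by (simp_all add: algebra_simps)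
      then show "?f (x + L *\<^sub>R z) = ?f x" by (simp add: G_periodic[OF z])
    qed
    then have "(\<integral>y. ?f y \<partial>cell L) = (\<integral>w. ?f (w + t *\<^sub>R \<zeta>) \<partial>cell L)"
      by (intro integral_cell_translate[symmetric, where B = "G_bound * norm \<zeta>"] L_pos bnd) measurable
    then show "(\<integral>y. ?f y \<partial>cell L) = (\<integral>w. (e w - e (w + \<zeta>)) * (\<zeta> \<bullet> G (w + t *\<^sub>R \<zeta>)) \<partial>cell L)"
      by simp
  qed
  also have "\<dots> = (\<integral>w. (\<integral>t. (e w - e (w + \<zeta>)) * (\<zeta> \<bullet> G (w + t *\<^sub>R \<zeta>)) \<partial>unit_interval) \<partial>cell L)"
    by (rule P.Fubini_integral[OF int2, symmetric])
  also have "\<dots> = (\<integral>w. (e (w + \<zeta>) - e w) * (u (w + \<zeta>) - u w) \<partial>cell L)"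
  proof (rule Bochner_Integration.integral_cong[OF refl])
    fix w :: "real ^ 'n"
    have "(\<integral>t. (e w - e (w + \<zeta>)) * (\<zeta> \<bullet> G (w + t *\<^sub>R \<zeta>)) \<partial>unit_interval)
        = (e w - e (w + \<zeta>)) * (\<integral>t. \<zeta> \<bullet> G (w + t *\<^sub>R \<zeta>) \<partial>unit_interval)"
      by simp
    then show "(\<integral>t. (e w - e (w + \<zeta>)) * (\<zeta> \<bullet> G (w + t *\<^sub>R \<zeta>)) \<partial>unit_interval)
        = (e (w + \<zeta>) - e w) * (u (w + \<zeta>) - u w)"
      unfolding u_diff by (simp add: algebra_simps)
  qed
  finally show ?thesis .
qed

lemma integral_\<psi>_G: "(\<integral>y. \<psi> y \<bullet> G y \<partial>cell L) = pairing"
proof -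
  interpret P: pair_sigma_finite "cell L :: (real ^ 'n) measure" \<kappa> ..
  have int: "integrable (cell L \<Otimes>\<^sub>M \<kappa>) (\<lambda>(y, \<zeta>). h y \<zeta> * (\<zeta> \<bullet> G y))"
  proof (rule Bochner_Integration.integrable_bound)
    show "integrable ((cell L :: (real ^ 'n) measure) \<Otimes>\<^sub>M \<kappa>) (\<lambda>p. G_bound * norm (snd p))"
    proof (rule P.Fubini_integrable)
      show "AE y in (cell L :: (real ^ 'n) measure). integrable \<kappa> (\<lambda>\<zeta>. G_bound * norm (snd (y, \<zeta>)))"
        using integrable_norm_\<kappa> by simp
    qed simp_all
    show "(\<lambda>(y, \<zeta>). h y \<zeta> * (\<zeta> \<bullet> G y)) \<in> borel_measurable (cell L \<Otimes>\<^sub>M \<kappa>)"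
      by measurable
    have "\<bar>h y \<zeta> * (\<zeta> \<bullet> G y)\<bar> \<le> \<bar>G_bound * norm \<zeta>\<bar>" for y \<zeta>
      using mult_mono[OF h_abs_le[of y \<zeta>] inner_G_le[of \<zeta> y]] G_bound_nonneg by (simp add: abs_mult)
    then show "AE p in cell L \<Otimes>\<^sub>M \<kappa>. norm (case p of (y, \<zeta>) \<Rightarrow> h y \<zeta> * (\<zeta> \<bullet> G y))
        \<le> norm (G_bound * norm (snd p))"
      by (auto simp: split_beta)
  qed
  have "(\<integral>y. \<psi> y \<bullet> G y \<partial>cell L) = (\<integral>y. (\<integral>\<zeta>. h y \<zeta> * (\<zeta> \<bullet> G y) \<partial>\<kappa>) \<partial>cell L)"
    unfolding \<psi>_def
    by (intro Bochner_Integration.integral_cong refl, subst integral_inner_left[symmetric])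
       (auto simp: integrable_h_scaleR)
  also have "\<dots> = (\<integral>\<zeta>. (\<integral>y. h y \<zeta> * (\<zeta> \<bullet> G y) \<partial>cell L) \<partial>\<kappa>)"
    by (rule P.Fubini_integral[OF int, symmetric])
  finally show ?thesis
    by (simp add: pairing_def pairing_slice)
qed

end

context calibration
begin

text \<open>
  The test field is the mollification of \<open>\<psi> / c\<close>, restricted to a fundamental domain \<open>D\<close>. In the integral
  of its divergence over \<open>E\<close>, Fubini's theorem moves the mollification onto the indicator function of
  \<open>E\<close>; what remains on \<open>D\<close> is a periodic function, and \<open>D\<close> can be replaced by the cell. In particular,
  no cutoff function has to be differentiated.
\<close>

lemma pairing_le_variation:
  fixes A D :: "(real ^ 'n) set"
  assumes [measurable]: "D \<in> sets borel" and D_ball: "\<And>y. y \<in> D \<Longrightarrow> ball y r \<subseteq> A"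
    and D_bound: "\<And>y. y \<in> D \<Longrightarrow> norm y \<le> R"
    and D_ex1: "\<And>y. \<exists>!z. z \<in> lattice \<and> y + L *\<^sub>R z \<in> D" and "a < r"
  shows "ereal pairing \<le> ereal c * variation E A"
proof -
  define F where "F y = (indicat_real D y / c) *\<^sub>R \<psi> y" for y
  have [measurable]: "F \<in> borel_measurable borel"
    unfolding F_def by measurable
  have F_le: "norm (F y) \<le> 1" for y
    using norm_\<psi>_le[of y] c_pos by (simp add: F_def indicator_def divide_le_eq)
  have F_D: "y \<in> D" if "F y \<noteq> 0" for y
    using that by (auto simp: F_def indicator_def split: if_splits)
  define \<Phi> where "\<Phi> x = (\<integral>y. \<rho> (x - y) *\<^sub>R F y \<partial>lborel)" for x
  have \<Phi>: "\<Phi> \<in> test_fields A" "divergence \<Phi> x = (\<integral>y. g (x - y) \<bullet> F y \<partial>lborel)" for x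
    using mollified_field[OF \<open>F \<in> borel_measurable borel\<close> F_le _ _ \<open>a < r\<close>, of A R] D_ball D_bound F_D
    unfolding \<Phi>_def by auto
  have int: "integrable (lborel \<Otimes>\<^sub>M lborel) (\<lambda>(y, x). e x * (g (x - y) \<bullet> F y))"
  proof (rule integrable_pair_bounded_support[where A = "cball 0 R" and B = "cball 0 (R + a)" and C = B])
    show "emeasure lborel (cball (0 :: real ^ 'n) R) < \<infinity>" "emeasure lborel (cball (0 :: real ^ 'n) (R + a)) < \<infinity>"
      by (intro emeasure_bounded_finite bounded_cball)+
    fix y x :: "real ^ 'n"
    have "\<bar>g (x - y) \<bullet> F y\<bar> \<le> norm (g (x - y)) * norm (F y)" by (rule Cauchy_Schwarz_ineq2)
    also have "\<dots> \<le> B * 1" by (intro mult_mono bound F_le bound_nonneg) simp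
    finally show "\<bar>case (y, x) of (y, x) \<Rightarrow> e x * (g (x - y) \<bullet> F y)\<bar> \<le> B"
      using bound_nonneg by (simp add: indicator_def)
    assume "y \<notin> cball 0 R \<or> x \<notin> cball 0 (R + a)"
    then have "F y = 0 \<or> norm (x - y) \<ge> a"
    proof (cases "F y = 0")
      case False
      then have "norm y \<le> R" using F_D D_bound by blast
      then have "norm x > R + a" using \<open>y \<notin> cball 0 R \<or> x \<notin> cball 0 (R + a)\<close> by simp
      then show ?thesis using \<open>norm y \<le> R\<close> norm_triangle_sub[of x y] by simp
    qed simp
    then show "(case (y, x) of (y, x) \<Rightarrow> e x * (g (x - y) \<bullet> F y)) = 0"
      by (auto simp: support)
  qed (auto intro: lborel.sigma_finite_measure_axioms)
  have "(LINT x:E|lebesgue. divergence \<Phi> x) = (\<integral>x. e x * (\<integral>y. g (x - y) \<bullet> F y \<partial>lborel) \<partial>lborel)"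
    unfolding \<Phi>(2) by (rule integral_lebesgue_borel_set) measurable
  also have "\<dots> = (\<integral>x. (\<integral>y. e x * (g (x - y) \<bullet> F y) \<partial>lborel) \<partial>lborel)"
    by simp
  also have "\<dots> = (\<integral>y. (\<integral>x. e x * (g (x - y) \<bullet> F y) \<partial>lborel) \<partial>lborel)"
    by (rule lborel_pair.Fubini_integral[OF int])
  also have "\<dots> = (\<integral>y. indicat_real D y * (\<psi> y \<bullet> G y / c) \<partial>lborel)"
  proof (rule Bochner_Integration.integral_cong[OF refl])
    fix y
    have "(\<integral>x. e x * (g (x - y) \<bullet> F y) \<partial>lborel) = (\<integral>x. (e (x + y) *\<^sub>R g x) \<bullet> F y \<partial>lborel)"
      using integral_lborel_translate[of "\<lambda>x. e x * (g (x - y) \<bullet> F y)" y] by simp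
    also have "\<dots> = G y \<bullet> F y"
      unfolding G_def by (rule integral_inner_left) simp
    also have "\<dots> = indicat_real D y * (\<psi> y \<bullet> G y / c)"
      by (simp add: F_def inner_commute)
    finally show "(\<integral>x. e x * (g (x - y) \<bullet> F y) \<partial>lborel) = indicat_real D y * (\<psi> y \<bullet> G y / c)" .
  qed
  also have "\<dots> = (\<integral>y. \<psi> y \<bullet> G y / c \<partial>cell L)"
  proof (rule integral_cell_eq_fundamental_domain[OF L_pos _ _ _ _ D_ex1])
    show "periodic L (\<lambda>y. \<psi> y \<bullet> G y / c)"
      by (simp add: periodic_def \<psi>_periodic G_periodic)
    fix y
    have "\<bar>\<psi> y \<bullet> G y\<bar> \<le> c * G_bound"
      by (rule order_trans[OF Cauchy_Schwarz_ineq2]) (use c_pos in \<open>intro mult_mono norm_\<psi>_le norm_G_le, auto\<close>)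
    then show "\<bar>\<psi> y \<bullet> G y / c\<bar> \<le> G_bound"
      using c_pos by (simp add: divide_le_eq mult.commute)
  qed measurable
  also have "\<dots> = pairing / c"
    by (simp add: integral_\<psi>_G)
  finally have "ereal (pairing / c) \<le> variation E A"
    unfolding variation_def using \<Phi>(1) by (intro SUP_upper2[of \<Phi>]) auto
  then have "ereal c * ereal (pairing / c) \<le> ereal c * variation E A"
    using c_pos by (intro ereal_mult_left_mono) auto
  then show ?thesis using c_pos by simp
qed

text \<open>
  Replacing \<open>e\<close> by \<open>u\<close> in one factor costs at most the \<open>L\<^sup>1\<close> distance of \<open>u\<close> and \<open>e\<close> on a cell, once for
  each of the two end points, and this distance is an average of defects \<open>N(t)\<close> with \<open>\<bar>t\<bar> \<le> a\<close>.
\<close>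

lemma pairing_lower_bound:
  assumes small: "\<And>t. norm t \<le> a \<Longrightarrow> translation_defect L E t \<le> \<delta>"
  shows "(\<integral>\<zeta>. translation_defect L E \<zeta> \<partial>\<kappa>) - 2 * \<delta> * measure \<kappa> UNIV \<le> pairing"
proof -
  interpret P: pair_sigma_finite "lborel :: (real ^ 'n) measure" "cell L :: (real ^ 'n) measure" ..
  have bnd: "\<bar>u w - e w\<bar> \<le> 1" for w
    using u_range(1,2)[of w] e_range(1,2)[of w] by linarith
  have close: "(\<integral>w. \<bar>u w - e w\<bar> \<partial>cell L) \<le> \<delta>"
  proof -
    have pointwise: "\<bar>u w - e w\<bar> \<le> (\<integral>x. \<bar>e (w + x) - e w\<bar> * \<rho> x \<partial>lborel)" for w
    proof -
      have "u w - e w = (\<integral>x. (e (w + x) - e w) * \<rho> x \<partial>lborel)"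
        using integrable_e_mult(1)[of w] integrable_kernel(1) integral_one
        by (simp add: u_def left_diff_distrib add.commute)
      also have "norm \<dots> \<le> (\<integral>x. norm ((e (w + x) - e w) * \<rho> x) \<partial>lborel)"
        by (rule integral_norm_bound)
      finally show ?thesis using nonneg by (simp add: abs_mult)
    qed
    have int: "integrable (lborel \<Otimes>\<^sub>M cell L) (\<lambda>(x, w). \<bar>e (w + x) - e w\<bar> * \<rho> x)"
    proof (rule integrable_pair_bounded_support[where A = "cball 0 a" and B = UNIV and C = B])
      show "emeasure lborel (cball (0 :: real ^ 'n) a) < \<infinity>"
        by (intro emeasure_bounded_finite bounded_cball)
      show "emeasure (cell L) (UNIV :: (real ^ 'n) set) < \<infinity>"
        using cell.emeasure_finite[of UNIV] by (simp add: less_top[symmetric])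
      fix x w
      show "\<bar>case (x, w) of (x, w) \<Rightarrow> \<bar>e (w + x) - e w\<bar> * \<rho> x\<bar> \<le> B"
        using bound(1)[of x] nonneg[of x] bound_nonneg by (simp add: indicator_def)
      assume "x \<notin> cball 0 a \<or> w \<notin> UNIV"
      then show "(case (x, w) of (x, w) \<Rightarrow> \<bar>e (w + x) - e w\<bar> * \<rho> x) = 0"
        by (simp add: support)
    qed (auto intro: lborel.sigma_finite_measure_axioms cell.sigma_finite_measure_axioms)
    have "(\<integral>w. \<bar>u w - e w\<bar> \<partial>cell L) \<le> (\<integral>w. (\<integral>x. \<bar>e (w + x) - e w\<bar> * \<rho> x \<partial>lborel) \<partial>cell L)"
    proof (rule integral_mono)
      show "integrable (cell L) (\<lambda>w. \<bar>u w - e w\<bar>)"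
        using bnd by (intro integrable_cell_bounded[where C = 1]) auto
      show "integrable (cell L) (\<lambda>w. \<integral>x. \<bar>e (w + x) - e w\<bar> * \<rho> x \<partial>lborel)"
        by (rule P.integrable_snd[OF int])
    qed (rule pointwise)
    also have "\<dots> = (\<integral>x. (\<integral>w. \<bar>e (w + x) - e w\<bar> * \<rho> x \<partial>cell L) \<partial>lborel)"
      by (rule P.Fubini_integral[OF int])
    also have "\<dots> = (\<integral>x. translation_defect L E x * \<rho> x \<partial>lborel)"
      by (simp add: translation_defect_def)
    also have "\<dots> \<le> (\<integral>x. \<delta> * \<rho> x \<partial>lborel)"
    proof (rule integral_mono)
      show "integrable lborel (\<lambda>x. translation_defect L E x * \<rho> x)"
        using P.integrable_fst[OF int] by (simp add: translation_defect_def)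
      show "integrable lborel (\<lambda>x. \<delta> * \<rho> x)" using integrable_kernel(1) by simp
      show "translation_defect L E x * \<rho> x \<le> \<delta> * \<rho> x" for x
        using small[of x] support(1)[of x] nonneg[of x]
        by (cases "norm x \<le> a") (auto intro: mult_right_mono)
    qed
    also have "\<dots> = \<delta>" by (simp add: integral_one)
    finally show ?thesis .
  qed
  have int_close: "integrable (cell L) (\<lambda>w. \<bar>u w - e w\<bar>)"
    using bnd by (intro integrable_cell_bounded[where C = 1]) auto
  have int_shift: "integrable (cell L) (\<lambda>w. \<bar>u (w + \<zeta>) - e (w + \<zeta>)\<bar>)" for \<zeta>
    using bnd by (intro integrable_cell_bounded[where C = 1]) auto
  have prod_bnd: "\<bar>(e x - e y) * (u x - u y)\<bar> \<le> 1" for x y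
  proof -
    have "\<bar>u x - u y\<bar> \<le> 1" using u_range(1,2)[of x] u_range(1,2)[of y] by linarith
    then have "\<bar>e x - e y\<bar> * \<bar>u x - u y\<bar> \<le> 1 * 1" using e_range(3)[of x y] by (intro mult_mono) auto
    then show ?thesis by (simp add: abs_mult)
  qed
  have slice: "translation_defect L E \<zeta> - 2 * \<delta> \<le> (\<integral>w. (e (w + \<zeta>) - e w) * (u (w + \<zeta>) - u w) \<partial>cell L)" for \<zeta>
  proof -
    have shift: "(\<integral>w. \<bar>u (w + \<zeta>) - e (w + \<zeta>)\<bar> \<partial>cell L) = (\<integral>w. \<bar>u w - e w\<bar> \<partial>cell L)"
      using bnd by (intro integral_cell_translate[where B = 1 and f = "\<lambda>w. \<bar>u w - e w\<bar>"] L_pos)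
        (auto simp: periodic_def u_periodic e_periodic')
    have int_d: "integrable (cell L) (\<lambda>w. \<bar>e (w + \<zeta>) - e w\<bar>)"
      by (intro integrable_cell_bounded[where C = 1]) (auto simp: e_range)
    have "translation_defect L E \<zeta> - 2 * \<delta>
        \<le> translation_defect L E \<zeta> - (\<integral>w. \<bar>u (w + \<zeta>) - e (w + \<zeta>)\<bar> \<partial>cell L) - (\<integral>w. \<bar>u w - e w\<bar> \<partial>cell L)"
      using close shift by simp
    also have "\<dots> = (\<integral>w. \<bar>e (w + \<zeta>) - e w\<bar> - \<bar>u (w + \<zeta>) - e (w + \<zeta>)\<bar> - \<bar>u w - e w\<bar> \<partial>cell L)"
      using int_d int_shift[of \<zeta>] int_close by (simp add: translation_defect_def)
    also have "\<dots> \<le> (\<integral>w. (e (w + \<zeta>) - e w) * (u (w + \<zeta>) - u w) \<partial>cell L)"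
    proof (rule integral_mono)
      show "integrable (cell L) (\<lambda>w. \<bar>e (w + \<zeta>) - e w\<bar> - \<bar>u (w + \<zeta>) - e (w + \<zeta>)\<bar> - \<bar>u w - e w\<bar>)"
        using int_d int_shift[of \<zeta>] int_close by auto
      show "integrable (cell L) (\<lambda>w. (e (w + \<zeta>) - e w) * (u (w + \<zeta>) - u w))"
        using prod_bnd by (intro integrable_cell_bounded[where C = 1]) auto
      show "\<bar>e (w + \<zeta>) - e w\<bar> - \<bar>u (w + \<zeta>) - e (w + \<zeta>)\<bar> - \<bar>u w - e w\<bar>
          \<le> (e (w + \<zeta>) - e w) * (u (w + \<zeta>) - u w)" for w
        using u_range(1,2)[of "w + \<zeta>"] u_range(1,2)[of w]
        by (cases "w + \<zeta> \<in> E"; cases "w \<in> E") (auto simp: indicator_def abs_if)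
    qed
    finally show ?thesis .
  qed
  have "(\<integral>\<zeta>. translation_defect L E \<zeta> \<partial>\<kappa>) - 2 * \<delta> * measure \<kappa> UNIV = (\<integral>\<zeta>. translation_defect L E \<zeta> - 2 * \<delta> \<partial>\<kappa>)"
    using integrable_translation_defect[OF finite_\<kappa> sets_\<kappa>] by simp
  also have "\<dots> \<le> pairing"
    unfolding pairing_def
  proof (rule integral_mono)
    show "integrable \<kappa> (\<lambda>\<zeta>. translation_defect L E \<zeta> - 2 * \<delta>)"
      using integrable_translation_defect[OF finite_\<kappa> sets_\<kappa>] by simp
    show "integrable \<kappa> (\<lambda>\<zeta>. \<integral>w. (e (w + \<zeta>) - e w) * (u (w + \<zeta>) - u w) \<partial>cell L)"
    proof (rule \<kappa>.integrable_const_bound[where B = "measure (cell L :: (real ^ 'n) measure) UNIV"])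
      have "norm (\<integral>w. (e (w + \<zeta>) - e w) * (u (w + \<zeta>) - u w) \<partial>cell L)
          \<le> (\<integral>w. 1 \<partial>(cell L :: (real ^ 'n) measure))" for \<zeta>
        by (rule Bochner_Integration.integral_norm_bound_integral)
           (use prod_bnd in \<open>auto intro!: integrable_cell_bounded[where C = 1]\<close>)
      then show "AE \<zeta> in \<kappa>. norm (\<integral>w. (e (w + \<zeta>) - e w) * (u (w + \<zeta>) - u w) \<partial>cell L)
          \<le> measure (cell L :: (real ^ 'n) measure) UNIV"
        by simp
    qed measurable
  qed (rule slice)
  finally show ?thesis .
qed

end

text \<open>
  The calibration inequality in the limit of vanishing mollification. The radius of the mollifier depends
  on \<open>A\<close> through the distance of the fundamental domain from the complement of \<open>A\<close>.
\<close>

lemma (in periodic_borel_set) integral_translation_defect_le_variation: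
  fixes \<kappa> :: "(real ^ 'n) measure"
  assumes \<kappa>: "sets \<kappa> = sets borel" "finite_measure \<kappa>" "integrable \<kappa> norm"
    and c: "c > 0" "\<And>v. (\<integral>\<zeta>. \<bar>\<zeta> \<bullet> v\<bar> \<partial>\<kappa>) \<le> c * norm v"
    and A: "open A" "cube L \<subseteq> A"
  shows "ereal (\<integral>\<zeta>. translation_defect L E \<zeta> \<partial>\<kappa>) \<le> ereal c * variation E A"
proof (rule ereal_le_epsilon2)
  obtain r R D where D: "r > 0" "D \<in> sets borel" "\<And>y. y \<in> D \<Longrightarrow> ball y r \<subseteq> A"
    "\<And>y. y \<in> D \<Longrightarrow> norm y \<le> R" "\<And>y. \<exists>!z. z \<in> lattice \<and> y + L *\<^sub>R z \<in> D"
    using fundamental_domain_in_open[OF L_pos A] by metis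
  fix \<epsilon> :: real assume "\<epsilon> > 0"
  show "ereal (\<integral>\<zeta>. translation_defect L E \<zeta> \<partial>\<kappa>) \<le> ereal c * variation E A + ereal \<epsilon>"
  proof -
    \<comment> \<open>The added \<open>1\<close> covers the case \<open>\<kappa> = 0\<close>.\<close>
    define \<delta> where "\<delta> = \<epsilon> / (2 * (measure \<kappa> UNIV + 1))"
    have m: "measure \<kappa> UNIV + 1 > 0" by (simp add: add_nonneg_pos)
    have "\<delta> > 0" using \<open>\<epsilon> > 0\<close> m by (simp add: \<delta>_def)
    then obtain a0 where a0: "a0 > 0" "\<And>t. norm t \<le> a0 \<Longrightarrow> translation_defect L E t \<le> \<delta>"
      using translation_defect_small by blast
    define a where "a = min a0 (r / 2)"
    have "a > 0" "a < r" "a \<le> a0" using a0(1) D(1) by (auto simp: a_def)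
    obtain \<rho> :: "real ^ 'n \<Rightarrow> real" and g M B where mollifier: "mollifier \<rho> g a M B"
      using mollifier_exists[OF \<open>a > 0\<close>] by blast
    interpret calibration L E \<rho> g a M B \<kappa> c
      by (rule calibration.intro[OF periodic_borel_set_axioms mollifier calibration_axioms.intro[OF \<kappa> c]])
    have "2 * \<delta> * measure \<kappa> UNIV \<le> 2 * \<delta> * (measure \<kappa> UNIV + 1)"
      using \<open>\<delta> > 0\<close> by (intro mult_left_mono) auto
    also have "\<dots> = \<epsilon>" using m by (simp add: \<delta>_def divide_simps)
    finally have "(\<integral>\<zeta>. translation_defect L E \<zeta> \<partial>\<kappa>) \<le> pairing + \<epsilon>"
      using pairing_lower_bound[of \<delta>] a0(2) \<open>a \<le> a0\<close> by force
    then have "ereal (\<integral>\<zeta>. translation_defect L E \<zeta> \<partial>\<kappa>) \<le> ereal pairing + ereal \<epsilon>"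
      by simp
    also have "\<dots> \<le> ereal c * variation E A + ereal \<epsilon>"
      by (intro add_right_mono pairing_le_variation[OF D(2,3,4,5) \<open>a < r\<close>])
    finally show "ereal (\<integral>\<zeta>. translation_defect L E \<zeta> \<partial>\<kappa>) \<le> ereal c * variation E A + ereal \<epsilon>" .
  qed
qed

section \<open>Moments and rotations of the kernel\<close>

text \<open>
  Dyadic shells are needed to reach all exponents above the dimension: on the shell where \<open>\<bar>z\<bar> + 1\<close> lies
  between \<open>2\<^sup>n\<close> and \<open>2\<^sup>n\<^sup>+\<^sup>1\<close> the integral is of order \<open>2\<close> to the power \<open>n (d - q)\<close>.
\<close>

lemma integrable_power_decay:
  assumes q: "q > real CARD('n)"
  shows "integrable lborel (\<lambda>z :: real ^ 'n. (norm z + 1) powr (- q))"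
proof (rule integrableI_bounded)
  show "(\<lambda>z :: real ^ 'n. (norm z + 1) powr (- q)) \<in> borel_measurable lborel" by measurable
  let ?d = "CARD('n)"
  define V where "V = unit_ball_vol (real ?d)"
  have "V \<ge> 0" by (simp add: V_def)
  define s where "s = 2 powr (real ?d - q)"
  have s: "0 < s" "s < 1" using q by (simp_all add: s_def powr_less_one)
  let ?f = "\<lambda>n (z :: real ^ 'n). ennreal (2 powr (- q * real n)) * indicator (ball 0 (2 ^ Suc n)) z"
  have "(\<integral>\<^sup>+z. ennreal (norm ((norm z + 1) powr (- q))) \<partial>(lborel :: (real ^ 'n) measure)) \<le> (\<integral>\<^sup>+z. (\<Sum>n. ?f n z) \<partial>lborel)"
  proof (rule nn_integral_mono)
    fix z :: "real ^ 'n"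
    define n where "n = nat \<lfloor>log 2 (norm z + 1)\<rfloor>"
    have pos: "norm z + 1 > 0" by (simp add: add_nonneg_pos)
    have log0: "log 2 (norm z + 1) \<ge> 0" using pos by (subst zero_le_log_cancel_iff) simp_all
    have n: "real n \<le> log 2 (norm z + 1)" "log 2 (norm z + 1) < real n + 1"
      using log0 by (simp_all add: n_def)
    have "2 powr real n \<le> norm z + 1"
      using n(1) pos by (subst (asm) le_log_iff) simp_all
    then have "(norm z + 1) powr (- q) \<le> (2 powr real n) powr (- q)"
      using q by (intro powr_mono2') auto
    then have 1: "(norm z + 1) powr (- q) \<le> 2 powr (- q * real n)"
      by (simp add: powr_powr mult.commute)
    have "norm z + 1 < 2 powr (real n + 1)"
      using n(2) pos by (subst (asm) log_less_iff) simp_all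
    also have "2 powr (real n + 1) = 2 ^ Suc n"
      by (simp add: powr_add powr_realpow)
    finally have "z \<in> ball 0 (2 ^ Suc n)" by simp
    then have "ennreal (norm ((norm z + 1) powr (- q))) \<le> ?f n z"
      using 1 by (simp add: ennreal_leI)
    also have "\<dots> \<le> (\<Sum>k. ?f k z)"
    proof -
      have "h n \<le> (\<Sum>k. h k)" for h :: "nat \<Rightarrow> ennreal"
        using sum_le_suminf[of h "{n}"] by simp
      then show ?thesis .
    qed
    finally show "ennreal (norm ((norm z + 1) powr (- q))) \<le> (\<Sum>k. ?f k z)" .
  qed
  also have "\<dots> = (\<Sum>n. (\<integral>\<^sup>+z. ?f n z \<partial>lborel))"
    by (intro nn_integral_suminf borel_measurable_times_ennreal borel_measurable_const
        borel_measurable_indicator) simp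
  also have "\<dots> = (\<Sum>n. ennreal (V * 2 ^ ?d * s ^ n))"
  proof (rule suminf_cong)
    fix n
    have "(\<integral>\<^sup>+z. ?f n z \<partial>lborel) = ennreal (2 powr (- q * real n)) * emeasure lborel (ball (0 :: real ^ 'n) (2 ^ Suc n))"
      by (rule nn_integral_cmult_indicator) simp
    also have "\<dots> = ennreal (2 powr (- q * real n) * (V * (2 ^ Suc n) ^ ?d))"
    proof -
      have "emeasure lborel (ball (0 :: real ^ 'n) (2 ^ Suc n)) = ennreal (V * (2 ^ Suc n) ^ ?d)"
        using emeasure_ball[of "2 ^ Suc n" "0 :: real ^ 'n"] by (simp add: V_def)
      then show ?thesis
        using \<open>V \<ge> 0\<close> by (simp only: ennreal_mult powr_ge_zero mult_nonneg_nonneg zero_le_power zero_le_numeral)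
    qed
    also have "2 powr (- q * real n) * (V * (2 ^ Suc n) ^ ?d) = V * 2 ^ ?d * s ^ n"
    proof -
      have "s ^ n = 2 powr ((real ?d - q) * real n)"
        by (simp add: s_def powr_realpow[symmetric] powr_powr)
      also have "\<dots> = 2 powr (- q * real n) * 2 powr real (n * ?d)"
        by (simp add: powr_add[symmetric] algebra_simps)
      also have "2 powr real (n * ?d) = (2 ^ n) ^ ?d"
        using powr_realpow[of 2 "n * ?d"] by (simp only: power_mult zero_less_numeral)
      finally show ?thesis by (simp add: power_mult_distrib)
    qed
    finally show "(\<integral>\<^sup>+z. ?f n z \<partial>lborel) = ennreal (V * 2 ^ ?d * s ^ n)" .
  qed
  also have "\<dots> < \<infinity>"
  proof -
    have "summable (\<lambda>n. V * 2 ^ ?d * s ^ n)"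
      using s by (intro summable_mult summable_geometric) simp
    moreover have "0 \<le> V * 2 ^ ?d * s ^ n" for n
      using s(1) \<open>V \<ge> 0\<close> by (intro mult_nonneg_nonneg) auto
    ultimately have "(\<Sum>n. ennreal (V * 2 ^ ?d * s ^ n)) \<noteq> top"
      by (rule ennreal_suminf_neq_top)
    then show ?thesis unfolding infinity_ennreal_def by (rule less_top[THEN iffD1])
  qed
  finally show "(\<integral>\<^sup>+z. ennreal (norm ((norm z + 1) powr (- q))) \<partial>(lborel :: (real ^ 'n) measure)) < \<infinity>" .
qed

lemma integrable_norm_mult_power_decay:
  fixes k :: "real ^ 'n \<Rightarrow> real"
  assumes p: "p > real CARD('n) + 1" and [measurable]: "k \<in> borel_measurable borel"
    and k: "\<And>z. 0 \<le> k z" "AE z in lborel. k z \<le> C / (norm z + 1) powr p"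
  shows "integrable lborel (\<lambda>z. norm z * k z)"
proof (rule Bochner_Integration.integrable_bound)
  show "integrable lborel (\<lambda>z :: real ^ 'n. C * (norm z + 1) powr (- (p - 1)))"
    using p by (intro integrable_mult_right integrable_power_decay) simp
  show "AE z in lborel. norm (norm z * k z) \<le> norm (C * (norm z + 1) powr (- (p - 1)))"
    using k(2)
  proof eventually_elim
    case (elim z)
    have pos: "norm z + 1 > 0" by (simp add: add_nonneg_pos)
    have "norm z * k z \<le> (norm z + 1) * (C / (norm z + 1) powr p)"
      using elim k(1)[of z] by (intro mult_mono) auto
    also have "\<dots> = C * (norm z + 1) powr (- (p - 1))"
      using pos by (simp add: powr_diff powr_minus divide_simps)
    finally show ?case using k(1)[of z] by simp
  qed
qed measurable

text \<open>
  The image measure is translation invariant and gives the unit ball its Lebesgue measure. Two translation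
  invariant Borel measures that are finite on bounded sets are proportional: integrate \<open>1\<^sub>A(x) 1\<^sub>B(y)\<close> with respect to their product and
  translate first \<open>x\<close> by \<open>y\<close> and then \<open>y\<close> by \<open>-x\<close>. The unit ball \<open>B\<close> determines the factor.
\<close>

lemma distr_orthogonal_lborel:
  fixes f :: "real ^ 'n \<Rightarrow> real ^ 'n"
  assumes f: "orthogonal_transformation f"
  shows "distr lborel borel f = lborel"
proof -
  define g where "g = inv f"
  have fg: "f (g y) = y" for y
    using orthogonal_transformation_surj[OF f] by (simp add: g_def surj_f_inv_f)
  have lin: "linear f" using f by (rule orthogonal_transformation_linear)
  have [measurable]: "f \<in> borel_measurable borel"
    using lin by (intro borel_measurable_continuous_onI linear_continuous_on) (simp add: linear_conv_bounded_linear)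
  have norm_f: "norm (f x) = norm x" for x
    using f by (rule orthogonal_transformation_norm)
  let ?B = "ball (0 :: real ^ 'n) 1"
  have [measurable]: "?B \<in> sets borel" by simp
  show ?thesis
  proof (rule measure_eqI)
    fix A assume "A \<in> sets (distr lborel borel f)"
    then have [measurable]: "A \<in> sets borel" by simp
    let ?a = "indicator A :: real ^ 'n \<Rightarrow> ennreal" and ?b = "indicator ?B :: real ^ 'n \<Rightarrow> ennreal"
    have "emeasure (distr lborel borel f) A * emeasure lborel ?B
        = (\<integral>\<^sup>+y. \<integral>\<^sup>+x. ?a (f x) * ?b y \<partial>lborel \<partial>lborel)"
    proof -
      have "emeasure (distr lborel borel f) A = (\<integral>\<^sup>+x. ?a x \<partial>distr lborel borel f)" by simp
      also have "\<dots> = (\<integral>\<^sup>+x. ?a (f x) \<partial>lborel)" by (rule nn_integral_distr) measurable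
      finally have "emeasure (distr lborel borel f) A * emeasure lborel ?B
          = (\<integral>\<^sup>+x. ?a (f x) \<partial>lborel) * (\<integral>\<^sup>+y. ?b y \<partial>lborel)" by simp
      also have "\<dots> = (\<integral>\<^sup>+y. (\<integral>\<^sup>+x. ?a (f x) \<partial>lborel) * ?b y \<partial>lborel)"
        by (rule nn_integral_cmult[symmetric]) measurable
      also have "\<dots> = (\<integral>\<^sup>+y. \<integral>\<^sup>+x. ?a (f x) * ?b y \<partial>lborel \<partial>lborel)"
        by (intro nn_integral_cong nn_integral_multc[symmetric]) measurable
      finally show ?thesis .
    qed
    also have "\<dots> = (\<integral>\<^sup>+y. \<integral>\<^sup>+x. ?a (f x + y) * ?b y \<partial>lborel \<partial>lborel)"
    proof (rule nn_integral_cong)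
      fix y
      have "(\<integral>\<^sup>+x. ?a (f x) * ?b y \<partial>lborel) = (\<integral>\<^sup>+x. ?a (f (x + g y)) * ?b y \<partial>lborel)"
        by (rule nn_integral_lborel_translate[symmetric, where f = "\<lambda>x. ?a (f x) * ?b y"]) measurable
      then show "(\<integral>\<^sup>+x. ?a (f x) * ?b y \<partial>lborel) = (\<integral>\<^sup>+x. ?a (f x + y) * ?b y \<partial>lborel)"
        by (simp add: linear_add[OF lin] fg)
    qed
    also have "\<dots> = (\<integral>\<^sup>+x. \<integral>\<^sup>+y. ?a (f x + y) * ?b y \<partial>lborel \<partial>lborel)"
      by (rule lborel_pair.Fubini') measurable
    also have "\<dots> = (\<integral>\<^sup>+x. \<integral>\<^sup>+y. ?a y * ?b (y - f x) \<partial>lborel \<partial>lborel)"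
    proof (rule nn_integral_cong)
      fix x
      show "(\<integral>\<^sup>+y. ?a (f x + y) * ?b y \<partial>lborel) = (\<integral>\<^sup>+y. ?a y * ?b (y - f x) \<partial>lborel)"
        using nn_integral_lborel_translate[of "\<lambda>y. ?a y * ?b (y - f x)" "f x"] by (simp add: add.commute)
    qed
    also have "\<dots> = (\<integral>\<^sup>+y. \<integral>\<^sup>+x. ?a y * ?b (y - f x) \<partial>lborel \<partial>lborel)"
      by (rule lborel_pair.Fubini') measurable
    also have "\<dots> = (\<integral>\<^sup>+y. ?a y * emeasure lborel ?B \<partial>lborel)"
    proof (rule nn_integral_cong)
      fix y
      have "?b (y - f x) = ?b (x + - g y)" for x
      proof -
        have "norm (y - f x) = norm (f (g y - x))" by (simp add: linear_diff[OF lin] fg)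
        also have "\<dots> = norm (x + - g y)" by (simp add: norm_f norm_minus_commute)
        finally show ?thesis by (simp add: indicator_def)
      qed
      then have "(\<integral>\<^sup>+x. ?a y * ?b (y - f x) \<partial>lborel) = ?a y * (\<integral>\<^sup>+x. ?b (x + - g y) \<partial>lborel)"
        by (simp add: nn_integral_cmult)
      also have "(\<integral>\<^sup>+x. ?b (x + - g y) \<partial>lborel) = emeasure lborel ?B"
        by (subst nn_integral_lborel_translate) simp_all
      finally show "(\<integral>\<^sup>+x. ?a y * ?b (y - f x) \<partial>lborel) = ?a y * emeasure lborel ?B" .
    qed
    also have "\<dots> = emeasure lborel A * emeasure lborel ?B"
      by (simp add: nn_integral_multc)
    finally have "emeasure (distr lborel borel f) A * emeasure lborel ?B = emeasure lborel A * emeasure lborel ?B" .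
    moreover have "emeasure lborel ?B \<noteq> 0" "emeasure lborel ?B \<noteq> top"
      using emeasure_bounded_finite[of ?B] content_ball_pos[of 1 "0 :: real ^ 'n"]
      by (auto simp: measure_def less_top)
    ultimately show "emeasure (distr lborel borel f) A = emeasure lborel A"
      by (simp add: ennreal_mult_cancel_left mult.commute[of _ "emeasure lborel ?B"])
  qed simp
qed

text \<open>
  Rotations act transitively on spheres only in dimension at least two. In dimension one, \<open>z \<bullet> v\<close> has the
  single term \<open>z\<^sub>i v\<^sub>i\<close>, of modulus \<open>\<bar>z\<^sub>i\<bar> \<bar>v\<bar>\<close>.
\<close>

lemma integral_abs_inner_rotation_invariant:
  fixes k :: "real ^ 'n \<Rightarrow> real"
  assumes [measurable]: "k \<in> borel_measurable borel"
    and inv: "\<And>f. orthogonal_transformation f \<Longrightarrow> det (matrix f) = 1 \<Longrightarrow> AE z in lborel. k (f z) = k z"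
  shows "(\<integral>z. \<bar>z \<bullet> v\<bar> * k z \<partial>lborel) = norm v * (\<integral>z. \<bar>z $ i\<bar> * k z \<partial>lborel)"
proof (cases "CARD('n) = 1")
  case True
  then obtain j where "(UNIV :: 'n set) = {j}" by (rule card_1_singletonE)
  then have UNIV: "(UNIV :: 'n set) = {i}" by (metis UNIV_I singletonD)
  have "\<bar>z \<bullet> v\<bar> = norm v * \<bar>z $ i\<bar>" for z
    by (simp add: inner_vec_def norm_vec_def UNIV abs_mult)
  then show ?thesis by (simp add: mult.assoc)
next
  case False
  then have "2 \<le> CARD('n)" using one_le_card_finite[where 'a = 'n] by linarith
  then obtain f where f: "orthogonal_transformation f" "det (matrix f) = 1"
    and fv: "f (norm v *\<^sub>R axis i 1) = v"
    by (rule rotation_exists[of "norm v *\<^sub>R axis i 1" v]) simp_all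
  have lin: "linear f" using f(1) by (rule orthogonal_transformation_linear)
  have [measurable]: "f \<in> borel_measurable borel"
    using lin by (intro borel_measurable_continuous_onI linear_continuous_on) (simp add: linear_conv_bounded_linear)
  have "(\<integral>z. \<bar>z \<bullet> v\<bar> * k z \<partial>lborel) = (\<integral>z. \<bar>z \<bullet> v\<bar> * k z \<partial>distr lborel borel f)"
    by (simp add: distr_orthogonal_lborel[OF f(1)])
  also have "\<dots> = (\<integral>z. \<bar>f z \<bullet> v\<bar> * k (f z) \<partial>lborel)"
    by (rule integral_distr) measurable
  also have "\<dots> = (\<integral>z. norm v * (\<bar>z $ i\<bar> * k z) \<partial>lborel)"
  proof (rule integral_cong_AE)
    show "AE z in lborel. \<bar>f z \<bullet> v\<bar> * k (f z) = norm v * (\<bar>z $ i\<bar> * k z)"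
      using inv[OF f]
    proof eventually_elim
      case (elim z)
      have "f z \<bullet> v = f z \<bullet> f (norm v *\<^sub>R axis i 1)" by (simp add: fv)
      also have "\<dots> = norm v * z $ i"
        using f(1) by (simp add: orthogonal_transformation_def inner_axis)
      finally show ?case by (simp add: elim abs_mult)
    qed
  qed measurable
  finally show ?thesis by simp
qed


section \<open>Moving mass of the kernel along lattice vectors\<close>

context periodic_borel_set
begin

text \<open>
  For each axis the same amount \<open>m / d\<close> of density is removed from the ball of radius \<open>r\<close> around \<open>L e\<^sub>j\<close> and
  added to the ball around the origin. Per unit of mass this lowers the first moment in direction \<open>v\<close> by
  \<open>\<bar>(z + L e\<^sub>j) \<bullet> v\<bar> - \<bar>z \<bullet> v\<bar> \<ge> L \<bar>v\<^sub>j\<bar> - 2 r \<bar>v\<bar>\<close>. This may be negative for a single axis, but the sum over all axes is at least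
  \<open>(L - 2 d r) \<bar>v\<bar> = L \<bar>v\<bar> / 2\<close> for the chosen radius \<open>r = L / (4 d)\<close>; this is why the weights must be equal
  for all axes and constant on the balls.
\<close>

lemma kernel_mass_transfer:
  fixes k :: "real ^ 'n \<Rightarrow> real"
  assumes [measurable]: "k \<in> borel_measurable borel" and k_nonneg: "\<And>z. 0 \<le> k z"
    and int: "integrable lborel k" and int_norm: "integrable lborel (\<lambda>z. norm z * k z)"
    and m: "m > 0" "\<And>z. norm z \<le> 2 * L \<Longrightarrow> m \<le> k z"
  obtains k' \<delta> where "k' \<in> borel_measurable borel" "\<And>z. 0 \<le> k' z" "integrable lborel k'"
    "integrable lborel (\<lambda>z. norm z * k' z)" "\<delta> > 0"
    "(\<integral>z. translation_defect L E z * k' z \<partial>lborel) = (\<integral>z. translation_defect L E z * k z \<partial>lborel)"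
    "\<And>v. (\<integral>z. \<bar>z \<bullet> v\<bar> * k' z \<partial>lborel) \<le> (\<integral>z. \<bar>z \<bullet> v\<bar> * k z \<partial>lborel) - \<delta> * norm v"
proof -
  define d where "d = real CARD('n)"
  have d: "d \<ge> 1" by (simp add: d_def Suc_leI)
  define r where "r = L / (4 * d)"
  have r: "r > 0" "r \<le> L" "2 * d * r = L / 2"
  proof -
    show "r > 0" "2 * d * r = L / 2" using L_pos d by (simp_all add: r_def)
    have "L * 1 \<le> L * (4 * d)" using L_pos d by (intro mult_left_mono) auto
    then show "r \<le> L" using d by (simp add: r_def divide_le_eq)
  qed
  define c where "c j = L *\<^sub>R (axis j 1 :: real ^ 'n)" for j
  define \<beta> where "\<beta> = indicat_real (ball (0 :: real ^ 'n) r)"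
  have [measurable]: "\<beta> \<in> borel_measurable borel" unfolding \<beta>_def by (intro borel_measurable_indicator) simp
  have \<beta>: "0 \<le> \<beta> z" "\<beta> z \<le> 1" "\<beta> z \<noteq> 0 \<Longrightarrow> norm z < r" for z
    by (auto simp: \<beta>_def indicator_def split: if_splits)
  have \<beta>_shift: "norm z \<le> 2 * L" if "\<beta> (z - c j) \<noteq> 0" for z j
  proof -
    have "norm z \<le> norm (z - c j) + norm (c j)" using norm_triangle_ineq[of "z - c j" "c j"] by simp
    then show ?thesis using \<beta>(3)[OF that] r L_pos by (simp add: c_def)
  qed
  have int_\<beta>: "integrable lborel (\<lambda>z. f z * \<beta> z)"
    if [measurable]: "f \<in> borel_measurable borel" and "\<And>z. norm z \<le> r \<Longrightarrow> \<bar>f z\<bar> \<le> C" for f :: "real ^ 'n \<Rightarrow> real" and C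
  proof (rule integrableI_bounded_set[where A = "ball 0 r" and B = C])
    show "emeasure lborel (ball (0 :: real ^ 'n) r) < \<infinity>"
      by (intro emeasure_bounded_finite bounded_ball)
    show "(\<lambda>z. f z * \<beta> z) \<in> borel_measurable lborel" by measurable
    show "AE z in lborel. z \<in> ball 0 r \<longrightarrow> norm (f z * \<beta> z) \<le> C"
      using that(2) by (auto simp: \<beta>_def)
    show "AE z in lborel. z \<notin> ball 0 r \<longrightarrow> f z * \<beta> z = 0"
      by (simp add: \<beta>_def)
  qed simp
  have shift: "(\<integral>z. f z * \<beta> (z - c j) \<partial>lborel) = (\<integral>z. f (z + c j) * \<beta> z \<partial>lborel)"
    if [measurable]: "f \<in> borel_measurable borel" for f :: "real ^ 'n \<Rightarrow> real" and j
    using integral_lborel_translate[of "\<lambda>z. f z * \<beta> (z - c j)" "c j"] by simp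
  have int_shift: "integrable lborel (\<lambda>z. f z * \<beta> (z - c j))"
    if f [measurable]: "f \<in> borel_measurable borel" and "\<And>z. norm z \<le> r \<Longrightarrow> \<bar>f (z + c j)\<bar> \<le> C"
    for f :: "real ^ 'n \<Rightarrow> real" and j C
    using integrable_lborel_translate[of "\<lambda>z. f (z + c j) * \<beta> z" "- c j"] int_\<beta>[of "\<lambda>z. f (z + c j)" C] that by simp
  define b where "b z = (m / d) * (\<Sum>j\<in>UNIV. \<beta> z - \<beta> (z - c j))" for z
  have [measurable]: "b \<in> borel_measurable borel" unfolding b_def by measurable
  define k' where "k' z = k z + b z" for z
  have k'_meas: "k' \<in> borel_measurable borel" unfolding k'_def by measurable
  have k'_nonneg: "0 \<le> k' z" for z
  proof -
    have "(\<Sum>j\<in>UNIV. \<beta> (z - c j)) * (m / d) \<le> k z"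
    proof (cases "norm z \<le> 2 * L")
      case True
      have "(\<Sum>j\<in>(UNIV :: 'n set). \<beta> (z - c j)) \<le> d"
        using sum_bounded_above[of "UNIV :: 'n set" "\<lambda>j. \<beta> (z - c j)" 1] \<beta>(2) by (simp add: d_def)
      then have "(\<Sum>j\<in>UNIV. \<beta> (z - c j)) * (m / d) \<le> d * (m / d)"
        using m(1) d by (intro mult_right_mono) auto
      also have "\<dots> \<le> k z" using d m(2)[OF True] by simp
      finally show ?thesis .
    next
      case False
      then have "\<beta> (z - c j) = 0" for j using \<beta>_shift by blast
      then show ?thesis using k_nonneg by simp
    qed
    moreover have "0 \<le> (\<Sum>j\<in>(UNIV :: 'n set). \<beta> z) * (m / d)"
      using m(1) d \<beta>(1) by (intro mult_nonneg_nonneg sum_nonneg) auto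
    ultimately show ?thesis by (simp add: k'_def b_def sum_subtractf algebra_simps)
  qed
  have bnd: "\<exists>C. \<forall>z. norm z \<le> r \<longrightarrow> \<bar>f (z + y)\<bar> \<le> C" if "continuous_on UNIV f" for f :: "real ^ 'n \<Rightarrow> real" and y
  proof -
    have "compact ((\<lambda>z. f (z + y)) ` cball 0 r)"
      by (intro compact_continuous_image continuous_on_compose2[OF that] continuous_intros) auto
    then obtain C where "\<forall>z\<in>cball 0 r. \<bar>f (z + y)\<bar> \<le> C"
      by (auto dest!: compact_imp_bounded simp: bounded_iff)
    then show ?thesis by (intro exI[of _ C]) simp
  qed
  have int_b: "integrable lborel (\<lambda>z. f z * b z)"
    and integral_b: "(\<integral>z. f z * b z \<partial>lborel) = (m / d) * (\<Sum>j\<in>UNIV. (\<integral>z. f z * \<beta> z \<partial>lborel) - (\<integral>z. f (z + c j) * \<beta> z \<partial>lborel))"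
    if f [measurable]: "f \<in> borel_measurable borel" and f_bnd: "\<And>y. \<exists>C. \<forall>z. norm z \<le> r \<longrightarrow> \<bar>f (z + y)\<bar> \<le> C"
    for f :: "real ^ 'n \<Rightarrow> real"
  proof -
    have i0: "integrable lborel (\<lambda>z. f z * \<beta> z)"
      using f_bnd[of 0] int_\<beta>[OF f] by auto
    have i1: "integrable lborel (\<lambda>z. f z * \<beta> (z - c j))" for j
      using f_bnd[of "c j"] int_shift[OF f] by blast
    have eq: "f z * b z = (m / d) * (\<Sum>j\<in>UNIV. f z * \<beta> z - f z * \<beta> (z - c j))" for z
      by (simp add: b_def sum_distrib_left right_diff_distrib mult.left_commute)
    show "integrable lborel (\<lambda>z. f z * b z)"
      unfolding eq using i0 i1 by auto
    show "(\<integral>z. f z * b z \<partial>lborel) = (m / d) * (\<Sum>j\<in>UNIV. (\<integral>z. f z * \<beta> z \<partial>lborel) - (\<integral>z. f (z + c j) * \<beta> z \<partial>lborel))"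
      unfolding eq using i0 i1 by (simp add: shift)
  qed
  define V where "V = measure lborel (ball (0 :: real ^ 'n) r)"
  have V: "V > 0" using content_ball_pos[OF r(1), of "0 :: real ^ 'n"] by (simp add: V_def)
  have int_\<beta>1: "integrable lborel \<beta>" using int_\<beta>[of "\<lambda>_. 1" 1] by simp
  have V_eq: "V = (\<integral>z. \<beta> z \<partial>lborel)" by (simp add: V_def \<beta>_def)
  have inner_bnd: "\<exists>C. \<forall>z. norm z \<le> r \<longrightarrow> \<bar>\<bar>(z + y) \<bullet> v\<bar>\<bar> \<le> C" for y v :: "real ^ 'n"
    by (rule bnd[where f = "\<lambda>z. \<bar>z \<bullet> v\<bar>"]) (intro continuous_intros)
  define \<delta> where "\<delta> = (m / d) * (V * (L / 2))"
  have \<delta>: "\<delta> > 0" using m(1) d V L_pos by (simp add: \<delta>_def)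
  have N_bnd: "\<exists>C. \<forall>z. norm z \<le> r \<longrightarrow> \<bar>translation_defect L E (z + y)\<bar> \<le> C" for y
    using translation_defect_le translation_defect_nonneg by (metis abs_of_nonneg)
  have int_inner: "integrable lborel (\<lambda>z. \<bar>z \<bullet> v\<bar> * k z)" for v :: "real ^ 'n"
  proof (rule Bochner_Integration.integrable_bound)
    show "integrable lborel (\<lambda>z. norm v * (norm z * k z))" using int_norm by simp
    have "\<bar>z \<bullet> v\<bar> * k z \<le> norm v * (norm z * k z)" for z
      using mult_right_mono[OF Cauchy_Schwarz_ineq2[of z v] k_nonneg[of z]] by (simp add: ac_simps)
    then show "AE z in lborel. norm (\<bar>z \<bullet> v\<bar> * k z) \<le> norm (norm v * (norm z * k z))"
      using k_nonneg by (auto simp: abs_mult)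
  qed measurable
  have int_N: "integrable lborel (\<lambda>z. translation_defect L E z * k z)"
    by (rule integrable_translation_defect_mult[OF _ k_nonneg int]) measurable
  show ?thesis
  proof (rule that[of k' \<delta>])
    show "k' \<in> borel_measurable borel" "0 \<le> k' z" "\<delta> > 0" for z by fact+
    show "integrable lborel k'"
      unfolding k'_def using int int_b[of "\<lambda>_. 1"] by auto
    have "\<exists>C. \<forall>z. norm z \<le> r \<longrightarrow> \<bar>norm (z + y)\<bar> \<le> C" for y :: "real ^ 'n"
      by (rule bnd[where f = norm]) (intro continuous_intros)
    then show "integrable lborel (\<lambda>z. norm z * k' z)"
      unfolding k'_def distrib_left using int_norm int_b[of norm] by auto
    have "(\<integral>z. translation_defect L E z * k' z \<partial>lborel)
        = (\<integral>z. translation_defect L E z * k z \<partial>lborel) + (\<integral>z. translation_defect L E z * b z \<partial>lborel)"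
      unfolding k'_def distrib_left using int_N int_b[OF measurable_translation_defect N_bnd] by simp
    also have "(\<integral>z. translation_defect L E z * b z \<partial>lborel) = 0"
      unfolding integral_b[OF measurable_translation_defect N_bnd]
      using translation_defect_lattice[OF axis_in_lattice] by (simp add: c_def add.commute)
    finally show "(\<integral>z. translation_defect L E z * k' z \<partial>lborel) = (\<integral>z. translation_defect L E z * k z \<partial>lborel)"
      by simp
    fix v :: "real ^ 'n"
    have inner_meas: "(\<lambda>z. \<bar>z \<bullet> v\<bar>) \<in> borel_measurable borel" by measurable
    have gain: "V * (L * \<bar>v $ j\<bar> - 2 * r * norm v) \<le> (\<integral>z. \<bar>(z + c j) \<bullet> v\<bar> * \<beta> z \<partial>lborel) - (\<integral>z. \<bar>z \<bullet> v\<bar> * \<beta> z \<partial>lborel)" for j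
    proof -
      have i: "integrable lborel (\<lambda>z. \<bar>(z + y) \<bullet> v\<bar> * \<beta> z)" for y
        using inner_bnd[of y v] int_\<beta>[of "\<lambda>z. \<bar>(z + y) \<bullet> v\<bar>"] by auto
      have "V * (L * \<bar>v $ j\<bar> - 2 * r * norm v) = (\<integral>z. (L * \<bar>v $ j\<bar> - 2 * r * norm v) * \<beta> z \<partial>lborel)"
        by (simp add: V_eq)
      also have "\<dots> \<le> (\<integral>z. \<bar>(z + c j) \<bullet> v\<bar> * \<beta> z - \<bar>z \<bullet> v\<bar> * \<beta> z \<partial>lborel)"
      proof (rule integral_mono)
        show "integrable lborel (\<lambda>z. (L * \<bar>v $ j\<bar> - 2 * r * norm v) * \<beta> z)" using int_\<beta>1 by simp
        show "integrable lborel (\<lambda>z. \<bar>(z + c j) \<bullet> v\<bar> * \<beta> z - \<bar>z \<bullet> v\<bar> * \<beta> z)"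
          using i[of "c j"] i[of 0] by simp
        fix z
        show "(L * \<bar>v $ j\<bar> - 2 * r * norm v) * \<beta> z \<le> \<bar>(z + c j) \<bullet> v\<bar> * \<beta> z - \<bar>z \<bullet> v\<bar> * \<beta> z"
        proof (cases "\<beta> z = 0")
          case False
          have "\<bar>z \<bullet> v\<bar> \<le> norm z * norm v" by (rule Cauchy_Schwarz_ineq2)
          also have "\<dots> \<le> r * norm v" using \<beta>(3)[OF False] by (intro mult_right_mono) auto
          finally have 1: "\<bar>z \<bullet> v\<bar> \<le> r * norm v" .
          have "(z + c j) \<bullet> v = z \<bullet> v + L * v $ j"
            by (simp add: c_def inner_add_left inner_axis')
          moreover have "\<bar>L * v $ j\<bar> = L * \<bar>v $ j\<bar>" using L_pos by (simp add: abs_mult)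
          ultimately have "L * \<bar>v $ j\<bar> - 2 * r * norm v \<le> \<bar>(z + c j) \<bullet> v\<bar> - \<bar>z \<bullet> v\<bar>"
            using 1 by linarith
          then show ?thesis using mult_right_mono[OF _ \<beta>(1)[of z]] by (fastforce simp: left_diff_distrib)
        qed simp
      qed
      also have "\<dots> = (\<integral>z. \<bar>(z + c j) \<bullet> v\<bar> * \<beta> z \<partial>lborel) - (\<integral>z. \<bar>z \<bullet> v\<bar> * \<beta> z \<partial>lborel)"
        using i[of "c j"] i[of 0] by simp
      finally show ?thesis .
    qed
    have "V * (L / 2 * norm v) = V * (L * norm v - d * (2 * r * norm v))"
    proof -
      have "d * (2 * r * norm v) = (2 * d * r) * norm v" by simp
      also have "\<dots> = L / 2 * norm v" by (simp only: r(3))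
      finally show ?thesis by (simp add: field_simps)
    qed
    also have "\<dots> \<le> V * (L * (\<Sum>j\<in>UNIV. \<bar>v $ j\<bar>) - d * (2 * r * norm v))"
      using V L_pos norm_le_l1_cart[of v] by (intro mult_left_mono diff_right_mono) auto
    also have "\<dots> = (\<Sum>j\<in>UNIV. V * (L * \<bar>v $ j\<bar> - 2 * r * norm v))"
      by (simp add: sum_subtractf sum_distrib_left right_diff_distrib d_def)
    also have "\<dots> \<le> (\<Sum>j\<in>UNIV. (\<integral>z. \<bar>(z + c j) \<bullet> v\<bar> * \<beta> z \<partial>lborel) - (\<integral>z. \<bar>z \<bullet> v\<bar> * \<beta> z \<partial>lborel))"
      by (intro sum_mono gain)
    finally have "(m / d) * (V * (L / 2 * norm v))
        \<le> (m / d) * (\<Sum>j\<in>UNIV. (\<integral>z. \<bar>(z + c j) \<bullet> v\<bar> * \<beta> z \<partial>lborel) - (\<integral>z. \<bar>z \<bullet> v\<bar> * \<beta> z \<partial>lborel))"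
      using m(1) d by (intro mult_left_mono) auto
    also have "\<dots> = - (\<integral>z. \<bar>z \<bullet> v\<bar> * b z \<partial>lborel)"
      unfolding integral_b[OF inner_meas inner_bnd] by (simp add: sum_subtractf right_diff_distrib)
    finally have "(\<integral>z. \<bar>z \<bullet> v\<bar> * b z \<partial>lborel) \<le> - (\<delta> * norm v)"
      by (simp add: \<delta>_def mult.assoc)
    moreover have "(\<integral>z. \<bar>z \<bullet> v\<bar> * k' z \<partial>lborel)
        = (\<integral>z. \<bar>z \<bullet> v\<bar> * k z \<partial>lborel) + (\<integral>z. \<bar>z \<bullet> v\<bar> * b z \<partial>lborel)"
      unfolding k'_def distrib_left using int_inner int_b[OF inner_meas inner_bnd] by simp
    ultimately show "(\<integral>z. \<bar>z \<bullet> v\<bar> * k' z \<partial>lborel) \<le> (\<integral>z. \<bar>z \<bullet> v\<bar> * k z \<partial>lborel) - \<delta> * norm v"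
      by linarith
  qed
qed

end

section \<open>Sets without translation defects\<close>

lemma negligible_of_negligible_Int_cube:
  fixes S :: "(real ^ 'n) set"
  assumes L: "L > 0" and S: "periodic L (\<lambda>x. x \<in> S)" and null: "negligible (S \<inter> cube L)"
  shows "negligible S"
proof -
  have "S \<subseteq> \<Union>((\<lambda>z. (+) (L *\<^sub>R z) ` (S \<inter> cube L)) ` lattice)"
  proof
    fix x assume x: "x \<in> S"
    obtain z where z: "z \<in> lattice" "x + L *\<^sub>R z \<in> cube L"
      using cube_translate_ex1[OF L, of x] by blast
    then have "x + L *\<^sub>R z \<in> S \<inter> cube L" using x S by (simp add: periodic_def)
    then have "x \<in> (+) (L *\<^sub>R (- z)) ` (S \<inter> cube L)"
      by (intro image_eqI[where x = "x + L *\<^sub>R z"]) simp_all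
    then show "x \<in> \<Union>((\<lambda>z. (+) (L *\<^sub>R z) ` (S \<inter> cube L)) ` lattice)"
      using z(1) by (intro UN_I[of "- z"]) simp_all
  qed
  moreover have "negligible (\<Union>((\<lambda>z. (+) (L *\<^sub>R z) ` (S \<inter> cube L)) ` lattice))"
    by (intro negligible_countable_Union countable_image countable_lattice)
       (auto intro: negligible_translation null)
  ultimately show ?thesis by (rule negligible_subset[rotated])
qed

context periodic_borel_set
begin

lemma negligible_of_cell_integral_zero:
  fixes S :: "(real ^ 'n) set"
  assumes [measurable]: "S \<in> sets borel" and S: "periodic L (\<lambda>x. x \<in> S)"
    and zero: "(\<integral>x. indicat_real S x \<partial>cell L) = 0"
  shows "negligible S"
proof (rule negligible_of_negligible_Int_cube[OF L_pos S])
  have int: "integrable (cell L) (indicat_real S)"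
    by (rule integrable_cell_bounded[where C = 1]) (auto simp: indicator_def)
  have "AE x in cell L. indicat_real S x = 0"
    by (rule integral_nonneg_eq_0_iff_AE[OF int, THEN iffD1]) (use zero in simp_all)
  then have "AE x in lborel. x \<in> cube L \<longrightarrow> x \<notin> S"
    unfolding cell_def by (subst (asm) AE_density) (auto simp: indicator_def)
  then have "S \<inter> cube L \<in> null_sets lborel"
    by (subst AE_iff_null_sets) (auto elim: eventually_mono)
  then show "negligible (S \<inter> cube L)"
    by (simp add: negligible_iff_null_sets null_sets_completionI)
qed

text \<open>
  If the defect vanishes almost everywhere, then so does its integral over a cell. By periodicity that
  integral is \<open>2 P (V - P)\<close>, where \<open>P\<close> and \<open>V\<close> are the volumes of \<open>E\<close> in a cell and of the cell.
\<close>

lemma integral_translation_defect_zero: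
  fixes k :: "real ^ 'n \<Rightarrow> real"
  assumes [measurable]: "k \<in> borel_measurable borel" and k: "\<And>z. 0 < k z"
    and int: "integrable lborel (\<lambda>z. translation_defect L E z * k z)"
    and zero: "(\<integral>z. translation_defect L E z * k z \<partial>lborel) = 0"
  shows "negligible E \<or> negligible (- E)"
proof -
  interpret P: pair_sigma_finite "cell L :: (real ^ 'n) measure" "cell L :: (real ^ 'n) measure" ..
  interpret PF: finite_measure "(cell L :: (real ^ 'n) measure) \<Otimes>\<^sub>M (cell L :: (real ^ 'n) measure)"
    by (intro finite_measure_pair_measure cell.finite_measure_axioms)
  define V where "V = measure (cell L :: (real ^ 'n) measure) UNIV"
  define P where "P = (\<integral>x. e x \<partial>cell L)"
  have int_e: "integrable (cell L) e"
    by (intro integrable_cell_bounded[where C = 1]) (auto simp: e_range)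
  have "AE z in lborel. translation_defect L E z * k z = 0"
    using zero int translation_defect_nonneg k[THEN less_imp_le]
    by (subst integral_nonneg_eq_0_iff_AE[symmetric]) auto
  then have "AE z in lborel. translation_defect L E z = 0"
    by (rule eventually_mono) (metis k less_irrefl mult_eq_0_iff)
  then have "AE z in cell L. translation_defect L E z = 0"
    unfolding cell_def by (subst AE_density) (auto elim: eventually_mono)
  then have "0 = (\<integral>z. translation_defect L E z \<partial>cell L)"
    using integral_eq_zero_AE[of _ "cell L"] by metis
  also have "\<dots> = (\<integral>x. (\<integral>z. \<bar>e (x + z) - e x\<bar> \<partial>cell L) \<partial>cell L)"
    unfolding translation_defect_def
    by (rule P.Fubini_integral) (auto intro!: PF.integrable_const_bound[where B = 1] simp: e_range)
  also have "\<dots> = (\<integral>x. (1 - e x) * P + e x * (V - P) \<partial>cell L)"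
  proof (rule Bochner_Integration.integral_cong[OF refl])
    fix x
    have "(\<integral>z. \<bar>e (x + z) - e x\<bar> \<partial>cell L) = (\<integral>z. \<bar>e z - e x\<bar> \<partial>cell L)"
      using integral_cell_translate[OF L_pos, of "\<lambda>z. \<bar>e z - e x\<bar>" 1 x]
      by (simp add: periodic_def e_periodic' e_range add.commute)
    also have "\<dots> = (\<integral>z. (1 - e x) * e z + e x * (1 - e z) \<partial>cell L)"
      by (intro Bochner_Integration.integral_cong refl) (auto simp: indicator_def)
    also have "\<dots> = (1 - e x) * P + e x * (V - P)"
      using int_e by (simp add: P_def V_def)
    finally show "(\<integral>z. \<bar>e (x + z) - e x\<bar> \<partial>cell L) = (1 - e x) * P + e x * (V - P)" .
  qed
  also have "\<dots> = (V - P) * P + P * (V - P)"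
    using int_e by (simp add: P_def V_def algebra_simps)
  finally have "P = 0 \<or> V = P" by simp
  then show ?thesis
  proof
    assume "P = 0"
    then have "negligible E"
      unfolding P_def by (intro negligible_of_cell_integral_zero E_periodic) auto
    then show ?thesis ..
  next
    assume "V = P"
    have "(\<integral>x. indicat_real (- E) x \<partial>cell L) = (\<integral>x. 1 - e x \<partial>cell L)"
      by (intro Bochner_Integration.integral_cong refl) (auto simp: indicator_def)
    also have "\<dots> = 0" using int_e \<open>V = P\<close> by (simp add: P_def V_def)
    finally have "negligible (- E)"
      using E_periodic by (intro negligible_of_cell_integral_zero) (auto simp: periodic_def)
    then show ?thesis ..
  qed
qed

end

section \<open>Variation of sets that agree almost everywhere\<close>

lemma continuous_on_divergence: "\<phi> \<in> test_fields A \<Longrightarrow> continuous_on UNIV (divergence \<phi>)"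
  unfolding divergence_def[abs_def] trace_def test_fields_def
  by (auto intro!: continuous_intros)

lemma ae_eq_set_AE: "ae_eq_set A B \<Longrightarrow> AE x in lebesgue. x \<in> A \<longleftrightarrow> x \<in> B"
  unfolding ae_eq_set_def by (rule AE_I') auto

lemma set_integral_divergence_cong:
  fixes E F :: "(real ^ 'n) set"
  assumes "ae_eq_set E F" and \<phi>: "\<phi> \<in> test_fields A" and F: "F \<in> sets lebesgue"
  shows "(LINT x:E|lebesgue. divergence \<phi> x) = (LINT x:F|lebesgue. divergence \<phi> x)"
proof -
  have [measurable]: "divergence \<phi> \<in> borel_measurable lebesgue"
    using borel_measurable_continuous_onI[OF continuous_on_divergence[OF \<phi>]]
    by (intro measurable_completion) simp
  have ae: "AE x in lebesgue. indicat_real F x *\<^sub>R divergence \<phi> x = indicat_real E x *\<^sub>R divergence \<phi> x"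
    using ae_eq_set_AE[OF assms(1)] by eventually_elim (simp add: indicator_def)
  have F_meas: "(\<lambda>x. indicat_real F x *\<^sub>R divergence \<phi> x) \<in> borel_measurable lebesgue"
    using F by measurable
  show ?thesis
    unfolding set_lebesgue_integral_def
    using integral_cong_AE[OF F_meas borel_measurable_AE[OF F_meas ae] ae] by simp
qed

lemma variation_cong: "ae_eq_set E F \<Longrightarrow> F \<in> sets lebesgue \<Longrightarrow> variation E A = variation F A"
  unfolding variation_def by (intro SUP_cong refl) (simp add: set_integral_divergence_cong)

lemma zero_test_field: "(\<lambda>x. 0) \<in> test_fields A"
  by (simp add: test_fields_def jacobian_def frechet_derivative_const matrix_def)

lemma divergence_zero_field: "divergence (\<lambda>x. 0) x = 0"
  by (simp add: divergence_def jacobian_def frechet_derivative_const matrix_def trace_def)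

lemma variation_nonneg: "0 \<le> variation E A"
  unfolding variation_def
  by (rule SUP_upper2[OF zero_test_field]) (simp add: divergence_zero_field set_lebesgue_integral_def)

lemma perimeter_nonneg: "0 \<le> perimeter E B"
  unfolding perimeter_def by (intro INF_greatest variation_nonneg)

text \<open>
  Each diagonal entry \<open>D i\<close> of the Jacobian integrates over a unit segment in direction \<open>i\<close> to a difference
  of two translates of the component \<open>\<phi>\<^sub>i\<close>. Integrating over all segments gives the integral of \<open>D i\<close> on one
  side and zero on the other.
\<close>

lemma integral_divergence_test_field:
  fixes \<phi> :: "real ^ 'n \<Rightarrow> real ^ 'n"
  assumes \<phi>: "\<phi> \<in> test_fields A"
  shows "(\<integral>x. divergence \<phi> x \<partial>lborel) = 0"
proof -
  let ?S = "closure {x. \<phi> x \<noteq> 0}"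
  have diff: "\<phi> differentiable (at x)" for x using \<phi> by (simp add: test_fields_def)
  have deriv: "(\<phi> has_derivative (\<lambda>h. jacobian \<phi> (at x) *v h)) (at x)" for x
    using diff[of x] by (simp add: jacobian_works)
  have cont_jac: "continuous_on UNIV (\<lambda>x. jacobian \<phi> (at x))" and cpt: "compact ?S"
    using \<phi> by (simp_all add: test_fields_def)
  have cont_\<phi>: "continuous_on UNIV \<phi>"
    using diff by (simp add: continuous_on_eq_continuous_at differentiable_imp_continuous_within)
  obtain R where R: "R > 0" "\<And>x. x \<in> ?S \<Longrightarrow> norm x \<le> R"
    using compact_imp_bounded[OF cpt] by (auto simp: bounded_pos)
  have \<phi>_zero: "\<phi> x = 0" if "x \<notin> ?S" for x
  proof (rule ccontr)
    assume "\<phi> x \<noteq> 0"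
    then have "x \<in> {x. \<phi> x \<noteq> 0}" by simp
    then have "x \<in> ?S" by (rule subsetD[OF closure_subset])
    with that show False by (rule notE)
  qed
  have jac_zero: "jacobian \<phi> (at x) = 0" if x: "x \<notin> ?S" for x
  proof -
    have "open (- ?S)" by (rule open_Compl[OF closed_closure])
    have const: "((\<lambda>x. 0 :: real ^ 'n) has_derivative (\<lambda>h. 0)) (at x)"
      by (rule has_derivative_const)
    have "x \<in> - ?S" by (rule ComplI, rule notE[OF x])
    have eq: "0 = \<phi> y" if "y \<in> - ?S" for y
      using \<phi>_zero[of y] ComplD[OF that] by metis
    have "(\<phi> has_derivative (\<lambda>h. 0)) (at x)"
      by (rule has_derivative_transform_within_open[OF const \<open>open (- ?S)\<close> \<open>x \<in> - ?S\<close> eq])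
    then have "frechet_derivative \<phi> (at x) = (\<lambda>h. 0)"
      by (rule frechet_derivative_at[symmetric])
    then show ?thesis by (simp add: jacobian_def matrix_def vec_eq_iff)
  qed
  define D where "D i x = jacobian \<phi> (at x) $ i $ i" for i x
  have cont_D: "continuous_on UNIV (D i)" for i
    unfolding D_def[abs_def] by (intro continuous_intros cont_jac)
  have [measurable]: "D i \<in> borel_measurable borel" for i
    by (rule borel_measurable_continuous_onI[OF cont_D])
  have D_zero: "D i x = 0" if "norm x > R" for i x
  proof -
    have "x \<notin> ?S" using R(2)[of x] that by linarith
    then show ?thesis by (simp add: D_def jac_zero)
  qed
  have int_D: "integrable lborel (D i)" for i
  proof -
    have "integrable lborel (\<lambda>x. indicator (cball 0 R) x *\<^sub>R D i x)"
      by (intro borel_integrable_compact continuous_on_subset[OF cont_D]) auto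
    also have "(\<lambda>x. indicator (cball 0 R) x *\<^sub>R D i x) = D i"
      using D_zero by (auto simp: indicator_def fun_eq_iff)
    finally show ?thesis .
  qed
  have "(\<integral>x. D i x \<partial>lborel) = 0" for i
  proof -
    let ?e = "axis i 1 :: real ^ 'n"
    let ?f = "\<lambda>x. \<phi> x $ i"
    have cont_f: "continuous_on UNIV ?f" by (intro continuous_intros cont_\<phi>)
    have int_f: "integrable lborel ?f"
    proof -
      have "integrable lborel (\<lambda>x. indicator ?S x *\<^sub>R ?f x)"
        by (intro borel_integrable_compact continuous_on_subset[OF cont_f] cpt) auto
      also have "(\<lambda>x. indicator ?S x *\<^sub>R ?f x) = ?f"
      proof
        fix x show "indicator ?S x *\<^sub>R ?f x = ?f x"
          using \<phi>_zero[of x] by (cases "x \<in> ?S") simp_all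
      qed
      finally show ?thesis .
    qed
    obtain C where C: "\<And>x. x \<in> cball 0 R \<Longrightarrow> \<bar>D i x\<bar> \<le> C"
    proof -
      have "compact (D i ` cball 0 R)"
        by (intro compact_continuous_image continuous_on_subset[OF cont_D]) auto
      then obtain C where "\<forall>x\<in>cball 0 R. \<bar>D i x\<bar> \<le> C"
        by (auto dest!: compact_imp_bounded simp: bounded_iff)
      then show ?thesis using that by blast
    qed
    have "\<bar>D i 0\<bar> \<le> C" using C[of 0] R(1) by simp
    then have C': "\<bar>D i x\<bar> \<le> C" for x
      using C[of x] D_zero[of x i] by (cases "norm x \<le> R") auto
    have line: "?f (x + ?e) - ?f x = (\<integral>t. indicat_real {0..1} t * D i (x + t *\<^sub>R ?e) \<partial>unit_interval)" for x
    proof -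
      have "(\<integral>t. indicat_real {0..1} t * D i (x + t *\<^sub>R ?e) \<partial>unit_interval) = (\<integral>t. D i (x + t *\<^sub>R ?e) \<partial>unit_interval)"
        by (rule integral_unit_interval_restrict) measurable
      also have "\<dots> = (\<integral>t. D i (x + t *\<^sub>R ?e) * indicator {0..1} t \<partial>lborel)"
        by (rule integral_unit_interval) measurable
      also have "\<dots> = ?f (x + 1 *\<^sub>R ?e) - ?f (x + 0 *\<^sub>R ?e)"
      proof (rule integral_FTC_Icc_real[where F = "\<lambda>t. ?f (x + t *\<^sub>R ?e)"])
        fix t :: real
        have "((\<lambda>t. \<phi> (x + t *\<^sub>R ?e)) has_derivative (\<lambda>h. jacobian \<phi> (at (x + t *\<^sub>R ?e)) *v (0 + h *\<^sub>R ?e))) (at t)"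
          by (rule has_derivative_compose[OF _ deriv]) (auto intro!: derivative_eq_intros)
        then have "((\<lambda>t. ?f (x + t *\<^sub>R ?e)) has_derivative (\<lambda>h. (jacobian \<phi> (at (x + t *\<^sub>R ?e)) *v (0 + h *\<^sub>R ?e)) $ i)) (at t)"
          by (rule bounded_linear.has_derivative[OF bounded_linear_vec_nth])
        moreover have "(jacobian \<phi> (at (x + t *\<^sub>R ?e)) *v (0 + h *\<^sub>R ?e)) $ i = D i (x + t *\<^sub>R ?e) * h" for h
          by (simp add: D_def matrix_vector_mult_scaleR matrix_vector_mul_component inner_axis mult.commute)
        ultimately show "DERIV (\<lambda>t. ?f (x + t *\<^sub>R ?e)) t :> D i (x + t *\<^sub>R ?e)"
          by (simp add: has_field_derivative_def)
        have "isCont (D i) y" for y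
          using cont_D[of i] by (simp add: continuous_on_eq_continuous_at)
        moreover have "isCont (\<lambda>t. x + t *\<^sub>R ?e) t" by (intro continuous_intros)
        ultimately show "isCont (\<lambda>t. D i (x + t *\<^sub>R ?e)) t" by (rule isCont_o2[rotated])
      qed simp
      finally show ?thesis by simp
    qed
    interpret P: pair_sigma_finite unit_interval "lborel :: (real ^ 'n) measure" ..
    have int: "integrable (unit_interval \<Otimes>\<^sub>M lborel) (\<lambda>(t, x). indicat_real {0..1} t * D i (x + t *\<^sub>R ?e))"
    proof (rule integrable_pair_bounded_support[where A = "{0..1}" and B = "cball 0 (R + 1)" and C = C])
      show "emeasure unit_interval {0..1} < \<infinity>"
        using unit_interval.emeasure_finite[of "{0..1}"] by (simp add: less_top[symmetric])
      show "emeasure lborel (cball (0 :: real ^ 'n) (R + 1)) < \<infinity>"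
        by (intro emeasure_bounded_finite bounded_cball)
      fix t :: real and x :: "real ^ 'n"
      show "\<bar>case (t, x) of (t, x) \<Rightarrow> indicat_real {0..1} t * D i (x + t *\<^sub>R ?e)\<bar> \<le> C"
        using C'[of "x + t *\<^sub>R ?e"] order_trans[OF abs_ge_zero C'] by (simp add: indicator_def)
      assume tx: "t \<notin> {0..1} \<or> x \<notin> cball 0 (R + 1)"
      have "D i (x + t *\<^sub>R ?e) = 0" if "t \<in> {0..1}"
      proof (rule D_zero)
        have "norm x \<le> norm (x + t *\<^sub>R ?e) + norm (t *\<^sub>R ?e)"
          using norm_triangle_ineq4[of "x + t *\<^sub>R ?e" "t *\<^sub>R ?e"] by simp
        then show "R < norm (x + t *\<^sub>R ?e)" using tx that by simp
      qed
      then show "(case (t, x) of (t, x) \<Rightarrow> indicat_real {0..1} t * D i (x + t *\<^sub>R ?e)) = 0"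
        by (simp add: indicator_def)
    qed (auto intro: unit_interval.sigma_finite_measure_axioms lborel.sigma_finite_measure_axioms)
    have "0 = (\<integral>x. ?f (x + ?e) \<partial>lborel) - (\<integral>x. ?f x \<partial>lborel)"
      using integral_lborel_translate[of ?f ?e] borel_measurable_continuous_onI[OF cont_f] by simp
    also have "\<dots> = (\<integral>x. ?f (x + ?e) - ?f x \<partial>lborel)"
      using int_f integrable_lborel_translate[OF int_f, of ?e] by simp
    also have "\<dots> = (\<integral>t. (\<integral>x. indicat_real {0..1} t * D i (x + t *\<^sub>R ?e) \<partial>lborel) \<partial>unit_interval)"
      unfolding line by (rule P.Fubini_integral[OF int])
    also have "\<dots> = (\<integral>t. indicat_real {0..1} t * (\<integral>x. D i x \<partial>lborel) \<partial>unit_interval)"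
      by (simp add: integral_lborel_translate)
    also have "\<dots> = (\<integral>x. D i x \<partial>lborel)"
      by (subst integral_unit_interval_restrict) (simp_all add: measure_def emeasure_unit_interval)
    finally show ?thesis by simp
  qed
  moreover have "divergence \<phi> x = (\<Sum>i\<in>UNIV. D i x)" for x
    by (simp add: divergence_def trace_def D_def)
  ultimately show ?thesis using int_D by simp
qed

lemma variation_trivial:
  fixes E :: "(real ^ 'n) set"
  assumes "ae_eq_set E {} \<or> ae_eq_set E UNIV"
  shows "variation E A = 0"
proof -
  have "(LINT x:E|lebesgue. divergence \<phi> x) = 0" if \<phi>: "\<phi> \<in> test_fields A" for \<phi>
    using assms
  proof
    assume "ae_eq_set E {}"
    then show ?thesis
      using set_integral_divergence_cong[OF _ \<phi>] by (simp add: set_lebesgue_integral_def)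
  next
    assume "ae_eq_set E UNIV"
    then have "(LINT x:E|lebesgue. divergence \<phi> x) = (LINT x:UNIV|lebesgue. divergence \<phi> x)"
      using set_integral_divergence_cong[OF _ \<phi>] by simp
    also have "\<dots> = (\<integral>x. indicat_real UNIV x * divergence \<phi> x \<partial>lborel)"
      by (rule integral_lebesgue_borel_set)
         (auto intro: borel_measurable_continuous_onI continuous_on_divergence[OF \<phi>])
    also have "\<dots> = 0" using integral_divergence_test_field[OF \<phi>] by simp
    finally show ?thesis .
  qed
  then have "variation E A = (SUP \<phi>\<in>test_fields A. (0 :: ereal))"
    unfolding variation_def by (intro SUP_cong refl) (simp add: zero_ereal_def)
  also have "\<dots> = 0"
    using zero_test_field[of A] by (intro SUP_const) blast
  finally show ?thesis .
qed

lemma perimeter_trivial: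
  fixes E :: "(real ^ 'n) set"
  assumes "ae_eq_set E {} \<or> ae_eq_set E UNIV"
  shows "perimeter E B = 0"
  unfolding perimeter_def variation_trivial[OF assms]
  by (rule INF_const) (use open_UNIV in blast)

section \<open>Borel representatives\<close>

lemma AE_lebesgue_translate:
  fixes P :: "real ^ 'n \<Rightarrow> bool"
  assumes "AE x in lebesgue. P x"
  shows "AE x in lebesgue. P (a + x)"
proof -
  have "AE x in distr lborel borel ((+) a). P x"
    by (subst lborel_distr_plus) (use assms in \<open>simp add: AE_completion_iff\<close>)
  then have "AE x in lborel. P (a + x)"
    by (rule AE_distrD[rotated]) simp
  then show ?thesis by (simp add: AE_completion_iff)
qed

lemma integral_lebesgue_eq_lborel:
  fixes f g :: "real ^ 'n \<Rightarrow> real"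
  assumes g: "g \<in> borel_measurable borel" and ae: "AE x in lebesgue. f x = g x"
  shows "(\<integral>x. f x \<partial>lebesgue) = (\<integral>x. g x \<partial>lborel)"
proof -
  have g': "g \<in> borel_measurable lebesgue"
    using g by (intro measurable_completion) simp
  have ae': "AE x in lebesgue. g x = f x" using ae by (rule eventually_mono) simp
  have "(\<integral>x. f x \<partial>lebesgue) = (\<integral>x. g x \<partial>lebesgue)"
    by (rule integral_cong_AE[OF borel_measurable_AE[OF g' ae'] g' ae])
  also have "\<dots> = (\<integral>x. g x \<partial>lborel)"
    using g by (intro integral_completion) simp
  finally show ?thesis .
qed

lemma ae_eq_set_iff_AE: "ae_eq_set A B \<longleftrightarrow> (AE x in lebesgue. x \<in> A \<longleftrightarrow> x \<in> B)"
proof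
  assume "AE x in lebesgue. x \<in> A \<longleftrightarrow> x \<in> B"
  then obtain M where M: "{x. \<not> (x \<in> A \<longleftrightarrow> x \<in> B)} \<subseteq> M" "M \<in> null_sets lebesgue"
    by (auto simp: eventually_ae_filter)
  have "A - B \<union> (B - A) \<subseteq> M" using M(1) by blast
  then show "ae_eq_set A B"
    using M(2) unfolding ae_eq_set_def by (metis negligible_iff_null_sets negligible_subset)
qed (rule ae_eq_set_AE)

text \<open>
  A Borel set that agrees with \<open>E\<close> up to a null set becomes exactly periodic when it is intersected with
  its countably many lattice translates, each of which agrees with \<open>E\<close> up to a null set.
\<close>

lemma periodic_borel_representative:
  fixes E :: "(real ^ 'n) set"
  assumes L: "L > 0" and E: "periodic_set L E" "E \<in> sets lebesgue"
  obtains F where "periodic_borel_set L F" "ae_eq_set E F"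
proof -
  obtain S N where S: "S \<in> sets borel" "negligible N" "S \<union> N = E"
    using sets_lebesgue_almost_borel[OF E(2)] by metis
  define F where "F = (\<Inter>z\<in>lattice. {x. x + L *\<^sub>R z \<in> S})"
  have ES: "AE x in lebesgue. x \<in> E \<longleftrightarrow> x \<in> S"
  proof -
    have "AE x in lebesgue. x \<notin> N"
      using S(2) by (intro AE_not_in) (simp add: negligible_iff_null_sets)
    then show ?thesis using S(3) by (auto elim!: eventually_mono)
  qed
  have shift: "AE x in lebesgue. x + L *\<^sub>R z \<in> S \<longleftrightarrow> x \<in> E" if z: "z \<in> lattice" for z
  proof -
    have 1: "AE x in lebesgue. x + L *\<^sub>R z \<in> E \<longleftrightarrow> x + L *\<^sub>R z \<in> S"
      using AE_lebesgue_translate[OF ES, of "L *\<^sub>R z"] by (simp add: add.commute)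
    have "ae_eq_set ((\<lambda>x. x + L *\<^sub>R (- z)) ` E) E"
      using E(1) z unfolding periodic_set_def lattice_def by (auto simp del: scaleR_minus_right)
    then have "AE x in lebesgue. x \<in> (\<lambda>x. x + L *\<^sub>R (- z)) ` E \<longleftrightarrow> x \<in> E"
      by (rule ae_eq_set_AE)
    moreover have "x \<in> (\<lambda>x. x + L *\<^sub>R (- z)) ` E \<longleftrightarrow> x + L *\<^sub>R z \<in> E" for x
      by (auto simp: image_iff) (metis add_diff_cancel_right')
    ultimately have "AE x in lebesgue. x + L *\<^sub>R z \<in> E \<longleftrightarrow> x \<in> E" by simp
    with 1 show ?thesis by eventually_elim simp
  qed
  have "AE x in lebesgue. \<forall>z\<in>lattice. x + L *\<^sub>R z \<in> S \<longleftrightarrow> x \<in> E"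
    by (subst AE_ball_countable[OF countable_lattice]) (use shift in blast)
  then have "AE x in lebesgue. x \<in> E \<longleftrightarrow> x \<in> F"
  proof (rule eventually_mono)
    have "\<exists>z. z \<in> (lattice :: (real ^ 'n) set)" using zero_in_lattice by blast
    then show "x \<in> E \<longleftrightarrow> x \<in> F" if "\<forall>z\<in>lattice. x + L *\<^sub>R z \<in> S \<longleftrightarrow> x \<in> E" for x
      using that by (auto simp: F_def)
  qed
  then have "ae_eq_set E F" by (simp add: ae_eq_set_iff_AE)
  moreover have "periodic_borel_set L F"
  proof
    show "L > 0" by (rule L)
    show "F \<in> sets borel"
      unfolding F_def
    proof (rule sets.countable_INT'')
      fix z :: "real ^ 'n"
      have "(\<lambda>x. x + L *\<^sub>R z) -` S \<in> sets borel"
        by (rule measurable_sets_borel[OF _ S(1)]) measurable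
      then show "{x. x + L *\<^sub>R z \<in> S} \<in> sets borel" by (simp add: vimage_def)
    qed (simp_all add: countable_lattice)
    show "periodic L (\<lambda>x. x \<in> F)"
      unfolding periodic_def
    proof (intro ballI allI)
      fix y x :: "real ^ 'n" assume y: "y \<in> lattice"
      have eq: "x + L *\<^sub>R y + L *\<^sub>R z = x + L *\<^sub>R (y + z)" for z
        by (simp add: scaleR_add_right)
      have "x + L *\<^sub>R y \<in> F \<longleftrightarrow> (\<forall>z\<in>lattice. x + L *\<^sub>R (y + z) \<in> S)"
        by (simp add: F_def eq del: scaleR_add_right)
      also have "\<dots> \<longleftrightarrow> (\<forall>z\<in>lattice. x + L *\<^sub>R z \<in> S)"
        by (metis y lattice_add lattice_diff add_diff_cancel_left' diff_add_cancel add.commute)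
      finally show "(x + L *\<^sub>R y \<in> F) = (x \<in> F)" by (simp add: F_def)
    qed
  qed
  ultimately show ?thesis using that by blast
qed

lemma (in periodic_borel_set) nonlocal_term_eq:
  fixes D :: "(real ^ 'n) set" and K k :: "real ^ 'n \<Rightarrow> real"
  assumes DE: "ae_eq_set D E" and [measurable]: "k \<in> borel_measurable borel"
    and Kk: "AE z in lebesgue. K z = k z" and k_nonneg: "\<And>z. 0 \<le> k z" and int: "integrable lborel k"
  shows "nonlocal_term K D (cube L) = (\<integral>z. translation_defect L E z * k z \<partial>lborel)"
proof -
  interpret P: pair_sigma_finite "cell L :: (real ^ 'n) measure" "lborel :: (real ^ 'n) measure" ..
  have inner: "AE x in lebesgue. indicat_real (cube L) x *\<^sub>R (\<integral>z. \<bar>indicat_real D (x + z) - indicat_real D x\<bar> * K z \<partial>lebesgue)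
      = indicat_real (cube L) x * (\<integral>z. \<bar>e (x + z) - e x\<bar> * k z \<partial>lborel)"
    using ae_eq_set_AE[OF DE]
  proof eventually_elim
    case (elim x)
    have "AE z in lebesgue. x + z \<in> D \<longleftrightarrow> x + z \<in> E"
      by (rule AE_lebesgue_translate[OF ae_eq_set_AE[OF DE]])
    then have "AE z in lebesgue. \<bar>indicat_real D (x + z) - indicat_real D x\<bar> * K z = \<bar>e (x + z) - e x\<bar> * k z"
      using Kk by eventually_elim (simp add: indicator_def elim)
    then have "(\<integral>z. \<bar>indicat_real D (x + z) - indicat_real D x\<bar> * K z \<partial>lebesgue) = (\<integral>z. \<bar>e (x + z) - e x\<bar> * k z \<partial>lborel)"
      by (rule integral_lebesgue_eq_lborel[rotated]) measurable
    then show ?case by simp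
  qed
  have int_pair: "integrable (cell L \<Otimes>\<^sub>M lborel) (\<lambda>(x, z). \<bar>e (x + z) - e x\<bar> * k z)"
  proof (rule Bochner_Integration.integrable_bound)
    show "integrable ((cell L :: (real ^ 'n) measure) \<Otimes>\<^sub>M lborel) (\<lambda>p. k (snd p))"
    proof (rule P.Fubini_integrable)
      show "AE x in (cell L :: (real ^ 'n) measure). integrable lborel (\<lambda>z. k (snd (x, z)))"
        using int by simp
    qed simp_all
    show "(\<lambda>(x, z). \<bar>e (x + z) - e x\<bar> * k z) \<in> borel_measurable (cell L \<Otimes>\<^sub>M lborel)"
      by measurable
    have "\<bar>e (x + z) - e x\<bar> * k z \<le> k z" for x z
      using k_nonneg e_range(3) by (simp add: mult_left_le_one_le)
    then show "AE p in cell L \<Otimes>\<^sub>M lborel. norm (case p of (x, z) \<Rightarrow> \<bar>e (x + z) - e x\<bar> * k z) \<le> norm (k (snd p))"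
      using k_nonneg by (auto simp: split_beta abs_mult)
  qed
  have "nonlocal_term K D (cube L) = (\<integral>x. indicat_real (cube L) x * (\<integral>z. \<bar>e (x + z) - e x\<bar> * k z \<partial>lborel) \<partial>lborel)"
    unfolding nonlocal_term_def set_lebesgue_integral_def
    by (rule integral_lebesgue_eq_lborel[OF _ inner]) measurable
  also have "\<dots> = (\<integral>x. (\<integral>z. \<bar>e (x + z) - e x\<bar> * k z \<partial>lborel) \<partial>cell L)"
    by (rule integral_cell[symmetric]) measurable
  also have "\<dots> = (\<integral>z. (\<integral>x. \<bar>e (x + z) - e x\<bar> * k z \<partial>cell L) \<partial>lborel)"
    by (rule P.Fubini_integral[OF int_pair, symmetric])
  finally show ?thesis by (simp add: translation_defect_def)
qed

text \<open>
  A Borel function that agrees with \<open>K\<close> almost everywhere may violate the lower bound on a null set, so it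
  is replaced by its maximum with that bound. The upper bound and the rotation invariance survive almost
  everywhere, which suffices for integrals.
\<close>

lemma admissible_kernel_borel_representative:
  fixes K :: "real ^ 'n \<Rightarrow> real"
  assumes K: "admissible_kernel p K" and p: "p > real CARD('n) + 1" and R: "R \<ge> 0"
  obtains k m where "k \<in> borel_measurable borel" "AE z in lebesgue. K z = k z" "\<And>z. 0 < k z"
    "integrable lborel k" "integrable lborel (\<lambda>z. norm z * k z)"
    "m > 0" "\<And>z. norm z \<le> R \<Longrightarrow> m \<le> k z"
    "\<And>v. (\<integral>z. \<bar>z \<bullet> v\<bar> * k z \<partial>lborel) = norm v * J_crit K i"
proof -
  obtain C where C: "C > 0" "\<And>z. 1 / (C * (norm z + 1) powr p) \<le> K z" "\<And>z. K z \<le> C / (norm z + 1) powr p"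
    using K by (auto simp: admissible_kernel_def)
  have K_int: "integrable lebesgue K" and rot: "\<And>Q z. rotation_matrix Q \<Longrightarrow> K (Q *v z) = K z"
    using K by (auto simp: admissible_kernel_def)
  obtain k0 where k0 [measurable]: "k0 \<in> borel_measurable borel" and Kk0: "AE z in lborel. K z = k0 z"
    using completion_ex_borel_measurable_real[of K lborel] K_int by auto
  have pos: "0 < norm z + 1" for z :: "real ^ 'n" by (simp add: add_nonneg_pos)
  define k where "k z = max (k0 z) (1 / (C * (norm z + 1) powr p))" for z
  have [measurable]: "k \<in> borel_measurable borel"
    unfolding k_def by measurable
  have k_pos: "0 < k z" for z
  proof -
    have "0 < 1 / (C * (norm z + 1) powr p)" using C(1) pos[of z] by simp
    then show ?thesis by (simp add: k_def less_max_iff_disj)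
  qed
  have Kk: "AE z in lborel. K z = k z"
    using Kk0
  proof eventually_elim
    case (elim z)
    then show ?case using C(2)[of z] by (simp add: k_def max.absorb1)
  qed
  have Kk': "AE z in lebesgue. K z = k z"
    using Kk by (rule AE_completion)
  have "integrable lebesgue k"
    by (rule integrable_cong_AE_imp[OF K_int _ Kk']) (intro measurable_completion, simp)
  then have k_int: "integrable lborel k"
    by (subst (asm) integrable_completion) simp_all
  have k_le: "AE z in lborel. k z \<le> C / (norm z + 1) powr p"
    using Kk by eventually_elim (metis C(3))
  have k_norm: "integrable lborel (\<lambda>z. norm z * k z)"
    by (rule integrable_norm_mult_power_decay[OF p _ _ k_le]) (auto intro: less_imp_le k_pos)
  have k_rot: "AE z in lborel. k (f z) = k z" if f: "orthogonal_transformation f" "det (matrix f) = 1" for f :: "real ^ 'n \<Rightarrow> real ^ 'n"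
  proof -
    have lin: "linear f" using f(1) by (rule orthogonal_transformation_linear)
    have [measurable]: "f \<in> borel_measurable borel"
      using lin by (intro borel_measurable_continuous_onI linear_continuous_on) (simp add: linear_conv_bounded_linear)
    have "rotation_matrix (matrix f)"
      using f by (simp add: rotation_matrix_def orthogonal_transformation_matrix)
    then have Kf: "K (f z) = K z" for z
      using rot[of "matrix f" z] lin by (simp add: matrix_works)
    have "AE z in distr lborel borel f. K z = k z"
      unfolding distr_orthogonal_lborel[OF f(1)] by (rule Kk)
    then have "AE z in lborel. K (f z) = k (f z)"
      by (rule AE_distrD[rotated]) measurable
    with Kk show ?thesis by eventually_elim (simp add: Kf)
  qed
  have "J_crit K i = (\<integral>z. \<bar>z $ i\<bar> * k z \<partial>lborel)"
    unfolding J_crit_def using Kk'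
    by (intro integral_lebesgue_eq_lborel) (auto elim: eventually_mono)
  then have width: "(\<integral>z. \<bar>z \<bullet> v\<bar> * k z \<partial>lborel) = norm v * J_crit K i" for v
    using integral_abs_inner_rotation_invariant[OF \<open>k \<in> borel_measurable borel\<close> k_rot] by simp
  have lower: "1 / (C * (R + 1) powr p) \<le> k z" if "norm z \<le> R" for z
  proof -
    have "(norm z + 1) powr p \<le> (R + 1) powr p"
      using that p pos[of z] by (intro powr_mono2) auto
    then have "1 / (C * (R + 1) powr p) \<le> 1 / (C * (norm z + 1) powr p)"
      using C(1) pos[of z] by (intro divide_left_mono mult_left_mono mult_pos_pos) auto
    then show ?thesis by (simp add: k_def)
  qed
  show ?thesis
    by (rule that[of k "1 / (C * (R + 1) powr p)"])
       (use Kk' k_pos k_int k_norm lower width C(1) R in auto)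
qed

section \<open>Nonnegativity above the critical constant\<close>

text \<open>
  After the mass transfer the first moments in all unit directions are at most \<open>J\<^sub>c - \<delta>\<close>, which is
  therefore nonnegative; the choice \<open>c = J\<^sub>c - \<delta> / 2\<close> keeps \<open>c\<close> positive and below \<open>J\<^sub>c\<close>.
\<close>

lemma nonlocal_term_le_perimeter_strict:
  fixes K :: "real ^ 'n \<Rightarrow> real" and E :: "(real ^ 'n) set"
  assumes p: "p > real CARD('n) + 1" and L: "L > 0" and K: "admissible_kernel p K"
    and E: "periodic_set L E" "E \<in> sets lebesgue"
  shows "\<exists>c. 0 < c \<and> c < J_crit K i \<and> ereal (nonlocal_term K E (cube L)) \<le> ereal c * perimeter E (cube L)"
    and "nonlocal_term K E (cube L) \<ge> 0"
    and "nonlocal_term K E (cube L) = 0 \<longleftrightarrow> ae_eq_set E {} \<or> ae_eq_set E UNIV"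
proof -
  obtain F where F: "periodic_borel_set L F" "ae_eq_set E F"
    using periodic_borel_representative[OF L E] by blast
  interpret periodic_borel_set L F by (rule F(1))
  have F_leb: "F \<in> sets lebesgue" using E_borel by simp
  obtain k m where k [measurable]: "k \<in> borel_measurable borel" and Kk: "AE z in lebesgue. K z = k z"
    and k_pos: "\<And>z. 0 < k z" and int: "integrable lborel k"
    and int_norm: "integrable lborel (\<lambda>z. norm z * k z)"
    and m: "m > 0" "\<And>z. norm z \<le> 2 * L \<Longrightarrow> m \<le> k z"
    and width: "\<And>v. (\<integral>z. \<bar>z \<bullet> v\<bar> * k z \<partial>lborel) = norm v * J_crit K i"
    using admissible_kernel_borel_representative[OF K p, of "2 * L" i] L by auto
  have N_eq: "nonlocal_term K E (cube L) = (\<integral>z. translation_defect L F z * k z \<partial>lborel)"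
    by (rule nonlocal_term_eq[OF F(2) k Kk less_imp_le[OF k_pos] int])
  show nonneg: "nonlocal_term K E (cube L) \<ge> 0"
    unfolding N_eq by (intro Bochner_Integration.integral_nonneg mult_nonneg_nonneg translation_defect_nonneg less_imp_le[OF k_pos])
  obtain k' \<delta> where k' [measurable]: "k' \<in> borel_measurable borel" and k'_nonneg: "\<And>z. 0 \<le> k' z"
    and int': "integrable lborel k'" and int_norm': "integrable lborel (\<lambda>z. norm z * k' z)" and \<delta>: "\<delta> > 0"
    and N': "(\<integral>z. translation_defect L F z * k' z \<partial>lborel) = (\<integral>z. translation_defect L F z * k z \<partial>lborel)"
    and width': "\<And>v. (\<integral>z. \<bar>z \<bullet> v\<bar> * k' z \<partial>lborel) \<le> (\<integral>z. \<bar>z \<bullet> v\<bar> * k z \<partial>lborel) - \<delta> * norm v"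
    using kernel_mass_transfer[OF k less_imp_le[OF k_pos] int int_norm m] by blast
  define \<kappa> where "\<kappa> = density lborel (\<lambda>z. ennreal (k' z))"
  have integral_\<kappa>: "(\<integral>z. f z \<partial>\<kappa>) = (\<integral>z. f z * k' z \<partial>lborel)"
    if [measurable]: "f \<in> borel_measurable borel" for f :: "real ^ 'n \<Rightarrow> real"
    unfolding \<kappa>_def by (subst integral_density) (simp_all add: k'_nonneg mult.commute)
  have \<kappa>: "sets \<kappa> = sets borel" "finite_measure \<kappa>" "integrable \<kappa> norm"
  proof -
    show "sets \<kappa> = sets borel" by (simp add: \<kappa>_def)
    show "finite_measure \<kappa>"
    proof (rule finite_measureI)
      have "emeasure \<kappa> (space \<kappa>) = (\<integral>\<^sup>+z. ennreal (k' z) \<partial>lborel)"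
        by (simp add: \<kappa>_def emeasure_density)
      also have "\<dots> < \<infinity>"
        using int' k'_nonneg by (simp add: nn_integral_eq_integral)
      finally show "emeasure \<kappa> (space \<kappa>) \<noteq> \<infinity>" by simp
    qed
    show "integrable \<kappa> norm"
      unfolding \<kappa>_def using int_norm' by (subst integrable_density) (simp_all add: k'_nonneg mult.commute)
  qed
  show "\<exists>c. 0 < c \<and> c < J_crit K i \<and> ereal (nonlocal_term K E (cube L)) \<le> ereal c * perimeter E (cube L)"
  proof (intro exI conjI)
    define c where "c = J_crit K i - \<delta> / 2"
    have "0 \<le> (\<integral>z. \<bar>z \<bullet> (axis i 1 :: real ^ 'n)\<bar> * k' z \<partial>lborel)"
      by (intro Bochner_Integration.integral_nonneg mult_nonneg_nonneg k'_nonneg) simp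
    also have "\<dots> \<le> J_crit K i - \<delta>"
      using width'[of "axis i 1"] width[of "axis i 1"] by simp
    finally have c_pos: "0 < J_crit K i - \<delta> / 2" using \<delta> by simp
    then show "0 < c" by (simp add: c_def)
    show "c < J_crit K i" using \<delta> by (simp add: c_def)
    have width_c: "(\<integral>z. \<bar>z \<bullet> v\<bar> \<partial>\<kappa>) \<le> c * norm v" for v
    proof -
      have "(\<integral>z. \<bar>z \<bullet> v\<bar> \<partial>\<kappa>) \<le> norm v * J_crit K i - \<delta> * norm v"
        using width'[of v] by (simp add: integral_\<kappa> width)
      also have "\<dots> \<le> c * norm v"
      proof -
        have "0 \<le> \<delta> * norm v" using \<delta> by simp
        then show ?thesis by (simp add: c_def algebra_simps)
      qed
      finally show ?thesis .
    qed
    let ?N = "nonlocal_term K E (cube L)"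
    have N_\<kappa>: "?N = (\<integral>z. translation_defect L F z \<partial>\<kappa>)"
      using N_eq N' by (simp add: integral_\<kappa>)
    have "ereal (?N / c) \<le> variation E A" if A: "open A" "cube L \<subseteq> A" for A
    proof -
      have "ereal ?N \<le> ereal c * variation F A"
        unfolding N_\<kappa> by (rule integral_translation_defect_le_variation[OF \<kappa> \<open>0 < c\<close> width_c A])
      then have "ereal ?N \<le> ereal c * variation E A"
        by (simp add: variation_cong[OF F(2) F_leb])
      then show ?thesis
        using \<open>0 < c\<close> by (cases "variation E A") (auto simp: divide_le_eq mult.commute)
    qed
    then have "ereal (?N / c) \<le> perimeter E (cube L)"
      unfolding perimeter_def by (intro INF_greatest) auto
    then have "ereal c * ereal (?N / c) \<le> ereal c * perimeter E (cube L)"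
      using \<open>0 < c\<close> by (intro ereal_mult_left_mono) auto
    then show "ereal ?N \<le> ereal c * perimeter E (cube L)"
      using \<open>0 < c\<close> by simp
  qed
  have EF: "AE x in lebesgue. x \<in> E \<longleftrightarrow> x \<in> F" by (rule ae_eq_set_AE[OF F(2)])
  have triv: "ae_eq_set E G \<longleftrightarrow> (AE x in lebesgue. x \<in> F \<longleftrightarrow> x \<in> G)" for G
  proof -
    have "ae_eq_set E G \<longleftrightarrow> (AE x in lebesgue. x \<in> E \<longleftrightarrow> x \<in> G)"
      by (rule ae_eq_set_iff_AE)
    also have "\<dots> \<longleftrightarrow> (AE x in lebesgue. x \<in> F \<longleftrightarrow> x \<in> G)"
      using EF by (intro iffI; elim eventually_rev_mp eventually_mono; blast)
    finally show ?thesis .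
  qed
  show "nonlocal_term K E (cube L) = 0 \<longleftrightarrow> ae_eq_set E {} \<or> ae_eq_set E UNIV"
  proof
    have intN: "integrable lborel (\<lambda>z. translation_defect L F z * k z)"
      by (rule integrable_translation_defect_mult[OF k less_imp_le[OF k_pos] int])
    assume "nonlocal_term K E (cube L) = 0"
    then have "negligible F \<or> negligible (- F)"
      using integral_translation_defect_zero[OF k k_pos intN] N_eq by simp
    moreover have "ae_eq_set E {}" if "negligible F"
      using that unfolding triv by (intro AE_I'[of F]) (auto simp: negligible_iff_null_sets)
    moreover have "ae_eq_set E UNIV" if "negligible (- F)"
      using that unfolding triv by (intro AE_I'[of "- F"]) (auto simp: negligible_iff_null_sets)
    ultimately show "ae_eq_set E {} \<or> ae_eq_set E UNIV" by blast
  next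
    assume "ae_eq_set E {} \<or> ae_eq_set E UNIV"
    then have "nonlocal_term K E (cube L) = 0"
    proof
      assume E0: "ae_eq_set E {}"
      interpret Z: periodic_borel_set L "{} :: (real ^ 'n) set"
        by standard (auto simp: L periodic_def)
      show ?thesis
        using Z.nonlocal_term_eq[OF E0 k Kk less_imp_le[OF k_pos] int] by (simp add: translation_defect_def)
    next
      assume E1: "ae_eq_set E UNIV"
      interpret U: periodic_borel_set L "UNIV :: (real ^ 'n) set"
        by standard (auto simp: L periodic_def)
      show ?thesis
        using U.nonlocal_term_eq[OF E1 k Kk less_imp_le[OF k_pos] int] by (simp add: translation_defect_def)
    qed
    then show "nonlocal_term K E (cube L) = 0" .
  qed
qed

theorem theorem4p2:
  fixes K :: "real ^ 'n \<Rightarrow> real" and i :: 'n and p L J :: real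
  assumes "p > real CARD('n) + 1" and "L > 0"
    and "admissible_kernel p K"
    and "J \<ge> J_crit K i"
  shows "\<forall>E :: (real ^ 'n) set. periodic_set L E \<and> locally_finite_perimeter E \<longrightarrow>
           functional J K E (cube L) \<ge> 0 \<and>
           (functional J K E (cube L) = 0 \<longleftrightarrow> ae_eq_set E {} \<or> ae_eq_set E UNIV)"
proof (intro allI impI, elim conjE)
  fix E :: "(real ^ 'n) set"
  assume per: "periodic_set L E" and lfp: "locally_finite_perimeter E"
  have E: "E \<in> sets lebesgue" using lfp by (simp add: locally_finite_perimeter_def)
  note nl = nonlocal_term_le_perimeter_strict[OF assms(1-3) per E]
  define N where "N = nonlocal_term K E (cube L)"
  obtain c where c: "0 < c" "c < J_crit K i" "ereal N \<le> ereal c * perimeter E (cube L)"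
    using nl(1)[of i] by (auto simp: N_def)
  \<comment> \<open>The perimeter is finite on compact sets, and the half-open cube lies in one.\<close>
  let ?Q = "cbox 0 (\<chi> i. L) :: (real ^ 'n) set"
  have "cube L \<subseteq> ?Q"
    by (auto simp: mem_box_cart cube_def less_imp_le)
  then have "perimeter E (cube L) \<le> perimeter E ?Q"
    unfolding perimeter_def by (intro INF_superset_mono) auto
  also have "\<dots> < \<infinity>"
    using lfp by (simp add: locally_finite_perimeter_def)
  finally obtain P where P: "perimeter E (cube L) = ereal P"
    using perimeter_nonneg[of E "cube L"] by (cases "perimeter E (cube L)") auto
  have "P \<ge> 0" using perimeter_nonneg[of E "cube L"] by (simp add: P)
  have NP: "N \<le> c * P" using c(3) by (simp add: P)
  have vol: "measure lebesgue (cube L :: (real ^ 'n) set) = L ^ CARD('n)"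
    using emeasure_lborel_cube[OF assms(2), where 'n = 'n] assms(2) by (simp add: measure_def)
  have F: "functional J K E (cube L) = ereal ((J * P - N) / L ^ CARD('n))"
    by (simp add: functional_def vol P N_def divide_inverse mult.commute)
  have "c * P \<le> J * P" using c assms(4) \<open>P \<ge> 0\<close> by (intro mult_right_mono) auto
  then have "0 \<le> functional J K E (cube L)"
    using NP assms(2) by (simp add: F)
  moreover have "functional J K E (cube L) = 0 \<longleftrightarrow> J * P = N"
    using assms(2) by (simp add: F)
  moreover have "J * P = N \<longleftrightarrow> ae_eq_set E {} \<or> ae_eq_set E UNIV"
  proof
    assume eq: "J * P = N"
    then have "(J - c) * P \<le> 0" using NP by (simp add: left_diff_distrib)
    moreover have "J - c > 0" using c assms(4) by simp
    ultimately have "P = 0" using \<open>P \<ge> 0\<close> by (simp add: mult_le_0_iff)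
    then have "N = 0" using eq by simp
    then show "ae_eq_set E {} \<or> ae_eq_set E UNIV" using nl(3) by (simp add: N_def)
  next
    assume triv: "ae_eq_set E {} \<or> ae_eq_set E UNIV"
    then have "P = 0" using perimeter_trivial[OF triv, of "cube L"] by (simp add: P)
    moreover have "N = 0" using nl(3) triv by (simp add: N_def)
    ultimately show "J * P = N" by simp
  qed
  ultimately show "functional J K E (cube L) \<ge> 0 \<and>
      (functional J K E (cube L) = 0 \<longleftrightarrow> ae_eq_set E {} \<or> ae_eq_set E UNIV)" by simp
qed

end
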